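(* Let $\alpha\ge0$, let $(Z_k)_{k\ge1}$ be independent one-dimensional standard Gaussian random variables, and define the probability measure $\nu^N_\infty$ on $\mathcal H_1^\perp$ by $$\nu^N_\infty=\mathrm{Law}\left(\sum_{k=2}^\infty(1+\lambda^N_k)^{-\alpha/2}(2\lambda^N_k)^{-1/2}Z_k\,\phi^N_k\right).$$ Let $u$ be a solution to the SPDE on $F$ with Neumann boundary conditions $$du(t)=L_Nu(t)\,dt+(1-L_N)^{-\alpha/2}\,dW(t),\qquad u(0)=u_0,$$ where $u_0$ is an $\mathcal H$-valued random variable independent of $W$. Then there exists a one-dimensional standard Wiener process $B=(B(t))_{t\ge0}$ which is adapted to the filtration generated by $W$ such that $B$ and $u-B$ are independent processes, and such that if $u$ has initial distribution $u_0\sim\nu\star\nu^N_\infty$ for some probability measure $\nu$ on $\mathcal H_1$ then $u(t)-B(t)\sim\nu\star\nu^N_\infty$ for all $t>0$. Moreover, if $u$ has initial distribution $u_0\sim\nu_0$ for some probability measure $\nu_0$ on $\mathcal H$ then $u(t)-B(t)$ converges weakly to $(\pi_1^*\nu_0)\star\nu^N_\infty$ as $t\to\infty$.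
   Context: Setting. Let $M\ge2$, $I=\{1,\dots,M\}$, let $F$ be a connected compact metric space and $\psi_i:F\to F$ ($i\in I$) injective strict contractions with $F=\bigcup_i\psi_i(F)$. Let $\mathbb W_n=I^n$ ($\mathbb W_0$ contains only the empty word), $\mathbb W_*=\bigcup_{n\ge0}\mathbb W_n$, $\mathbb W=I^{\mathbb N}$. For $w=w_1\dots w_n\in\mathbb W_*$ put $\psi_w=\psi_{w_1}\circ\dots\circ\psi_{w_n}$, $F_w=\psi_w(F)$. Let $\pi:\mathbb W\to F$ be given by $\{\pi(w)\}=\bigcap_nF_{w_1\dots w_n}$. With $\sigma$ the left shift on $\mathbb W$, the post-critical set is $P=\bigcup_{n\ge1}\sigma^n\big(\pi^{-1}(\bigcup_{i\ne j}F_i\cap F_j)\big)$; assume $P$ is finite (so $(F,(\psi_i))$ is a connected post-critically finite self-similar set). Put $F^0=\pi(P)$, $F^n=\bigcup_{w\in\mathbb W_n}\psi_w(F^0)$. Let $(A_0,\mathbf r)$ be a regular irreducible harmonic structure: $\mathbf r=(r_1,\dots,r_M)$ with all $r_i\in(0,1)$; $A_0$ is a real symmetric matrix indexed by $F^0$, non-positive definite, with non-negative off-diagonal entries and kernel exactly the constants; and, with $\mathcal E_0(f,g)=-\sum_{x,y\in F^0}f(x)A_0(x,y)g(y)$, $r_w=\prod_ir_{w_i}$ and $\mathcal E_n(f,g)=\sum_{w\in\mathbb W_n}r_w^{-1}\mathcal E_0(f\circ\psi_w|_{F^0},g\circ\psi_w|_{F^0})$ for $f,g:F^n\to\mathbb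 R$, one has $\mathcal E_0(f,f)=\min\{\mathcal E_1(g,g):g|_{F^0}=f\}$ for all $f$. Let $\mathcal D=\{f\in C(F):\lim_n\mathcal E_n(f|_{F^n},f|_{F^n})<\infty\}$, $\mathcal E(f,g)=\lim_n\mathcal E_n(f|_{F^n},g|_{F^n})$. Let $d_H>0$ be the unique number with $\sum_ir_i^{d_H}=1$, and $\mu$ the Borel probability measure on $F$ with $\mu(F_w)=r_w^{d_H}$ for all $w\in\mathbb W_*$. Then $(\mathcal E,\mathcal D)$ is a regular local Dirichlet form on $\mathcal H:=L^2(F,\mu)$. Let $-L_N$ be the associated non-negative self-adjoint operator and $S^N_t=\exp(tL_N)$. $(\phi^N_k)_{k\ge1}$ is a complete orthonormal basis of $\mathcal H$ of eigenfunctions of $-L_N$ with eigenvalues $0=\lambda^N_1<\lambda^N_2\le\lambda^N_3\le\cdots\to\infty$, and $\phi^N_1\equiv1$. $\mathcal H_1\subseteq\mathcal H$ is the span of $\phi^N_1$ (the constant functions), $\mathcal H_1^\perp$ its orthogonal complement, $\pi_1:\mathcal H\to\mathcal H_1$ the orthogonal projection, and $\pi_1^*\nu_0$ the pushforward of $\nu_0$ under $\pi_1$. $\star$ is convolution of measures on $\mathcal H$. Scalars $c\in\mathbb R$ are identified with the constant functions $c\phi^N_1\in\mathcal H$, so $u(t)-B(t)$ is $\mathcal H$-valued. $W$ is a cylindrical Wiener process on $\mathcal H$ (identity covariance). A (mild, global) solution is an $\mathcal H$-valued predictable process with $u(t)=S^N_tu_0+\int_0^tS^N_{t-s}(1-L_N)^{-\alpha/2}dW(s)$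 almost surely for every $t\ge0$. *)

theory Defs
  imports "HOL-Probability.Probability"
begin

section \<open>Connected post-critically finite self-similar sets\<close>

text \<open>
  The space \<open>F\<close> is the whole type. Letters are \<open>1, \<dots>, M\<close>; a finite word is a list of letters, an
  infinite word is a function \<open>w\<close> on the naturals whose first letter is \<open>w 0\<close>.
\<close>

definition words :: "nat \<Rightarrow> nat \<Rightarrow> nat list set" where
  "words M n = {w. length w = n \<and> set w \<subseteq> {1..M}}"

definition inf_words :: "nat \<Rightarrow> (nat \<Rightarrow> nat) set" where
  "inf_words M = {w. range w \<subseteq> {1..M}}"

definition psi_word :: "(nat \<Rightarrow> 'a \<Rightarrow> 'a) \<Rightarrow> nat list \<Rightarrow> 'a \<Rightarrow> 'a" where
  "psi_word \<psi> w = foldr (\<lambda>i f. \<psi> i \<circ> f) w id"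

definition cell :: "(nat \<Rightarrow> 'a \<Rightarrow> 'a) \<Rightarrow> nat list \<Rightarrow> 'a set" where
  "cell \<psi> w = range (psi_word \<psi> w)"

definition coding :: "(nat \<Rightarrow> 'a \<Rightarrow> 'a) \<Rightarrow> (nat \<Rightarrow> nat) \<Rightarrow> 'a" where
  "coding \<psi> w = (THE x. x \<in> (\<Inter>n. cell \<psi> (map w [0..<n])))"

definition post_critical :: "nat \<Rightarrow> (nat \<Rightarrow> 'a \<Rightarrow> 'a) \<Rightarrow> (nat \<Rightarrow> nat) set" where
  "post_critical M \<psi> =
    (\<Union>n\<in>{1..}. (\<lambda>w k. w (k + n)) `
      {w \<in> inf_words M. coding \<psi> w \<in>
        (\<Union>i\<in>{1..M}. \<Union>j\<in>{1..M} - {i}. range (\<psi> i) \<inter> range (\<psi> j))})"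

definition bdry :: "nat \<Rightarrow> (nat \<Rightarrow> 'a \<Rightarrow> 'a) \<Rightarrow> 'a set" where
  "bdry M \<psi> = coding \<psi> ` post_critical M \<psi>"

locale pcf_self_similar =
  fixes M :: nat and \<psi> :: "nat \<Rightarrow> 'a::metric_space \<Rightarrow> 'a"
  assumes two_le_M: "2 \<le> M"
    and compact_F: "compact (UNIV :: 'a set)"
    and connected_F: "connected (UNIV :: 'a set)"
    and inj_psi: "\<And>i. i \<in> {1..M} \<Longrightarrow> inj (\<psi> i)"
    and contraction_psi: "\<And>i. i \<in> {1..M} \<Longrightarrow> \<exists>c<1. c-lipschitz_on UNIV (\<psi> i)"
    and cover: "(\<Union>i\<in>{1..M}. range (\<psi> i)) = UNIV"
    and finite_post_critical: "finite (post_critical M \<psi>)"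


section \<open>Harmonic structures and the Dirichlet form\<close>

text \<open>
  Functions on the finite sets \<open>F\<^sup>n\<close> are represented by arbitrary functions on \<open>F\<close>; the forms below
  only look at their values on \<open>F\<^sup>n\<close>.
\<close>

definition E0 :: "nat \<Rightarrow> (nat \<Rightarrow> 'a \<Rightarrow> 'a) \<Rightarrow> ('a \<Rightarrow> 'a \<Rightarrow> real) \<Rightarrow> ('a \<Rightarrow> real) \<Rightarrow> ('a \<Rightarrow> real) \<Rightarrow> real"
  where "E0 M \<psi> A0 f g = - (\<Sum>x\<in>bdry M \<psi>. \<Sum>y\<in>bdry M \<psi>. f x * A0 x y * g y)"

definition r_word :: "(nat \<Rightarrow> real) \<Rightarrow> nat list \<Rightarrow> real" where
  "r_word r w = prod_list (map r w)"

definition En :: "nat \<Rightarrow> (nat \<Rightarrow> 'a \<Rightarrow> 'a) \<Rightarrow> (nat \<Rightarrow> real) \<Rightarrow> ('a \<Rightarrow> 'a \<Rightarrow> real) \<Rightarrow> nat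
    \<Rightarrow> ('a \<Rightarrow> real) \<Rightarrow> ('a \<Rightarrow> real) \<Rightarrow> real"
  where "En M \<psi> r A0 n f g =
    (\<Sum>w\<in>words M n. inverse (r_word r w) * E0 M \<psi> A0 (f \<circ> psi_word \<psi> w) (g \<circ> psi_word \<psi> w))"

locale regular_irreducible_harmonic_structure = pcf_self_similar M \<psi>
  for M :: nat and \<psi> :: "nat \<Rightarrow> 'a::metric_space \<Rightarrow> 'a" +
  fixes r :: "nat \<Rightarrow> real" and A0 :: "'a \<Rightarrow> 'a \<Rightarrow> real"
  assumes r_range: "\<And>i. i \<in> {1..M} \<Longrightarrow> 0 < r i \<and> r i < 1"
    and A0_sym: "\<And>x y. x \<in> bdry M \<psi> \<Longrightarrow> y \<in> bdry M \<psi> \<Longrightarrow> A0 x y = A0 y x"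
    and A0_nonpos: "\<And>f. (\<Sum>x\<in>bdry M \<psi>. \<Sum>y\<in>bdry M \<psi>. f x * A0 x y * f y) \<le> 0"
    and A0_offdiag: "\<And>x y. x \<in> bdry M \<psi> \<Longrightarrow> y \<in> bdry M \<psi> \<Longrightarrow> x \<noteq> y \<Longrightarrow> 0 \<le> A0 x y"
    and A0_kernel: "\<And>f. (\<forall>x\<in>bdry M \<psi>. (\<Sum>y\<in>bdry M \<psi>. A0 x y * f y) = 0)
                       \<longleftrightarrow> (\<exists>c. \<forall>x\<in>bdry M \<psi>. f x = c)"
    and harmonic_attained:
      "\<And>f. \<exists>g. (\<forall>x\<in>bdry M \<psi>. g x = f x) \<and> En M \<psi> r A0 1 g g = E0 M \<psi> A0 f f"
    and harmonic_minimal: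
      "\<And>f g. (\<forall>x\<in>bdry M \<psi>. g x = f x) \<Longrightarrow> E0 M \<psi> A0 f f \<le> En M \<psi> r A0 1 g g"

definition form_domain :: "nat \<Rightarrow> (nat \<Rightarrow> 'a::topological_space \<Rightarrow> 'a) \<Rightarrow> (nat \<Rightarrow> real)
    \<Rightarrow> ('a \<Rightarrow> 'a \<Rightarrow> real) \<Rightarrow> ('a \<Rightarrow> real) set"
  where "form_domain M \<psi> r A0 =
    {f. continuous_on UNIV f \<and> convergent (\<lambda>n. En M \<psi> r A0 n f f)}"

definition energy :: "nat \<Rightarrow> (nat \<Rightarrow> 'a \<Rightarrow> 'a) \<Rightarrow> (nat \<Rightarrow> real) \<Rightarrow> ('a \<Rightarrow> 'a \<Rightarrow> real)
    \<Rightarrow> ('a \<Rightarrow> real) \<Rightarrow> ('a \<Rightarrow> real) \<Rightarrow> real"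
  where "energy M \<psi> r A0 f g = lim (\<lambda>n. En M \<psi> r A0 n f g)"

locale self_similar_measure = regular_irreducible_harmonic_structure M \<psi> r A0
  for M :: nat and \<psi> :: "nat \<Rightarrow> 'a::metric_space \<Rightarrow> 'a"
    and r :: "nat \<Rightarrow> real" and A0 :: "'a \<Rightarrow> 'a \<Rightarrow> real" +
  fixes dH :: real and \<mu> :: "'a measure"
  assumes dH_pos: "0 < dH"
    and dH_eq: "(\<Sum>i\<in>{1..M}. r i powr dH) = 1"
    and sets_mu: "sets \<mu> = sets borel"
    and prob_mu: "prob_space \<mu>"
    and mu_cell: "\<And>n w. w \<in> words M n \<Longrightarrow> measure \<mu> (cell \<psi> w) = r_word r w powr dH"


section \<open>The Hilbert space of square integrable functions\<close>

text \<open>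
  Elements of \<open>L\<^sup>2(\<mu>)\<close> are given by representatives. The topology is that of the seminorm, so open
  sets, Borel sets and continuous functions do not distinguish almost everywhere equal
  representatives: the Borel sets (hence the laws) and the continuous functions are exactly those of
  the quotient.
\<close>

definition L2 :: "'a measure \<Rightarrow> ('a \<Rightarrow> real) set" where
  "L2 \<mu> = {f \<in> borel_measurable \<mu>. integrable \<mu> (\<lambda>x. (f x)\<^sup>2)}"

definition l2_inner :: "'a measure \<Rightarrow> ('a \<Rightarrow> real) \<Rightarrow> ('a \<Rightarrow> real) \<Rightarrow> real" where
  "l2_inner \<mu> f g = (\<integral>x. f x * g x \<partial>\<mu>)"

definition l2_norm :: "'a measure \<Rightarrow> ('a \<Rightarrow> real) \<Rightarrow> real" where
  "l2_norm \<mu> f = sqrt (l2_inner \<mu> f f)"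

definition l2_topology :: "'a measure \<Rightarrow> ('a \<Rightarrow> real) topology" where
  "l2_topology \<mu> = topology (\<lambda>U. U \<subseteq> L2 \<mu> \<and>
     (\<forall>f\<in>U. \<exists>e>0. \<forall>g\<in>L2 \<mu>. l2_norm \<mu> (\<lambda>x. g x - f x) < e \<longrightarrow> g \<in> U))"

lemma openin_l2_topology:
  "openin (l2_topology \<mu>) U \<longleftrightarrow> U \<subseteq> L2 \<mu> \<and>
     (\<forall>f\<in>U. \<exists>e>0. \<forall>g\<in>L2 \<mu>. l2_norm \<mu> (\<lambda>x. g x - f x) < e \<longrightarrow> g \<in> U)"
proof -
  let ?P = "\<lambda>U. U \<subseteq> L2 \<mu> \<and>
     (\<forall>f\<in>U. \<exists>e>0. \<forall>g\<in>L2 \<mu>. l2_norm \<mu> (\<lambda>x. g x - f x) < e \<longrightarrow> g \<in> U)"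
  have "?P (S \<inter> T)" if S: "?P S" and T: "?P T" for S T
  proof (intro conjI ballI)
    show "S \<inter> T \<subseteq> L2 \<mu>" using S by blast
    fix f assume f: "f \<in> S \<inter> T"
    obtain e1 where e1: "e1 > 0" "\<forall>g\<in>L2 \<mu>. l2_norm \<mu> (\<lambda>x. g x - f x) < e1 \<longrightarrow> g \<in> S"
      using S f by blast
    obtain e2 where e2: "e2 > 0" "\<forall>g\<in>L2 \<mu>. l2_norm \<mu> (\<lambda>x. g x - f x) < e2 \<longrightarrow> g \<in> T"
      using T f by blast
    show "\<exists>e>0. \<forall>g\<in>L2 \<mu>. l2_norm \<mu> (\<lambda>x. g x - f x) < e \<longrightarrow> g \<in> S \<inter> T"
      using e1 e2 by (intro exI[of _ "min e1 e2"]) auto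
  qed
  moreover have "?P (\<Union>K)" if K: "\<forall>S\<in>K. ?P S" for K
  proof (intro conjI ballI)
    show "\<Union>K \<subseteq> L2 \<mu>" using K by blast
    fix f assume "f \<in> \<Union>K"
    then obtain S where S: "S \<in> K" "f \<in> S" by blast
    then obtain e where "e > 0" "\<forall>g\<in>L2 \<mu>. l2_norm \<mu> (\<lambda>x. g x - f x) < e \<longrightarrow> g \<in> S"
      using K by blast
    then show "\<exists>e>0. \<forall>g\<in>L2 \<mu>. l2_norm \<mu> (\<lambda>x. g x - f x) < e \<longrightarrow> g \<in> \<Union>K"
      using S by blast
  qed
  ultimately have "istopology ?P"
    unfolding istopology_def by blast
  then show ?thesis
    by (simp add: l2_topology_def topology_inverse')
qed

lemma topspace_l2_topology [simp]: "topspace (l2_topology \<mu>) = L2 \<mu>"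
proof
  show "topspace (l2_topology \<mu>) \<subseteq> L2 \<mu>"
    using openin_topspace[of "l2_topology \<mu>"] openin_l2_topology by blast
  have "openin (l2_topology \<mu>) (L2 \<mu>)"
    unfolding openin_l2_topology by (auto intro: exI[of _ 1])
  then show "L2 \<mu> \<subseteq> topspace (l2_topology \<mu>)"
    by (rule openin_subset)
qed

definition L2_borel :: "'a measure \<Rightarrow> ('a \<Rightarrow> real) measure" where
  "L2_borel \<mu> = sigma (L2 \<mu>) {U. openin (l2_topology \<mu>) U}"

definition has_l2_limit :: "'a measure \<Rightarrow> (nat \<Rightarrow> 'a \<Rightarrow> real) \<Rightarrow> ('a \<Rightarrow> real) \<Rightarrow> bool" where
  "has_l2_limit \<mu> X f \<longleftrightarrow> f \<in> L2 \<mu> \<and> (\<lambda>n. l2_norm \<mu> (\<lambda>x. X n x - f x)) \<longlonglongrightarrow> 0"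

text \<open>A representative of the limit; divergent sequences get the limit \<open>0\<close>.\<close>

definition l2_lim :: "'a measure \<Rightarrow> (nat \<Rightarrow> 'a \<Rightarrow> real) \<Rightarrow> 'a \<Rightarrow> real" where
  "l2_lim \<mu> X = (if \<exists>f. has_l2_limit \<mu> X f then (SOME f. has_l2_limit \<mu> X f) else (\<lambda>_. 0))"

definition l2_proj :: "'a measure \<Rightarrow> ('a \<Rightarrow> real) set \<Rightarrow> ('a \<Rightarrow> real) \<Rightarrow> 'a \<Rightarrow> real" where
  "l2_proj \<mu> S f = (SOME g. g \<in> S \<and> (\<forall>h\<in>S. l2_inner \<mu> (\<lambda>x. f x - g x) h = 0))"

definition l2_convolution ::
    "'a measure \<Rightarrow> ('a \<Rightarrow> real) measure \<Rightarrow> ('a \<Rightarrow> real) measure \<Rightarrow> ('a \<Rightarrow> real) measure"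
  where "l2_convolution \<mu> \<nu>1 \<nu>2 =
    distr (\<nu>1 \<Otimes>\<^sub>M \<nu>2) (L2_borel \<mu>) (\<lambda>(f, g). \<lambda>x. f x + g x)"

definition l2_prob :: "'a measure \<Rightarrow> ('a \<Rightarrow> real) measure \<Rightarrow> bool" where
  "l2_prob \<mu> \<nu> \<longleftrightarrow> prob_space \<nu> \<and> sets \<nu> = sets (L2_borel \<mu>)"

definition l2_weak_conv :: "'a measure \<Rightarrow> ('t \<Rightarrow> ('a \<Rightarrow> real) measure) \<Rightarrow> ('a \<Rightarrow> real) measure
    \<Rightarrow> 't filter \<Rightarrow> bool"
  where "l2_weak_conv \<mu> \<nu> \<nu>' G \<longleftrightarrow>
    (\<forall>\<Phi>. continuous_map (l2_topology \<mu>) euclideanreal \<Phi> \<and> bounded (\<Phi> ` L2 \<mu>) \<longrightarrow>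
       ((\<lambda>t. \<integral>f. \<Phi> f \<partial>(\<nu> t)) \<longlongrightarrow> (\<integral>f. \<Phi> f \<partial>\<nu>')) G)"

definition complete_orthonormal :: "'a measure \<Rightarrow> (nat \<Rightarrow> 'a \<Rightarrow> real) \<Rightarrow> bool" where
  "complete_orthonormal \<mu> \<phi> \<longleftrightarrow>
    (\<forall>k\<ge>1. \<phi> k \<in> L2 \<mu>) \<and>
    (\<forall>j\<ge>1. \<forall>k\<ge>1. l2_inner \<mu> (\<phi> j) (\<phi> k) = (if j = k then 1 else 0)) \<and>
    (\<forall>f\<in>L2 \<mu>. (\<forall>k\<ge>1. l2_inner \<mu> f (\<phi> k) = 0) \<longrightarrow> (AE x in \<mu>. f x = 0))"


section \<open>The Neumann Laplacian and its spectral calculus\<close>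

text \<open>
  Graph of the non-negative self-adjoint operator associated with the Dirichlet form:
  \<open>neg_laplacian \<dots> f h\<close> says that \<open>f\<close> is in the domain and is mapped to \<open>h\<close>. The form domain consists
  of continuous functions, so \<open>f\<close> has to be identified with its continuous version.
\<close>

definition neg_laplacian :: "nat \<Rightarrow> (nat \<Rightarrow> 'a::topological_space \<Rightarrow> 'a) \<Rightarrow> (nat \<Rightarrow> real)
    \<Rightarrow> ('a \<Rightarrow> 'a \<Rightarrow> real) \<Rightarrow> 'a measure \<Rightarrow> ('a \<Rightarrow> real) \<Rightarrow> ('a \<Rightarrow> real) \<Rightarrow> bool"
  where "neg_laplacian M \<psi> r A0 \<mu> f h \<longleftrightarrow> f \<in> L2 \<mu> \<and> h \<in> L2 \<mu> \<and>
    (\<exists>f'\<in>form_domain M \<psi> r A0. (AE x in \<mu>. f' x = f x) \<and>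
       (\<forall>g\<in>form_domain M \<psi> r A0. energy M \<psi> r A0 f' g = l2_inner \<mu> h g))"

locale neumann_eigenbasis = self_similar_measure M \<psi> r A0 dH \<mu>
  for M :: nat and \<psi> :: "nat \<Rightarrow> 'a::metric_space \<Rightarrow> 'a"
    and r :: "nat \<Rightarrow> real" and A0 :: "'a \<Rightarrow> 'a \<Rightarrow> real" and dH :: real and \<mu> :: "'a measure" +
  fixes \<phi> :: "nat \<Rightarrow> 'a \<Rightarrow> real" and lam :: "nat \<Rightarrow> real"
  assumes basis: "complete_orthonormal \<mu> \<phi>"
    and eigen: "\<And>k. 1 \<le> k \<Longrightarrow> neg_laplacian M \<psi> r A0 \<mu> (\<phi> k) (\<lambda>x. lam k * \<phi> k x)"
    and lam_1: "lam 1 = 0"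
    and lam_2: "0 < lam 2"
    and lam_mono: "\<And>k. 2 \<le> k \<Longrightarrow> lam k \<le> lam (Suc k)"
    and lam_top: "filterlim lam at_top sequentially"
    and phi_1: "AE x in \<mu>. \<phi> 1 x = 1"

text \<open>
  Functional calculus of the self-adjoint operator with complete orthonormal eigenbasis \<open>\<phi>\<close> and
  eigenvalues \<open>lam\<close>, for bounded functions \<open>p\<close> of the operator.
\<close>

definition spectral_op :: "'a measure \<Rightarrow> (nat \<Rightarrow> 'a \<Rightarrow> real) \<Rightarrow> (nat \<Rightarrow> real) \<Rightarrow> (real \<Rightarrow> real)
    \<Rightarrow> ('a \<Rightarrow> real) \<Rightarrow> 'a \<Rightarrow> real"
  where "spectral_op \<mu> \<phi> lam p f =
    l2_lim \<mu> (\<lambda>n x. \<Sum>k=1..n. p (lam k) * l2_inner \<mu> f (\<phi> k) * \<phi> k x)"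

definition semigroup :: "'a measure \<Rightarrow> (nat \<Rightarrow> 'a \<Rightarrow> real) \<Rightarrow> (nat \<Rightarrow> real) \<Rightarrow> real
    \<Rightarrow> ('a \<Rightarrow> real) \<Rightarrow> 'a \<Rightarrow> real"
  where "semigroup \<mu> \<phi> lam t = spectral_op \<mu> \<phi> lam (\<lambda>x. exp (- t * x))"

definition noise_op :: "'a measure \<Rightarrow> (nat \<Rightarrow> 'a \<Rightarrow> real) \<Rightarrow> (nat \<Rightarrow> real) \<Rightarrow> real
    \<Rightarrow> ('a \<Rightarrow> real) \<Rightarrow> 'a \<Rightarrow> real"
  where "noise_op \<mu> \<phi> lam \<alpha> = spectral_op \<mu> \<phi> lam (\<lambda>x. (1 + x) powr (- \<alpha> / 2))"

definition H1 :: "'a measure \<Rightarrow> (nat \<Rightarrow> 'a \<Rightarrow> real) \<Rightarrow> ('a \<Rightarrow> real) set" where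
  "H1 \<mu> \<phi> = {f \<in> L2 \<mu>. \<exists>c. AE x in \<mu>. f x = c * \<phi> 1 x}"


section \<open>Wiener processes and the stochastic integral\<close>

definition process_sigma :: "'w measure \<Rightarrow> 'b measure \<Rightarrow> ('i \<Rightarrow> 'w \<Rightarrow> 'b) \<Rightarrow> 'i set \<Rightarrow> 'w measure"
  where "process_sigma P N X T =
    sigma (space P) (\<Union>i\<in>T. {X i -` A \<inter> space P | A. A \<in> sets N})"

text \<open>One-dimensional standard Wiener process with respect to a filtration.\<close>

definition wiener_process ::
    "'w measure \<Rightarrow> (real \<Rightarrow> 'w measure) \<Rightarrow> (real \<Rightarrow> 'w \<Rightarrow> real) \<Rightarrow> bool"
  where "wiener_process P Fil B \<longleftrightarrow>
    (\<forall>t\<ge>0. B t \<in> borel_measurable (Fil t)) \<and>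
    (AE \<omega> in P. B 0 \<omega> = 0) \<and>
    (\<forall>s\<ge>0. \<forall>t>s.
       distributed P lborel (\<lambda>\<omega>. B t \<omega> - B s \<omega>) (normal_density 0 (sqrt (t - s))) \<and>
       prob_space.indep_set P (sets (Fil s))
         (sets (vimage_algebra (space P) (\<lambda>\<omega>. B t \<omega> - B s \<omega>) borel))) \<and>
    (AE \<omega> in P. continuous_on {0..} (\<lambda>t. B t \<omega>))"

text \<open>
  A cylindrical Wiener process with identity covariance is a family \<open>W t h\<close> of real random
  variables. Linearity in \<open>h\<close> and the law for unit vectors give the covariance
  \<open>E [W s g * W t h] = min s t * \<langle>g, h\<rangle>\<close> by polarisation.
\<close>

definition cylindrical_wiener_process :: "'w measure \<Rightarrow> (real \<Rightarrow> 'w measure) \<Rightarrow> 'a measure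
    \<Rightarrow> (real \<Rightarrow> ('a \<Rightarrow> real) \<Rightarrow> 'w \<Rightarrow> real) \<Rightarrow> bool"
  where "cylindrical_wiener_process P Fil \<mu> W \<longleftrightarrow>
    (\<forall>t\<ge>0. \<forall>h\<in>L2 \<mu>. W t h \<in> borel_measurable (Fil t)) \<and>
    (\<forall>t\<ge>0. \<forall>a b. \<forall>g\<in>L2 \<mu>. \<forall>h\<in>L2 \<mu>.
       AE \<omega> in P. W t (\<lambda>x. a * g x + b * h x) \<omega> = a * W t g \<omega> + b * W t h \<omega>) \<and>
    (\<forall>h\<in>L2 \<mu>. l2_norm \<mu> h = 1 \<longrightarrow> wiener_process P Fil (\<lambda>t. W t h))"

definition W_sigma :: "'w measure \<Rightarrow> 'a measure \<Rightarrow> (real \<Rightarrow> ('a \<Rightarrow> real) \<Rightarrow> 'w \<Rightarrow> real)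
    \<Rightarrow> real set \<Rightarrow> 'w measure"
  where "W_sigma P \<mu> W T = process_sigma P borel (\<lambda>(s, h). W s h) (T \<times> L2 \<mu>)"

text \<open>
  Elementary operator-valued integrands: the list entry \<open>(a, b, g, h)\<close> stands for the function
  \<open>s \<mapsto> 1\<^bsub>(a,b]\<^esub>(s) \<langle>\<sqdot>, g\<rangle> h\<close>. The integrands of interest are deterministic.
\<close>

type_synonym 'a elementary = "(real \<times> real \<times> ('a \<Rightarrow> real) \<times> ('a \<Rightarrow> real)) list"

definition elementary_on :: "'a measure \<Rightarrow> real \<Rightarrow> 'a elementary \<Rightarrow> bool" where
  "elementary_on \<mu> t xs \<longleftrightarrow>
    (\<forall>(a, b, g, h)\<in>set xs. 0 \<le> a \<and> a \<le> b \<and> b \<le> t \<and> g \<in> L2 \<mu> \<and> h \<in> L2 \<mu>)"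

definition elementary_op ::
    "'a measure \<Rightarrow> 'a elementary \<Rightarrow> real \<Rightarrow> ('a \<Rightarrow> real) \<Rightarrow> 'a \<Rightarrow> real"
  where "elementary_op \<mu> xs s f =
    (\<lambda>x. \<Sum>(a, b, g, h)\<leftarrow>xs. indicator {a<..b} s * l2_inner \<mu> f g * h x)"

definition elementary_integral ::
    "(real \<Rightarrow> ('a \<Rightarrow> real) \<Rightarrow> 'w \<Rightarrow> real) \<Rightarrow> 'a elementary \<Rightarrow> 'w \<Rightarrow> 'a \<Rightarrow> real"
  where "elementary_integral W xs \<omega> =
    (\<lambda>x. \<Sum>(a, b, g, h)\<leftarrow>xs. (W b g \<omega> - W a g \<omega>) * h x)"

text \<open>
  Squared Hilbert-Schmidt norm, computed in the orthonormal basis \<open>e\<close> (its value does not depend on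
  the basis).
\<close>

definition hs_norm2 :: "'a measure \<Rightarrow> (nat \<Rightarrow> 'a \<Rightarrow> real) \<Rightarrow> (('a \<Rightarrow> real) \<Rightarrow> 'a \<Rightarrow> real) \<Rightarrow> ennreal"
  where "hs_norm2 \<mu> e A = (\<Sum>k. ennreal ((l2_norm \<mu> (A (e (Suc k))))\<^sup>2))"

text \<open>
  \<open>has_stochastic_integral P W \<mu> e \<Phi> t X\<close>: the \<open>L\<^sup>2(\<mu>)\<close>-valued integral of \<open>\<Phi>\<close> against \<open>W\<close> over
  \<open>[0, t]\<close> exists and \<open>X\<close> is a version of it. As usual it is the extension, by the Ito isometry, of
  the integral of elementary integrands to the square integrable Hilbert-Schmidt valued ones.
\<close>

definition has_stochastic_integral :: "'w measure \<Rightarrow> (real \<Rightarrow> ('a \<Rightarrow> real) \<Rightarrow> 'w \<Rightarrow> real)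
    \<Rightarrow> 'a measure \<Rightarrow> (nat \<Rightarrow> 'a \<Rightarrow> real) \<Rightarrow> (real \<Rightarrow> ('a \<Rightarrow> real) \<Rightarrow> 'a \<Rightarrow> real) \<Rightarrow> real
    \<Rightarrow> ('w \<Rightarrow> 'a \<Rightarrow> real) \<Rightarrow> bool"
  where "has_stochastic_integral P W \<mu> e \<Phi> t X \<longleftrightarrow>
    X \<in> P \<rightarrow>\<^sub>M L2_borel \<mu> \<and>
    (\<forall>f\<in>L2 \<mu>. \<forall>g\<in>L2 \<mu>.
       (\<lambda>s. l2_inner \<mu> (\<Phi> s f) g) \<in> borel_measurable (restrict_space borel {0..t})) \<and>
    (\<exists>xs. (\<forall>n. elementary_on \<mu> t (xs n)) \<and>
       (\<lambda>n. \<integral>\<^sup>+s\<in>{0..t}. hs_norm2 \<mu> e (\<lambda>f x. elementary_op \<mu> (xs n) s f x - \<Phi> s f x) \<partial>lborel)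
         \<longlonglongrightarrow> 0 \<and>
       (\<lambda>n. \<integral>\<^sup>+\<omega>. ennreal ((l2_norm \<mu> (\<lambda>x. elementary_integral W (xs n) \<omega> x - X \<omega> x))\<^sup>2) \<partial>P)
         \<longlonglongrightarrow> 0)"


section \<open>The stochastic heat equation with Neumann boundary conditions\<close>

definition predictable_sigma :: "'w measure \<Rightarrow> (real \<Rightarrow> 'w measure) \<Rightarrow> (real \<times> 'w) measure" where
  "predictable_sigma P Fil = sigma ({0..} \<times> space P)
    ({{0} \<times> A | A. A \<in> sets (Fil 0)} \<union>
     {{s<..t} \<times> A | s t A. 0 \<le> s \<and> s \<le> t \<and> A \<in> sets (Fil s)})"

definition neumann_mild_solution :: "'w measure \<Rightarrow> (real \<Rightarrow> 'w measure)
    \<Rightarrow> (real \<Rightarrow> ('a \<Rightarrow> real) \<Rightarrow> 'w \<Rightarrow> real) \<Rightarrow> 'a measure \<Rightarrow> (nat \<Rightarrow> 'a \<Rightarrow> real) \<Rightarrow> (nat \<Rightarrow> real)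
    \<Rightarrow> real \<Rightarrow> ('w \<Rightarrow> 'a \<Rightarrow> real) \<Rightarrow> (real \<Rightarrow> 'w \<Rightarrow> 'a \<Rightarrow> real) \<Rightarrow> bool"
  where "neumann_mild_solution P Fil W \<mu> \<phi> lam \<alpha> u0 u \<longleftrightarrow>
    (\<lambda>(t, \<omega>). u t \<omega>) \<in> predictable_sigma P Fil \<rightarrow>\<^sub>M L2_borel \<mu> \<and>
    (\<forall>t\<ge>0. \<exists>I.
       has_stochastic_integral P W \<mu> \<phi>
         (\<lambda>s. semigroup \<mu> \<phi> lam (t - s) \<circ> noise_op \<mu> \<phi> lam \<alpha>) t I \<and>
       (AE \<omega> in P. AE x in \<mu>. u t \<omega> x = semigroup \<mu> \<phi> lam t (u0 \<omega>) x + I \<omega> x))"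

text \<open>\<open>\<nu>\<^sub>\<infinity>\<close> is regarded as a measure on the whole of \<open>L\<^sup>2(\<mu>)\<close>; it is carried by the orthogonal
  complement of the constants.\<close>

definition nu_infinity :: "'a measure \<Rightarrow> (nat \<Rightarrow> 'a \<Rightarrow> real) \<Rightarrow> (nat \<Rightarrow> real) \<Rightarrow> real
    \<Rightarrow> 'z measure \<Rightarrow> (nat \<Rightarrow> 'z \<Rightarrow> real) \<Rightarrow> ('a \<Rightarrow> real) measure"
  where "nu_infinity \<mu> \<phi> lam \<alpha> Q Z = distr Q (L2_borel \<mu>) (\<lambda>\<omega>.
    l2_lim \<mu> (\<lambda>n x. \<Sum>k=2..n.
      (1 + lam k) powr (- \<alpha> / 2) * (2 * lam k) powr (- 1 / 2) * Z k \<omega> * \<phi> k x))"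

end

theory Submission
  imports Defs
begin

text \<open>
  The Brownian motion is the constant mode \<open>B t = W t (\<phi> 1)\<close>. Since \<open>lam 1 = 0\<close>, the first component
  of the stochastic convolution is \<open>B t\<close> itself, so \<open>u - B\<close> has first component constant in time,
  while its other components are Ornstein--Uhlenbeck processes driven by \<open>W (\<phi> k)\<close>, \<open>k \<ge> 2\<close>, and
  contracted towards their Gaussian equilibrium. Everything is read off characteristic functions
  of finitely many components: a combination of values of \<open>W\<close> is Gaussian with variance the squared
  norm of its integrand, this passes to \<open>L\<^sup>2\<close> limits, and orthogonal integrands factorise. For the
  weak convergence the laws of \<open>u(t) - B(t)\<close> are realised on the product of the two probability
  spaces by random elements converging in norm almost surely.
\<close>

section \<open>Square integrable functions\<close>

text \<open>The data speak of one time and one direction at a time: the mild formula holds almost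
  surely for each fixed \<open>t\<close> with its own stochastic integral, \<open>W\<close> is
  linear only almost surely for each pair of vectors, and its increments are known to be normal only
  for unit vectors. Joint laws must be built from this, and joint normality of several values of
  \<open>W\<close> is derived by peeling off the increment after the second latest time. Functions
  are representatives, so measurability and laws in \<open>L2 \<mu>\<close> are handled through the
  coordinates \<open>l2_inner \<mu> f (\<phi> k)\<close>, which generate its Borel sets.

  The equilibrium variance comes from integrating exp(-2 (t - s) lam k) over [0, t], which gives (1
  - \<rho>^2) / (2 lam k) with \<rho> = exp(-t lam k). The noise injects exactly the fraction 1 -
  \<rho>^2 of the equilibrium variance that the contraction by \<rho> removes. This balance gives
  stationarity, and it suggests the coupling: the initial coordinate with weight \<rho> plus an
  independent equilibrium coordinate with weight sqrt(1 - \<rho>^2).\<close>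

lemma L2_measurable [measurable_dest]: "f \<in> L2 M \<Longrightarrow> f \<in> borel_measurable M"
  by (simp add: L2_def)

lemma L2_integrable_square: "f \<in> L2 M \<Longrightarrow> integrable M (\<lambda>x. (f x)\<^sup>2)"
  by (simp add: L2_def)

lemma L2_integrable_mult:
  assumes f: "f \<in> L2 M" and g: "g \<in> L2 M"
  shows "integrable M (\<lambda>x. f x * g x)"
proof (rule Bochner_Integration.integrable_bound[where f = "\<lambda>x. (f x)\<^sup>2 + (g x)\<^sup>2"])
  show "integrable M (\<lambda>x. (f x)\<^sup>2 + (g x)\<^sup>2)"
    using f g by (simp add: L2_integrable_square)
  show "(\<lambda>x. f x * g x) \<in> borel_measurable M"
    using L2_measurable[OF f] L2_measurable[OF g] by measurable
  have "\<bar>a * b\<bar> \<le> a\<^sup>2 + b\<^sup>2" for a b :: real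
  proof -
    have "0 \<le> (\<bar>a\<bar> - \<bar>b\<bar>)\<^sup>2" by simp
    then have "2 * \<bar>a * b\<bar> \<le> a\<^sup>2 + b\<^sup>2" by (simp add: power2_diff abs_mult)
    moreover have "0 \<le> \<bar>a * b\<bar>" by simp
    ultimately show ?thesis by linarith
  qed
  then show "AE x in M. norm (f x * g x) \<le> norm ((f x)\<^sup>2 + (g x)\<^sup>2)"
    by simp
qed

lemma L2_add [intro]:
  assumes f: "f \<in> L2 M" and g: "g \<in> L2 M"
  shows "(\<lambda>x. f x + g x) \<in> L2 M"
  using L2_integrable_square[OF f] L2_integrable_square[OF g] L2_integrable_mult[OF f g]
    L2_measurable[OF f] L2_measurable[OF g]
  by (auto simp: L2_def power2_sum mult.assoc)

lemma L2_scale [intro]: "f \<in> L2 M \<Longrightarrow> (\<lambda>x. c * f x) \<in> L2 M"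
  by (auto simp: L2_def power_mult_distrib)

lemma L2_diff [intro]:
  assumes f: "f \<in> L2 M" and g: "g \<in> L2 M"
  shows "(\<lambda>x. f x - g x) \<in> L2 M"
  using L2_add[OF f L2_scale[OF g, of "-1"]] by simp

lemma L2_zero [simp, intro]: "(\<lambda>x. 0) \<in> L2 M"
  by (simp add: L2_def)

lemma L2_sum [intro]: "(\<And>i. i \<in> I \<Longrightarrow> f i \<in> L2 M) \<Longrightarrow> (\<lambda>x. \<Sum>i\<in>I. f i x) \<in> L2 M"
  by (induction I rule: infinite_finite_induct) auto

section \<open>Inner product and seminorm on representatives\<close>

lemma l2_inner_commute: "l2_inner M f g = l2_inner M g f"
  by (simp add: l2_inner_def mult.commute)

lemma l2_inner_add_left:
  "f \<in> L2 M \<Longrightarrow> g \<in> L2 M \<Longrightarrow> h \<in> L2 M \<Longrightarrow>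
    l2_inner M (\<lambda>x. f x + g x) h = l2_inner M f h + l2_inner M g h"
  by (simp add: l2_inner_def ring_distribs L2_integrable_mult)

lemma l2_inner_diff_left:
  "f \<in> L2 M \<Longrightarrow> g \<in> L2 M \<Longrightarrow> h \<in> L2 M \<Longrightarrow>
    l2_inner M (\<lambda>x. f x - g x) h = l2_inner M f h - l2_inner M g h"
  by (simp add: l2_inner_def ring_distribs L2_integrable_mult)

lemma l2_inner_scale_left: "l2_inner M (\<lambda>x. c * f x) h = c * l2_inner M f h"
  by (simp add: l2_inner_def mult.assoc)

lemma l2_inner_zero_left [simp]: "l2_inner M (\<lambda>x. 0) h = 0"
  by (simp add: l2_inner_def)

lemma l2_inner_sum_left:
  "(\<And>i. i \<in> I \<Longrightarrow> f i \<in> L2 M) \<Longrightarrow> h \<in> L2 M \<Longrightarrow>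
    l2_inner M (\<lambda>x. \<Sum>i\<in>I. f i x) h = (\<Sum>i\<in>I. l2_inner M (f i) h)"
  by (induction I rule: infinite_finite_induct) (auto simp: l2_inner_add_left L2_sum)

lemma l2_inner_cong_AE:
  assumes "f \<in> borel_measurable M" "f' \<in> borel_measurable M" "g \<in> borel_measurable M"
    and "AE x in M. f x = f' x"
  shows "l2_inner M f g = l2_inner M f' g"
  unfolding l2_inner_def using assms by (intro integral_cong_AE) auto

lemma l2_inner_self: "l2_inner M f f = (\<integral>x. (f x)\<^sup>2 \<partial>M)"
  by (simp add: l2_inner_def power2_eq_square)

lemma l2_inner_self_nonneg [simp]: "0 \<le> l2_inner M f f"
  by (simp add: l2_inner_self)

lemma l2_norm_nonneg [simp]: "0 \<le> l2_norm M f"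
  by (simp add: l2_norm_def)

lemma l2_norm_square: "(l2_norm M f)\<^sup>2 = l2_inner M f f"
  by (simp add: l2_norm_def)

lemma l2_norm_square_integral: "(l2_norm M f)\<^sup>2 = (\<integral>x. (f x)\<^sup>2 \<partial>M)"
  by (simp add: l2_norm_square l2_inner_self)

lemma l2_norm_zero [simp]: "l2_norm M (\<lambda>x. 0) = 0"
  by (simp add: l2_norm_def)

lemma l2_norm_scale: "l2_norm M (\<lambda>x. c * f x) = \<bar>c\<bar> * l2_norm M f"
  by (simp add: l2_norm_def l2_inner_self power_mult_distrib real_sqrt_mult)

lemma l2_norm_minus_commute: "l2_norm M (\<lambda>x. f x - g x) = l2_norm M (\<lambda>x. g x - f x)"
  by (simp add: l2_norm_def l2_inner_self power2_commute)

lemma nn_integral_square: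
  assumes "f \<in> L2 M"
  shows "(\<integral>\<^sup>+x. ennreal ((f x)\<^sup>2) \<partial>M) = ennreal ((l2_norm M f)\<^sup>2)"
  unfolding l2_norm_square_integral
  using L2_integrable_square[OF assms] by (intro nn_integral_eq_integral) auto

lemma L2_if_nn_integral_finite:
  assumes "f \<in> borel_measurable M" "(\<integral>\<^sup>+x. ennreal ((f x)\<^sup>2) \<partial>M) < \<infinity>"
  shows "f \<in> L2 M"
  unfolding L2_def using assms by (auto intro!: integrableI_nonneg)

lemma l2_norm_add_square:
  assumes "f \<in> L2 M" "g \<in> L2 M"
  shows "(l2_norm M (\<lambda>x. f x + g x))\<^sup>2 = (l2_norm M f)\<^sup>2 + 2 * l2_inner M f g + (l2_norm M g)\<^sup>2"
proof -
  let ?s = "\<lambda>x. f x + g x"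
  have s: "l2_inner M h ?s = l2_inner M h f + l2_inner M h g" if "h \<in> L2 M" for h
    using l2_inner_add_left[OF assms that] by (simp only: l2_inner_commute[of M h])
  have "l2_inner M ?s ?s = l2_inner M f ?s + l2_inner M g ?s"
    using assms by (intro l2_inner_add_left) auto
  then show ?thesis
    using s[OF assms(1)] s[OF assms(2)] by (simp add: l2_norm_square l2_inner_commute[of M g f])
qed

text \<open>Discriminant argument for the squared norm of f + t g as a quadratic in t. Since
  \<open>l2_norm\<close> is only a seminorm, norm 0 does not mean the zero function, and that case
  is treated separately.\<close>

lemma l2_cauchy_schwarz:
  assumes f: "f \<in> L2 M" and g: "g \<in> L2 M"
  shows "\<bar>l2_inner M f g\<bar> \<le> l2_norm M f * l2_norm M g"
proof -
  let ?a = "l2_norm M f" and ?b = "l2_norm M g" and ?c = "l2_inner M f g"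
  have q: "0 \<le> ?a\<^sup>2 + 2 * (t * ?c) + t\<^sup>2 * ?b\<^sup>2" for t
    using l2_norm_add_square[OF f L2_scale[OF g, of t]]
      zero_le_power2[of "l2_norm M (\<lambda>x. f x + t * g x)"]
    by (simp add: l2_norm_scale power_mult_distrib l2_inner_commute[of M f] l2_inner_scale_left)
  have "?c\<^sup>2 \<le> ?a\<^sup>2 * ?b\<^sup>2"
  proof (cases "?b = 0")
    case True
    \<comment> \<open>The quadratic has become affine in t; at t = -(a^2 + 1) / c its value would be
      -(a^2 + 2).\<close>
    have "?c = 0"
    proof (rule ccontr)
      assume "?c \<noteq> 0"
      then have "(- (?a\<^sup>2 + 1) / ?c) * ?c = - (?a\<^sup>2 + 1)"
        by simp
      then have "?a\<^sup>2 + 2 \<le> 0"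
        using q[of "- (?a\<^sup>2 + 1) / ?c"] unfolding True by simp
      moreover have "0 < ?a\<^sup>2 + 2"
        by (intro add_nonneg_pos) auto
      ultimately show False
        by simp
    qed
    then show ?thesis by simp
  next
    case False
    then have "0 < ?b\<^sup>2" by simp
    \<comment> \<open>The quadratic at its minimum t = -c / b^2.\<close>
    moreover have "0 \<le> ?a\<^sup>2 - ?c\<^sup>2 / ?b\<^sup>2"
      using q[of "- ?c / ?b\<^sup>2"] False by (simp add: power2_eq_square field_simps)
    ultimately show ?thesis by (simp add: field_simps)
  qed
  then have "\<bar>?c\<bar>\<^sup>2 \<le> (?a * ?b)\<^sup>2"
    by (simp add: power_mult_distrib)
  then show ?thesis
    by (rule power2_le_imp_le) simp
qed

lemma l2_norm_triangle:
  assumes f: "f \<in> L2 M" and g: "g \<in> L2 M"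
  shows "l2_norm M (\<lambda>x. f x + g x) \<le> l2_norm M f + l2_norm M g"
proof (rule power2_le_imp_le)
  show "(l2_norm M (\<lambda>x. f x + g x))\<^sup>2 \<le> (l2_norm M f + l2_norm M g)\<^sup>2"
    using l2_norm_add_square[OF f g] l2_cauchy_schwarz[OF f g] by (simp add: power2_sum)
qed simp

lemma l2_norm_triangle_diff:
  assumes "f \<in> L2 M" "g \<in> L2 M" "h \<in> L2 M"
  shows "l2_norm M (\<lambda>x. f x - h x) \<le> l2_norm M (\<lambda>x. f x - g x) + l2_norm M (\<lambda>x. g x - h x)"
  using l2_norm_triangle[OF L2_diff[OF assms(1,2)] L2_diff[OF assms(2,3)]] by simp

lemma abs_l2_norm_diff_le:
  assumes f: "f \<in> L2 M" and g: "g \<in> L2 M"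
  shows "\<bar>l2_norm M f - l2_norm M g\<bar> \<le> l2_norm M (\<lambda>x. f x - g x)"
  using l2_norm_triangle[OF L2_diff[OF f g] g] l2_norm_triangle[OF L2_diff[OF g f] f]
  by (simp add: l2_norm_minus_commute[of M g f])

text \<open>Riesz-Fischer for an arbitrary measure. Along a subsequence the increments
  \<open>?g k\<close> have norm below 2^(-k). Summability of their squares would not make the
  telescoping series converge pointwise; the weights 2^k do: the weighted sum is integrable, so
  almost everywhere its terms are bounded and \<open>?g k x\<close> decays like 2^(-k/2). Fatou then
  identifies the pointwise limit as the limit in norm.\<close>

lemma l2_complete:
  assumes X: "\<And>n. X n \<in> L2 M"
    and Cauchy: "\<And>e. 0 < e \<Longrightarrow> \<exists>N. \<forall>m\<ge>N. \<forall>n\<ge>N. l2_norm M (\<lambda>x. X m x - X n x) < e"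
  shows "\<exists>f. has_l2_limit M X f"
proof -
  have [measurable]: "X n \<in> borel_measurable M" for n
    using X by (rule L2_measurable)
  have "\<exists>N. \<forall>m\<ge>N. \<forall>n\<ge>N. l2_norm M (\<lambda>x. X m x - X n x) < (1/2) ^ k" for k :: nat
    by (rule Cauchy) simp
  then obtain N where N: "\<And>k m n. N k \<le> m \<Longrightarrow> N k \<le> n \<Longrightarrow>
      l2_norm M (\<lambda>x. X m x - X n x) < (1/2) ^ k"
    by metis
  \<comment> \<open>The sum dominates every \<open>N j\<close> with j \<le> k. The summand
    \<open>k\<close> gives \<open>k \<le> r k\<close>, so that a shift by \<open>N0\<close> puts all
    indices past \<open>N0\<close>.\<close>
  define r where "r = (\<lambda>k. (\<Sum>j\<le>k. N j) + k)"
  have r_ge: "N k \<le> r j" if "k \<le> j" for k j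
    using member_le_sum[of k "{..j}" N] that by (simp add: r_def)
  have r_ge': "k \<le> r k" for k
    by (simp add: r_def)
  let ?g = "\<lambda>k x. X (r (Suc k)) x - X (r k) x"
  have g: "l2_norm M (?g k) < (1/2) ^ k" for k
    using N[of k "r (Suc k)" "r k"] r_ge by auto
  have "(\<integral>\<^sup>+x. (\<Sum>k. ennreal (2 ^ k * (?g k x)\<^sup>2)) \<partial>M) = (\<Sum>k. \<integral>\<^sup>+x. ennreal (2 ^ k * (?g k x)\<^sup>2) \<partial>M)"
    by (rule nn_integral_suminf) measurable
  also have "\<dots> = (\<Sum>k. ennreal (2 ^ k * (l2_norm M (?g k))\<^sup>2))"
  proof -
    have "(\<integral>\<^sup>+x. ennreal (2 ^ k * (?g k x)\<^sup>2) \<partial>M) = ennreal (2 ^ k * (l2_norm M (?g k))\<^sup>2)" for k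
      using nn_integral_square[of "?g k" M] X by (simp add: ennreal_mult L2_diff nn_integral_cmult)
    then show ?thesis by simp
  qed
  also have "\<dots> \<le> (\<Sum>k. ennreal ((1/2) ^ k))"
  proof (intro suminf_le ennreal_leI)
    fix k
    have "(l2_norm M (?g k))\<^sup>2 \<le> ((1/2) ^ k)\<^sup>2"
      using g[of k] by (intro power_mono) auto
    then have "2 ^ k * (l2_norm M (?g k))\<^sup>2 \<le> 2 ^ k * ((1/2) ^ k)\<^sup>2"
      by (intro mult_left_mono) auto
    also have "\<dots> = (1/2::real) ^ k"
      by (simp add: power2_eq_square power_divide)
    finally show "2 ^ k * (l2_norm M (?g k))\<^sup>2 \<le> (1/2) ^ k" .
  qed auto
  also have "\<dots> = ennreal (\<Sum>k. (1/2) ^ k)"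
    by (rule suminf_ennreal2) (auto intro: summable_geometric)
  also have "\<dots> < \<infinity>"
    by simp
  finally have "AE x in M. (\<Sum>k. ennreal (2 ^ k * (?g k x)\<^sup>2)) \<noteq> \<infinity>"
    by (intro nn_integral_PInf_AE) auto
  then have conv: "AE x in M. (\<lambda>k. X (r k) x) \<longlonglongrightarrow> lim (\<lambda>k. X (r k) x)"
  proof (eventually_elim)
    case (elim x)
    then have "summable (\<lambda>k. 2 ^ k * (?g k x)\<^sup>2)"
      by (intro summable_suminf_not_top) auto
    then have "(\<lambda>k. 2 ^ k * (?g k x)\<^sup>2) \<longlonglongrightarrow> 0"
      by (rule summable_LIMSEQ_zero)
    then have "Bseq (\<lambda>k. 2 ^ k * (?g k x)\<^sup>2)"
      by (intro convergent_imp_Bseq) (auto simp: convergent_def)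
    then obtain C where C: "0 < C" "\<And>k. norm (2 ^ k * (?g k x)\<^sup>2) \<le> C"
      by (auto simp: Bseq_def)
    have "norm (?g k x) \<le> sqrt C * (1 / sqrt 2) ^ k" for k
    proof (rule power2_le_imp_le)
      have "2 ^ k * (?g k x)\<^sup>2 \<le> C"
        using C(2)[of k] by (simp add: abs_mult)
      then have "(?g k x)\<^sup>2 \<le> C / 2 ^ k"
        by (simp add: field_simps)
      also have "C / 2 ^ k = (sqrt C * (1 / sqrt 2) ^ k)\<^sup>2"
      proof -
        have "((1 / sqrt 2) ^ k)\<^sup>2 = ((1 / sqrt 2)\<^sup>2) ^ k"
          by (simp only: power_mult[symmetric] mult.commute)
        then have "((1 / sqrt 2) ^ k)\<^sup>2 = 1 / 2 ^ k"
          by (simp add: power_divide)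
        then show ?thesis
          using C(1) by (simp add: power_mult_distrib)
      qed
      finally show "(norm (?g k x))\<^sup>2 \<le> (sqrt C * (1 / sqrt 2) ^ k)\<^sup>2"
        by simp
    qed (use C in auto)
    moreover have "summable (\<lambda>k. sqrt C * (1 / sqrt 2) ^ k)"
      by (intro summable_mult summable_geometric) auto
    ultimately have "summable (\<lambda>k. ?g k x)"
      using summable_comparison_test'[of "\<lambda>k. sqrt C * (1 / sqrt 2) ^ k" 0 "\<lambda>k. ?g k x"] by blast
    then have "convergent (\<lambda>n. \<Sum>k<n. ?g k x)"
      by (simp only: summable_iff_convergent)
    then have "convergent (\<lambda>n. X (r n) x - X (r 0) x)"
      using sum_lessThan_telescope[of "\<lambda>k. X (r k) x"] by simp
    then have "convergent (\<lambda>n. X (r n) x)"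
      by (simp only: convergent_diff_const_right_iff)
    then show ?case
      by (simp add: convergent_LIMSEQ_iff)
  qed
  define f where "f x = lim (\<lambda>k. X (r k) x)" for x
  have f_meas [measurable]: "f \<in> borel_measurable M"
    unfolding f_def by measurable
  have bound: "(\<integral>\<^sup>+x. ennreal ((X n x - f x)\<^sup>2) \<partial>M) \<le> ennreal (e\<^sup>2)"
    if "0 < e" and e: "\<And>m. N0 \<le> m \<Longrightarrow> l2_norm M (\<lambda>x. X n x - X m x) \<le> e" for n e N0
  proof -
    \<comment> \<open>Fatou along the shifted subsequence. The nonnegative integral makes sense
      before \<open>f\<close> is known to be square integrable.\<close>
    have "(\<integral>\<^sup>+x. ennreal ((X n x - f x)\<^sup>2) \<partial>M)
        = (\<integral>\<^sup>+x. liminf (\<lambda>k. ennreal ((X n x - X (r (k + N0)) x)\<^sup>2)) \<partial>M)"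
      using conv
    proof (intro nn_integral_cong_AE, eventually_elim)
      case (elim x)
      from LIMSEQ_ignore_initial_segment[OF elim(2), of N0]
      have "(\<lambda>k. X (r (k + N0)) x) \<longlonglongrightarrow> f x"
        by (simp add: f_def)
      then have "(\<lambda>k. ennreal ((X n x - X (r (k + N0)) x)\<^sup>2)) \<longlonglongrightarrow> ennreal ((X n x - f x)\<^sup>2)"
        by (intro tendsto_intros)
      then show ?case
        by (intro lim_imp_Liminf[symmetric]) auto
    qed
    also have "\<dots> \<le> liminf (\<lambda>k. \<integral>\<^sup>+x. ennreal ((X n x - X (r (k + N0)) x)\<^sup>2) \<partial>M)"
      by (rule nn_integral_liminf) measurable
    also have "\<dots> \<le> liminf (\<lambda>k::nat. ennreal (e\<^sup>2))"
    proof (intro Liminf_mono always_eventually allI)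
      fix k
      have "N0 \<le> r (k + N0)"
        using r_ge'[of "k + N0"] by simp
      then have "(l2_norm M (\<lambda>x. X n x - X (r (k + N0)) x))\<^sup>2 \<le> e\<^sup>2"
        by (intro power_mono e) auto
      then show "(\<integral>\<^sup>+x. ennreal ((X n x - X (r (k + N0)) x)\<^sup>2) \<partial>M) \<le> ennreal (e\<^sup>2)"
        by (subst nn_integral_square) (auto intro: X ennreal_leI)
    qed
    finally show ?thesis by (simp add: Liminf_const)
  qed
  have close: "\<exists>N. \<forall>n\<ge>N. (\<integral>\<^sup>+x. ennreal ((X n x - f x)\<^sup>2) \<partial>M) \<le> ennreal (e\<^sup>2)" if pos: "0 < e" for e
  proof -
    obtain N0 where "\<forall>m\<ge>N0. \<forall>n\<ge>N0. l2_norm M (\<lambda>x. X m x - X n x) < e"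
      using Cauchy[OF pos] by blast
    then show ?thesis
      using bound[OF pos, of N0] by (meson less_imp_le)
  qed
  have diff: "(\<lambda>x. X n x - f x) \<in> L2 M"
    if "(\<integral>\<^sup>+x. ennreal ((X n x - f x)\<^sup>2) \<partial>M) \<le> ennreal (e\<^sup>2)" for n e
    using that by (intro L2_if_nn_integral_finite) (auto simp: less_top[symmetric] top_unique)
  obtain n1 where "(\<integral>\<^sup>+x. ennreal ((X n1 x - f x)\<^sup>2) \<partial>M) \<le> ennreal (1\<^sup>2)"
    using close[of 1] by auto
  from L2_diff[OF X diff[OF this], of n1] have f: "f \<in> L2 M"
    by simp
  have "(\<lambda>n. l2_norm M (\<lambda>x. X n x - f x)) \<longlonglongrightarrow> 0"
  proof (rule LIMSEQ_I)
    fix e :: real assume "0 < e"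
    then obtain N0 where N0: "\<And>n. N0 \<le> n \<Longrightarrow> (\<integral>\<^sup>+x. ennreal ((X n x - f x)\<^sup>2) \<partial>M) \<le> ennreal ((e/2)\<^sup>2)"
      using close[of "e/2"] by auto
    have "l2_norm M (\<lambda>x. X n x - f x) < e" if "N0 \<le> n" for n
    proof -
      have "(l2_norm M (\<lambda>x. X n x - f x))\<^sup>2 \<le> (e/2)\<^sup>2"
        using N0[OF that] nn_integral_square[OF L2_diff[OF X f], of n] by simp
      then have "l2_norm M (\<lambda>x. X n x - f x) \<le> e/2"
        using \<open>0 < e\<close> by - (rule power2_le_imp_le, auto)
      then show ?thesis using \<open>0 < e\<close> by simp
    qed
    then show "\<exists>no. \<forall>n\<ge>no. norm (l2_norm M (\<lambda>x. X n x - f x) - 0) < e"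
      by auto
  qed
  with f show ?thesis by (auto simp: has_l2_limit_def)
qed

section \<open>Orthonormal bases and Borel sets\<close>

lemma space_process_sigma [simp]: "space (process_sigma P N X T) = space P"
  unfolding process_sigma_def by (rule space_measure_of) auto

lemma sets_process_sigma:
  "sets (process_sigma P N X T) =
    sigma_sets (space P) (\<Union>i\<in>T. {X i -` A \<inter> space P | A. A \<in> sets N})"
  unfolding process_sigma_def by (rule sets_measure_of) auto

lemma measurable_process_sigma:
  assumes "i \<in> T" "\<And>\<omega>. \<omega> \<in> space P \<Longrightarrow> X i \<omega> \<in> space N"
  shows "X i \<in> process_sigma P N X T \<rightarrow>\<^sub>M N"
proof (rule measurableI)
  fix A assume "A \<in> sets N"
  then show "X i -` A \<inter> space (process_sigma P N X T) \<in> sets (process_sigma P N X T)"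
    unfolding sets_process_sigma space_process_sigma using assms(1) by (intro sigma_sets.Basic) auto
qed (use assms in auto)

lemma sets_process_sigma_subset:
  assumes "space M = space P" "\<And>i. i \<in> T \<Longrightarrow> X i \<in> M \<rightarrow>\<^sub>M N"
  shows "sets (process_sigma P N X T) \<subseteq> sets M"
  unfolding sets_process_sigma assms(1)[symmetric]
proof (rule sets.sigma_sets_subset, safe)
  fix i A assume "i \<in> T" "A \<in> sets N"
  then show "X i -` A \<inter> space M \<in> sets M"
    using assms(2) by (auto intro: measurable_sets)
qed

section \<open>Limits in the seminorm, its topology and its Borel sets\<close>

lemma l2_lim_has_limit: "\<exists>f. has_l2_limit \<mu> X f \<Longrightarrow> has_l2_limit \<mu> X (l2_lim \<mu> X)"
  unfolding l2_lim_def by (simp add: someI_ex[of "has_l2_limit \<mu> X"])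

lemma l2_lim_L2: "l2_lim \<mu> X \<in> L2 \<mu>"
proof (cases "\<exists>f. has_l2_limit \<mu> X f")
  case True
  then show ?thesis
    using l2_lim_has_limit unfolding has_l2_limit_def by blast
qed (simp add: l2_lim_def)

lemma tendsto_l2_inner:
  assumes lim: "has_l2_limit \<mu> X f" and X: "\<And>n. X n \<in> L2 \<mu>" and g: "g \<in> L2 \<mu>"
  shows "(\<lambda>n. l2_inner \<mu> (X n) g) \<longlonglongrightarrow> l2_inner \<mu> f g"
proof -
  have f: "f \<in> L2 \<mu>" and lim: "(\<lambda>n. l2_norm \<mu> (\<lambda>x. X n x - f x)) \<longlonglongrightarrow> 0"
    using lim by (auto simp: has_l2_limit_def)
  have "(\<lambda>n. l2_inner \<mu> (X n) g - l2_inner \<mu> f g) \<longlonglongrightarrow> 0"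
  proof (rule Lim_null_comparison)
    show "(\<lambda>n. l2_norm \<mu> (\<lambda>x. X n x - f x) * l2_norm \<mu> g) \<longlonglongrightarrow> 0"
      using tendsto_mult_right[OF lim] by simp
    show "\<forall>\<^sub>F n in sequentially. norm (l2_inner \<mu> (X n) g - l2_inner \<mu> f g)
        \<le> l2_norm \<mu> (\<lambda>x. X n x - f x) * l2_norm \<mu> g"
      using l2_cauchy_schwarz[OF L2_diff[OF X f] g] by (simp add: l2_inner_diff_left[OF X f g])
  qed
  then show ?thesis by (rule LIM_zero_cancel)
qed

lemma tendsto_l2_norm:
  assumes lim: "has_l2_limit \<mu> X f" and X: "\<And>n. X n \<in> L2 \<mu>"
  shows "(\<lambda>n. l2_norm \<mu> (X n)) \<longlonglongrightarrow> l2_norm \<mu> f"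
proof -
  have f: "f \<in> L2 \<mu>" and lim: "(\<lambda>n. l2_norm \<mu> (\<lambda>x. X n x - f x)) \<longlonglongrightarrow> 0"
    using lim by (auto simp: has_l2_limit_def)
  have "(\<lambda>n. l2_norm \<mu> (X n) - l2_norm \<mu> f) \<longlonglongrightarrow> 0"
    using abs_l2_norm_diff_le[OF X f] by (intro Lim_null_comparison[OF _ lim]) auto
  then show ?thesis by (rule LIM_zero_cancel)
qed

lemma space_L2_borel [simp]: "space (L2_borel \<mu>) = L2 \<mu>"
  unfolding L2_borel_def by (rule space_measure_of) (auto simp: openin_l2_topology)

lemma sets_L2_borel: "sets (L2_borel \<mu>) = sigma_sets (L2 \<mu>) {U. openin (l2_topology \<mu>) U}"
  unfolding L2_borel_def by (rule sets_measure_of) (auto simp: openin_l2_topology)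

lemma borel_measurable_continuous_map_l2:
  assumes "continuous_map (l2_topology \<mu>) euclideanreal \<Phi>"
  shows "\<Phi> \<in> borel_measurable (L2_borel \<mu>)"
proof (rule borel_measurableI)
  fix S :: "real set" assume "open S"
  then have "openin (l2_topology \<mu>) {f \<in> topspace (l2_topology \<mu>). \<Phi> f \<in> S}"
    using assms by (intro openin_continuous_map_preimage) auto
  moreover have "{f \<in> topspace (l2_topology \<mu>). \<Phi> f \<in> S} = \<Phi> -` S \<inter> space (L2_borel \<mu>)"
    by auto
  ultimately show "\<Phi> -` S \<inter> space (L2_borel \<mu>) \<in> sets (L2_borel \<mu>)"
    by (auto simp: sets_L2_borel)
qed

lemma continuous_map_l2_topologyI:
  assumes "\<And>f e. f \<in> L2 \<mu> \<Longrightarrow> 0 < e \<Longrightarrow>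
    \<exists>d>0. \<forall>g\<in>L2 \<mu>. l2_norm \<mu> (\<lambda>x. g x - f x) < d \<longrightarrow> \<bar>\<Phi> g - \<Phi> f\<bar> < e"
  shows "continuous_map (l2_topology \<mu>) euclideanreal \<Phi>"
  unfolding continuous_map_def
proof (intro conjI allI impI)
  fix S :: "real set" assume "openin euclideanreal S"
  then have "open S" by simp
  show "openin (l2_topology \<mu>) {x \<in> topspace (l2_topology \<mu>). \<Phi> x \<in> S}"
    unfolding openin_l2_topology topspace_l2_topology
  proof (intro conjI ballI)
    fix f assume "f \<in> {x \<in> L2 \<mu>. \<Phi> x \<in> S}"
    then have f: "f \<in> L2 \<mu>" "\<Phi> f \<in> S" by auto
    obtain e where e: "0 < e" "\<And>y. dist y (\<Phi> f) < e \<Longrightarrow> y \<in> S"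
      using \<open>open S\<close> f(2) by (auto simp: open_dist)
    obtain d where "0 < d" "\<forall>g\<in>L2 \<mu>. l2_norm \<mu> (\<lambda>x. g x - f x) < d \<longrightarrow> \<bar>\<Phi> g - \<Phi> f\<bar> < e"
      using assms[OF f(1) e(1)] by blast
    then show "\<exists>e>0. \<forall>g\<in>L2 \<mu>. l2_norm \<mu> (\<lambda>x. g x - f x) < e \<longrightarrow> g \<in> {x \<in> L2 \<mu>. \<Phi> x \<in> S}"
      using e(2) by (auto simp: dist_real_def intro!: exI[of _ d])
  qed auto
qed auto

lemma continuous_map_l2_topologyD:
  assumes "continuous_map (l2_topology \<mu>) euclideanreal \<Phi>" "f \<in> L2 \<mu>" "0 < e"
  shows "\<exists>d>0. \<forall>g\<in>L2 \<mu>. l2_norm \<mu> (\<lambda>x. g x - f x) < d \<longrightarrow> \<bar>\<Phi> g - \<Phi> f\<bar> < e"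
proof -
  have "openin (l2_topology \<mu>) {g \<in> topspace (l2_topology \<mu>). \<Phi> g \<in> ball (\<Phi> f) e}"
    using assms(1) by (rule openin_continuous_map_preimage) simp
  then show ?thesis
    using assms(2,3) unfolding openin_l2_topology topspace_l2_topology
    by (auto simp: dist_real_def abs_minus_commute)
qed

lemma continuous_map_l2_inner:
  assumes g: "g \<in> L2 \<mu>"
  shows "continuous_map (l2_topology \<mu>) euclideanreal (\<lambda>f. l2_inner \<mu> f g)"
proof (rule continuous_map_l2_topologyI)
  fix f and e :: real assume f: "f \<in> L2 \<mu>" and "0 < e"
  \<comment> \<open>The added 1 covers the case that \<open>g\<close> has norm 0.\<close>
  let ?d = "e / (l2_norm \<mu> g + 1)"
  have pos: "0 < l2_norm \<mu> g + 1"
    using l2_norm_nonneg[of \<mu> g] by linarith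
  have "\<bar>l2_inner \<mu> h g - l2_inner \<mu> f g\<bar> < e"
    if h: "h \<in> L2 \<mu>" and d: "l2_norm \<mu> (\<lambda>x. h x - f x) < ?d" for h
  proof -
    have "\<bar>l2_inner \<mu> h g - l2_inner \<mu> f g\<bar> \<le> l2_norm \<mu> (\<lambda>x. h x - f x) * l2_norm \<mu> g"
      using l2_cauchy_schwarz[OF L2_diff[OF h f] g] by (simp add: l2_inner_diff_left[OF h f g])
    also have "\<dots> \<le> l2_norm \<mu> (\<lambda>x. h x - f x) * (l2_norm \<mu> g + 1)"
      by (intro mult_left_mono) auto
    also have "\<dots> < ?d * (l2_norm \<mu> g + 1)"
      using d pos by (intro mult_strict_right_mono)
    also have "\<dots> = e" using pos by simp
    finally show ?thesis .
  qed
  moreover have "0 < ?d" using pos \<open>0 < e\<close> by simp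
  ultimately show "\<exists>d>0. \<forall>h\<in>L2 \<mu>. l2_norm \<mu> (\<lambda>x. h x - f x) < d \<longrightarrow>
      \<bar>l2_inner \<mu> h g - l2_inner \<mu> f g\<bar> < e"
    by blast
qed

lemma borel_measurable_l2_inner [measurable]:
  "g \<in> L2 \<mu> \<Longrightarrow> (\<lambda>f. l2_inner \<mu> f g) \<in> borel_measurable (L2_borel \<mu>)"
  by (intro borel_measurable_continuous_map_l2 continuous_map_l2_inner)

section \<open>Expansion in a complete orthonormal system\<close>

locale l2_basis =
  fixes \<mu> :: "'a measure" and \<phi> :: "nat \<Rightarrow> 'a \<Rightarrow> real"
  assumes basis: "complete_orthonormal \<mu> \<phi>"
begin

lemma phi_L2 [intro, simp]: "1 \<le> k \<Longrightarrow> \<phi> k \<in> L2 \<mu>"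
  using basis by (simp add: complete_orthonormal_def)

lemma phi_inner: "1 \<le> j \<Longrightarrow> 1 \<le> k \<Longrightarrow> l2_inner \<mu> (\<phi> j) (\<phi> k) = (if j = k then 1 else 0)"
  using basis unfolding complete_orthonormal_def by blast

lemma phi_complete:
  "f \<in> L2 \<mu> \<Longrightarrow> (\<And>k. 1 \<le> k \<Longrightarrow> l2_inner \<mu> f (\<phi> k) = 0) \<Longrightarrow> AE x in \<mu>. f x = 0"
  using basis unfolding complete_orthonormal_def by blast

definition psum :: "(nat \<Rightarrow> real) \<Rightarrow> nat \<Rightarrow> 'a \<Rightarrow> real" where
  "psum c n = (\<lambda>x. \<Sum>k=1..n. c k * \<phi> k x)"

text \<open>Defined through \<open>l2_lim\<close> so that it matches the series in
  \<open>spectral_op\<close> and \<open>nu_infinity\<close> literally. Coefficients that are not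
  square summable yield the zero function.\<close>

definition synth :: "(nat \<Rightarrow> real) \<Rightarrow> 'a \<Rightarrow> real" where
  "synth c = l2_lim \<mu> (psum c)"

lemma psum_L2 [intro]: "psum c n \<in> L2 \<mu>"
  unfolding psum_def by (intro L2_sum L2_scale phi_L2) auto

lemma psum_diff: "(\<lambda>x. psum c n x - psum d n x) = psum (\<lambda>k. c k - d k) n"
  by (simp add: psum_def left_diff_distrib sum_subtractf)

lemma inner_psum:
  assumes "1 \<le> k"
  shows "l2_inner \<mu> (psum c n) (\<phi> k) = (if k \<le> n then c k else 0)"
proof -
  have "l2_inner \<mu> (psum c n) (\<phi> k) = (\<Sum>j=1..n. l2_inner \<mu> (\<lambda>x. c j * \<phi> j x) (\<phi> k))"
    unfolding psum_def using assms by (intro l2_inner_sum_left L2_scale phi_L2) auto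
  also have "\<dots> = (\<Sum>j=1..n. if k = j then c j else 0)"
    using assms by (intro sum.cong) (auto simp: l2_inner_scale_left phi_inner)
  finally show ?thesis using assms by (simp add: sum.delta)
qed

lemma inner_psum_right:
  assumes "f \<in> L2 \<mu>"
  shows "l2_inner \<mu> (psum c n) f = (\<Sum>k=1..n. c k * l2_inner \<mu> f (\<phi> k))"
proof -
  have "l2_inner \<mu> (psum c n) f = (\<Sum>j=1..n. l2_inner \<mu> (\<lambda>x. c j * \<phi> j x) f)"
    unfolding psum_def using assms by (intro l2_inner_sum_left L2_scale phi_L2) auto
  then show ?thesis
    by (simp add: l2_inner_scale_left l2_inner_commute[of \<mu> _ f])
qed

lemma norm_psum: "(l2_norm \<mu> (psum c n))\<^sup>2 = (\<Sum>k=1..n. (c k)\<^sup>2)"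
proof -
  have "l2_inner \<mu> (psum c n) (psum c n) = (\<Sum>k=1..n. c k * l2_inner \<mu> (psum c n) (\<phi> k))"
    by (rule inner_psum_right) auto
  also have "\<dots> = (\<Sum>k=1..n. (c k)\<^sup>2)"
    by (intro sum.cong) (auto simp: inner_psum power2_eq_square)
  finally show ?thesis
    by (simp add: l2_norm_square)
qed

lemma norm_psum_diff:
  assumes "n \<le> m"
  shows "(l2_norm \<mu> (\<lambda>x. psum c m x - psum c n x))\<^sup>2 = (\<Sum>k=1..m. (c k)\<^sup>2) - (\<Sum>k=1..n. (c k)\<^sup>2)"
proof -
  have split: "(\<Sum>k=1..m. g k) = (\<Sum>k=1..n. g k) + (\<Sum>k=1..m. if n < k then g k else 0)" for g :: "nat \<Rightarrow> real"
  proof -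
    have "(\<Sum>k=1..n. g k) = (\<Sum>k=1..m. if n < k then 0 else g k)"
      using assms by (intro sum.mono_neutral_cong_left) auto
    then show ?thesis
      by (simp add: sum.distrib[symmetric]) (intro sum.cong; auto)
  qed
  have "(\<lambda>x. psum c m x - psum c n x) = psum (\<lambda>k. if n < k then c k else 0) m"
    unfolding psum_def by (subst split) (auto intro!: ext sum.cong)
  then show ?thesis
    by (subst split) (simp add: norm_psum if_distrib[of "\<lambda>x. x\<^sup>2"] cong: if_cong)
qed

lemma psum_has_limit:
  assumes "summable (\<lambda>k. (c (Suc k))\<^sup>2)"
  shows "\<exists>f. has_l2_limit \<mu> (psum c) f"
proof (rule l2_complete)
  fix e :: real assume "0 < e"
  have S: "(\<Sum>k=1..n. (c k)\<^sup>2) = (\<Sum>k<n. (c (Suc k))\<^sup>2)" for n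
    by (rule sum.reindex_bij_witness[where i = Suc and j = "\<lambda>k. k - 1"]) auto
  have "Cauchy (\<lambda>n. \<Sum>k<n. (c (Suc k))\<^sup>2)"
    using assms by (simp add: summable_iff_convergent Cauchy_convergent_iff)
  then obtain N where N: "\<And>m n. N \<le> m \<Longrightarrow> N \<le> n \<Longrightarrow>
      \<bar>(\<Sum>k<m. (c (Suc k))\<^sup>2) - (\<Sum>k<n. (c (Suc k))\<^sup>2)\<bar> < e\<^sup>2"
    using \<open>0 < e\<close> by (auto simp: Cauchy_def dist_real_def dest!: spec[of _ "e\<^sup>2"])
  have "l2_norm \<mu> (\<lambda>x. psum c m x - psum c n x) < e" if "N \<le> m" "N \<le> n" "n \<le> m" for m n
    using N[OF that(1,2)] norm_psum_diff[OF that(3), of c] \<open>0 < e\<close>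
    unfolding S by - (rule power2_less_imp_less[of _ e], auto)
  then have "l2_norm \<mu> (\<lambda>x. psum c m x - psum c n x) < e" if "N \<le> m" "N \<le> n" for m n
    using that by (metis nat_le_linear l2_norm_minus_commute)
  then show "\<exists>N. \<forall>m\<ge>N. \<forall>n\<ge>N. l2_norm \<mu> (\<lambda>x. psum c m x - psum c n x) < e"
    by blast
qed auto

lemma synth_L2 [intro]: "synth c \<in> L2 \<mu>"
  unfolding synth_def by (rule l2_lim_L2)

lemma synth_has_limit:
  "summable (\<lambda>k. (c (Suc k))\<^sup>2) \<Longrightarrow> has_l2_limit \<mu> (psum c) (synth c)"
  unfolding synth_def by (intro l2_lim_has_limit psum_has_limit)

lemma inner_limit_psum:
  assumes "has_l2_limit \<mu> (psum c) f" "1 \<le> k"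
  shows "l2_inner \<mu> f (\<phi> k) = c k"
proof (rule LIMSEQ_unique)
  show "(\<lambda>n. l2_inner \<mu> (psum c n) (\<phi> k)) \<longlonglongrightarrow> l2_inner \<mu> f (\<phi> k)"
    using assms by (intro tendsto_l2_inner) auto
  show "(\<lambda>n. l2_inner \<mu> (psum c n) (\<phi> k)) \<longlonglongrightarrow> c k"
    using assms(2) by (intro tendsto_eventually eventually_sequentiallyI[of k]) (simp add: inner_psum)
qed

lemma inner_synth:
  "summable (\<lambda>k. (c (Suc k))\<^sup>2) \<Longrightarrow> 1 \<le> k \<Longrightarrow> l2_inner \<mu> (synth c) (\<phi> k) = c k"
  using inner_limit_psum[OF synth_has_limit] by simp

lemma bessel:
  assumes f: "f \<in> L2 \<mu>"
  shows "(\<Sum>k=1..n. (l2_inner \<mu> f (\<phi> k))\<^sup>2) \<le> (l2_norm \<mu> f)\<^sup>2"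
proof -
  let ?p = "psum (\<lambda>k. l2_inner \<mu> f (\<phi> k)) n"
  have p: "?p \<in> L2 \<mu>" by auto
  have "l2_inner \<mu> f (\<lambda>x. (-1) * ?p x) = - l2_inner \<mu> ?p f"
    unfolding l2_inner_commute[of \<mu> f "\<lambda>x. (-1) * ?p x"] l2_inner_scale_left by simp
  then have "0 \<le> (l2_norm \<mu> f)\<^sup>2 - 2 * l2_inner \<mu> ?p f + (l2_norm \<mu> ?p)\<^sup>2"
    using zero_le_power2[of "l2_norm \<mu> (\<lambda>x. f x + (-1) * ?p x)"]
    unfolding l2_norm_add_square[OF f L2_scale[OF p]] l2_norm_scale by simp
  moreover have "l2_inner \<mu> ?p f = (\<Sum>k=1..n. (l2_inner \<mu> f (\<phi> k))\<^sup>2)"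
    by (simp only: inner_psum_right[OF f] power2_eq_square)
  ultimately show ?thesis
    unfolding norm_psum by linarith
qed

lemma summable_coords:
  assumes f: "f \<in> L2 \<mu>"
  shows "summable (\<lambda>k. (l2_inner \<mu> f (\<phi> (Suc k)))\<^sup>2)"
proof (rule summableI_nonneg_bounded)
  fix n
  have "(\<Sum>k<n. (l2_inner \<mu> f (\<phi> (Suc k)))\<^sup>2) = (\<Sum>k=1..n. (l2_inner \<mu> f (\<phi> k))\<^sup>2)"
    by (rule sum.reindex_bij_witness[where j = Suc and i = "\<lambda>k. k - 1"]) auto
  then show "(\<Sum>k<n. (l2_inner \<mu> f (\<phi> (Suc k)))\<^sup>2) \<le> (l2_norm \<mu> f)\<^sup>2"
    using bessel[OF f] by simp
qed auto

text \<open>A limit of the partial sums would have the coordinates \<open>c\<close>, which would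
  then be square summable by Bessel. With this the coordinates of \<open>synth c\<close> are known
  for every \<open>c\<close>, which is what its measurability requires.\<close>

lemma synth_not_summable:
  assumes "\<not> summable (\<lambda>k. (c (Suc k))\<^sup>2)"
  shows "synth c = (\<lambda>x. 0)"
proof -
  have "\<not> has_l2_limit \<mu> (psum c) f" for f
    using assms summable_coords[of f] inner_limit_psum[of c f]
    by (auto simp: has_l2_limit_def)
  then show ?thesis by (simp add: synth_def l2_lim_def)
qed

lemma AE_eq_coords:
  assumes f: "f \<in> L2 \<mu>" and g: "g \<in> L2 \<mu>"
    and eq: "\<And>k. 1 \<le> k \<Longrightarrow> l2_inner \<mu> f (\<phi> k) = l2_inner \<mu> g (\<phi> k)"
  shows "AE x in \<mu>. f x = g x"
proof -
  have "AE x in \<mu>. f x - g x = 0"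
    using f g eq by (intro phi_complete) (auto simp: l2_inner_diff_left)
  then show ?thesis by simp
qed

text \<open>The function synthesised from the coordinates of \<open>f\<close> has the same
  coordinates, so completeness identifies it with \<open>f\<close> almost everywhere.\<close>

lemma parseval:
  assumes f: "f \<in> L2 \<mu>"
  shows "(\<lambda>k. (l2_inner \<mu> f (\<phi> (Suc k)))\<^sup>2) sums (l2_norm \<mu> f)\<^sup>2"
    and "has_l2_limit \<mu> (psum (\<lambda>k. l2_inner \<mu> f (\<phi> k))) f"
proof -
  let ?c = "\<lambda>k. l2_inner \<mu> f (\<phi> k)"
  have lim: "has_l2_limit \<mu> (psum ?c) (synth ?c)"
    by (intro synth_has_limit summable_coords f)
  have "AE x in \<mu>. f x = synth ?c x"
    using f inner_limit_psum[OF lim] by (intro AE_eq_coords) auto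
  then have "l2_norm \<mu> (\<lambda>x. psum ?c n x - f x) = l2_norm \<mu> (\<lambda>x. psum ?c n x - synth ?c x)" for n
    unfolding l2_norm_def l2_inner_self
    using L2_measurable[OF f] L2_measurable[OF psum_L2[of ?c n]] L2_measurable[OF synth_L2[of ?c]]
    by (intro arg_cong[of _ _ sqrt] integral_cong_AE) (auto elim!: eventually_mono)
  then show lim': "has_l2_limit \<mu> (psum ?c) f"
    using lim f by (simp add: has_l2_limit_def)
  have "(\<Sum>k<n. (?c (Suc k))\<^sup>2) = (l2_norm \<mu> (psum ?c n))\<^sup>2" for n
    unfolding norm_psum by (rule sum.reindex_bij_witness[where j = Suc and i = "\<lambda>k. k - 1"]) auto
  then show "(\<lambda>k. (?c (Suc k))\<^sup>2) sums (l2_norm \<mu> f)\<^sup>2"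
    unfolding sums_def using tendsto_l2_norm[OF lim'] by (auto intro!: tendsto_power)
qed

lemma norm_synth_diff:
  assumes c: "summable (\<lambda>k. (c (Suc k))\<^sup>2)" and d: "summable (\<lambda>k. (d (Suc k))\<^sup>2)"
  shows "(\<lambda>k. (c (Suc k) - d (Suc k))\<^sup>2) sums (l2_norm \<mu> (\<lambda>x. synth c x - synth d x))\<^sup>2"
  using parseval(1)[OF L2_diff[OF synth_L2 synth_L2], of c d]
  by (simp add: l2_inner_diff_left synth_L2 phi_L2 inner_synth c d)

text \<open>By Parseval the distance to a fixed point is a measurable function of the coordinates,
  so balls are measurable in them. Finite rational combinations of the basis are dense, so each open
  set is a countable union of such balls.\<close>

lemma sets_L2_borel_eq_process_sigma:
  "sets (L2_borel \<mu>) = sets (process_sigma (L2_borel \<mu>) borel (\<lambda>k f. l2_inner \<mu> f (\<phi> k)) {1..})"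
    (is "_ = sets ?C")
proof (intro equalityI)
  show "sets ?C \<subseteq> sets (L2_borel \<mu>)"
    by (rule sets_process_sigma_subset) auto
  have coord [measurable]: "(\<lambda>f. l2_inner \<mu> f (\<phi> (Suc k))) \<in> borel_measurable ?C" for k
    using measurable_process_sigma[of "Suc k" "{1..}" "L2_borel \<mu>" "\<lambda>k f. l2_inner \<mu> f (\<phi> k)" borel]
    by simp
  define B where "B d e = {f \<in> L2 \<mu>. l2_norm \<mu> (\<lambda>x. f x - d x) < e}" for d e
  have ball: "B d e \<in> sets ?C" if d: "d \<in> L2 \<mu>" and e: "0 < e" for d e
  proof -
    have "l2_norm \<mu> (\<lambda>x. f x - d x) < e \<longleftrightarrow>
        (\<Sum>k. (l2_inner \<mu> f (\<phi> (Suc k)) - l2_inner \<mu> d (\<phi> (Suc k)))\<^sup>2) < e\<^sup>2" if f: "f \<in> L2 \<mu>" for f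
    proof -
      have "(\<Sum>k. (l2_inner \<mu> f (\<phi> (Suc k)) - l2_inner \<mu> d (\<phi> (Suc k)))\<^sup>2) = (l2_norm \<mu> (\<lambda>x. f x - d x))\<^sup>2"
        using parseval(1)[OF L2_diff[OF f d]] f d by (simp add: sums_iff l2_inner_diff_left phi_L2)
      then show ?thesis
        using e power_strict_mono[of "l2_norm \<mu> (\<lambda>x. f x - d x)" e 2]
          power2_less_imp_less[of "l2_norm \<mu> (\<lambda>x. f x - d x)" e] by auto
    qed
    then have "B d e = {f \<in> space ?C.
        (\<Sum>k. (l2_inner \<mu> f (\<phi> (Suc k)) - l2_inner \<mu> d (\<phi> (Suc k)))\<^sup>2) < e\<^sup>2}"
      by (auto simp: B_def)
    also have "\<dots> \<in> sets ?C"
      by measurable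
    finally show ?thesis .
  qed
  \<comment> \<open>The list starts at position 0 while the basis starts at 1, hence
    \<open>k - 1\<close>.\<close>
  define D where "D qs = psum (\<lambda>k. of_rat (qs ! (k - 1))) (length qs)" for qs :: "rat list"
  have dense: "\<exists>qs. l2_norm \<mu> (\<lambda>x. f x - D qs x) < e" if f: "f \<in> L2 \<mu>" and e: "0 < e" for f e
  proof -
    let ?c = "\<lambda>k. l2_inner \<mu> f (\<phi> k)"
    have "(\<lambda>n. l2_norm \<mu> (\<lambda>x. psum ?c n x - f x)) \<longlonglongrightarrow> 0"
      using parseval(2)[OF f] by (simp add: has_l2_limit_def)
    then have "\<forall>\<^sub>F n in sequentially. l2_norm \<mu> (\<lambda>x. psum ?c n x - f x) < e / 2"
      using e by (intro order_tendstoD) auto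
    then obtain n where n: "l2_norm \<mu> (\<lambda>x. psum ?c n x - f x) < e / 2"
      by (auto simp: eventually_sequentially)
    \<comment> \<open>With n coordinate errors below d, the error in norm is at most sqrt n * d
      \<le> (n + 1) * d = e / 2.\<close>
    let ?d = "e / (2 * (real n + 1))"
    have "\<exists>q::rat. \<bar>?c k - of_rat q\<bar> < ?d" for k
    proof -
      have "?c k - ?d < ?c k + ?d" using e by simp
      then obtain q where "?c k - ?d < of_rat q" "of_rat q < ?c k + ?d"
        using of_rat_dense by blast
      then show ?thesis by (intro exI[of _ q]) (auto simp: abs_less_iff)
    qed
    then obtain q :: "nat \<Rightarrow> rat" where q: "\<And>k. \<bar>?c k - of_rat (q k)\<bar> < ?d"
      by metis
    define qs where "qs = map (\<lambda>k. q (Suc k)) [0..<n]"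
    have D: "D qs = psum (\<lambda>k. of_rat (q k)) n"
      unfolding D_def psum_def qs_def by (intro ext sum.cong) auto
    have "(l2_norm \<mu> (\<lambda>x. psum ?c n x - D qs x))\<^sup>2 = (\<Sum>k=1..n. (?c k - of_rat (q k))\<^sup>2)"
      unfolding D psum_diff norm_psum ..
    also have "\<dots> \<le> (\<Sum>k=1..n. ?d\<^sup>2)"
      using less_imp_le[OF q] e by (intro sum_mono) (simp add: abs_le_square_iff[symmetric])
    also have "\<dots> = real n * ?d\<^sup>2" by simp
    also have "\<dots> \<le> (real n + 1)\<^sup>2 * ?d\<^sup>2"
      by (intro mult_right_mono) (auto simp: power2_eq_square algebra_simps)
    also have "\<dots> = (e / 2)\<^sup>2"
    proof -
      have "(real n + 1) * ?d = e / 2"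
        by (simp add: field_simps)
      then show ?thesis
        by (simp only: power_mult_distrib[symmetric])
    qed
    finally have "l2_norm \<mu> (\<lambda>x. psum ?c n x - D qs x) \<le> e / 2"
      using e by - (rule power2_le_imp_le, auto)
    then have "l2_norm \<mu> (\<lambda>x. f x - D qs x) < e"
      using l2_norm_triangle_diff[OF f psum_L2, of "D qs" ?c n] n
      by (simp add: D psum_L2 l2_norm_minus_commute[of \<mu> f])
    then show ?thesis ..
  qed
  have "U \<in> sets ?C" if U: "openin (l2_topology \<mu>) U" for U
  proof -
    \<comment> \<open>A ball of radius 1 / (m + 1) < e / 2 that contains \<open>f\<close> stays
      within distance e of \<open>f\<close>, so the countably many rational balls inside
      \<open>U\<close> cover it.\<close>
    let ?I = "{(qs, m). B (D qs) (1 / Suc m) \<subseteq> U}"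
    have "U = (\<Union>(qs, m)\<in>?I. B (D qs) (1 / Suc m))"
    proof (intro equalityI subsetI)
      fix f assume "f \<in> U"
      then obtain e where f: "f \<in> L2 \<mu>" and e: "0 < e"
        "\<And>g. g \<in> L2 \<mu> \<Longrightarrow> l2_norm \<mu> (\<lambda>x. g x - f x) < e \<Longrightarrow> g \<in> U"
        using U unfolding openin_l2_topology by blast
      obtain m where m: "1 / real (Suc m) < e / 2"
        using nat_approx_posE[of "e / 2"] e by auto
      obtain qs where qs: "l2_norm \<mu> (\<lambda>x. f x - D qs x) < 1 / Suc m"
        using dense[OF f, of "1 / Suc m"] by auto
      have D: "D qs \<in> L2 \<mu>" by (auto simp: D_def)
      have "B (D qs) (1 / Suc m) \<subseteq> U"
      proof
        fix g assume "g \<in> B (D qs) (1 / Suc m)"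
        then have g: "g \<in> L2 \<mu>" "l2_norm \<mu> (\<lambda>x. g x - D qs x) < 1 / Suc m"
          by (auto simp: B_def)
        then have "l2_norm \<mu> (\<lambda>x. g x - f x) < e"
          using l2_norm_triangle_diff[OF g(1) D f] qs m
          by (simp add: l2_norm_minus_commute[of \<mu> "D qs"])
        then show "g \<in> U" using e g by blast
      qed
      then show "f \<in> (\<Union>(qs, m)\<in>?I. B (D qs) (1 / Suc m))"
        using qs f by (auto simp: B_def intro!: exI[of _ qs] exI[of _ m])
    qed auto
    also have "\<dots> \<in> sets ?C"
    proof -
      have "B (D qs) (1 / Suc m) \<in> sets ?C" for qs m
        by (rule ball) (auto simp: D_def)
      then show ?thesis
        by (intro sets.countable_UN'') (auto simp del: of_nat_Suc One_nat_def)
    qed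
    finally show ?thesis .
  qed
  then show "sets (L2_borel \<mu>) \<subseteq> sets ?C"
    unfolding sets_L2_borel using sets.sigma_sets_subset[of "{U. openin (l2_topology \<mu>) U}" ?C] by auto
qed

lemma measurable_L2_borelI:
  assumes "\<And>\<omega>. \<omega> \<in> space M \<Longrightarrow> X \<omega> \<in> L2 \<mu>"
    and "\<And>k. 1 \<le> k \<Longrightarrow> (\<lambda>\<omega>. l2_inner \<mu> (X \<omega>) (\<phi> k)) \<in> borel_measurable M"
  shows "X \<in> M \<rightarrow>\<^sub>M L2_borel \<mu>"
proof (rule measurable_sigma_sets[OF sets_L2_borel_eq_process_sigma[unfolded sets_process_sigma]])
  fix A assume "A \<in> (\<Union>i\<in>{1..}. {(\<lambda>f. l2_inner \<mu> f (\<phi> i)) -` A \<inter> space (L2_borel \<mu>) |A. A \<in> sets borel})"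
  then obtain k S where A: "1 \<le> k" "S \<in> sets borel" "A = (\<lambda>f. l2_inner \<mu> f (\<phi> k)) -` S \<inter> L2 \<mu>"
    by auto
  then have "X -` A \<inter> space M = (\<lambda>\<omega>. l2_inner \<mu> (X \<omega>) (\<phi> k)) -` S \<inter> space M"
    using assms(1) by auto
  then show "X -` A \<inter> space M \<in> sets M"
    using measurable_sets[OF assms(2)[OF A(1)] A(2)] by simp
qed (use assms in auto)

text \<open>Each coordinate of the synthesised function is \<open>c \<omega> k\<close> where the
  squares are summable and 0 elsewhere. Summability is rewritten as finiteness of an extended sum,
  which is a measurable event.\<close>

lemma measurable_synth:
  assumes [measurable]: "\<And>k. 1 \<le> k \<Longrightarrow> (\<lambda>\<omega>. c \<omega> k) \<in> borel_measurable M"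
  shows "(\<lambda>\<omega>. synth (c \<omega>)) \<in> M \<rightarrow>\<^sub>M L2_borel \<mu>"
proof (rule measurable_L2_borelI)
  fix k :: nat assume k: "1 \<le> k"
  have [measurable]: "(\<lambda>\<omega>. c \<omega> (Suc j)) \<in> borel_measurable M" for j
    by (rule assms) simp
  have [measurable]: "(\<lambda>\<omega>. c \<omega> k) \<in> borel_measurable M"
    by (rule assms[OF k])
  have eq: "summable (\<lambda>j. (c \<omega> (Suc j))\<^sup>2) \<longleftrightarrow> (\<Sum>j. ennreal ((c \<omega> (Suc j))\<^sup>2)) \<noteq> top" for \<omega>
  proof
    assume "summable (\<lambda>j. (c \<omega> (Suc j))\<^sup>2)"
    then have "(\<Sum>j. ennreal ((c \<omega> (Suc j))\<^sup>2)) = ennreal (\<Sum>j. (c \<omega> (Suc j))\<^sup>2)"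
      by (intro suminf_ennreal2) auto
    then show "(\<Sum>j. ennreal ((c \<omega> (Suc j))\<^sup>2)) \<noteq> top"
      by simp
  next
    assume "(\<Sum>j. ennreal ((c \<omega> (Suc j))\<^sup>2)) \<noteq> top"
    then show "summable (\<lambda>j. (c \<omega> (Suc j))\<^sup>2)"
      by (intro summable_suminf_not_top) auto
  qed
  have "l2_inner \<mu> (synth (c \<omega>)) (\<phi> k) =
      (if (\<Sum>j. ennreal ((c \<omega> (Suc j))\<^sup>2)) \<noteq> top then c \<omega> k else 0)" for \<omega>
    unfolding eq[symmetric] using inner_synth[of "c \<omega>" k] k by (simp add: synth_not_summable)
  then show "(\<lambda>\<omega>. l2_inner \<mu> (synth (c \<omega>)) (\<phi> k)) \<in> borel_measurable M"
    by simp
qed auto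

end

section \<open>Uniqueness of characteristic functions\<close>

lemma integral_pair_mult:
  fixes f :: "'a \<Rightarrow> complex" and g :: "'b \<Rightarrow> complex"
  assumes "prob_space P" "prob_space Q"
    and [measurable]: "f \<in> borel_measurable P" "g \<in> borel_measurable Q"
    and f: "\<And>x. x \<in> space P \<Longrightarrow> norm (f x) \<le> 1" and g: "\<And>x. x \<in> space Q \<Longrightarrow> norm (g x) \<le> 1"
  shows "(CLINT z|P \<Otimes>\<^sub>M Q. f (fst z) * g (snd z)) = (CLINT x|P. f x) * (CLINT y|Q. g y)"
proof -
  interpret P: prob_space P by fact
  interpret Q: prob_space Q by fact
  interpret PQ: pair_prob_space P Q ..
  have "integrable (P \<Otimes>\<^sub>M Q) (\<lambda>z. f (fst z) * g (snd z))"
  proof (rule PQ.integrable_const_bound[where B = 1])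
    have "norm (f (fst z) * g (snd z)) \<le> 1 * 1" if "z \<in> space (P \<Otimes>\<^sub>M Q)" for z
      unfolding norm_mult using that f g by (intro mult_mono) (auto simp: space_pair_measure)
    then show "AE z in P \<Otimes>\<^sub>M Q. norm (f (fst z) * g (snd z)) \<le> 1"
      by (intro AE_I2) auto
  qed measurable
  from PQ.integral_fst'[OF this] show ?thesis
    by simp
qed

text \<open>Levy uniqueness for the law of \<open>X\<close> after a change of measure with density
  proportional to \<open>Z\<close>. The lower bound 1 on \<open>Z\<close> makes the total mass
  positive, so that it can be normalised.\<close>

lemma measure_eq_if_weighted_char_eq_pos:
  fixes X Z :: "'a \<Rightarrow> real"
  assumes M: "prob_space M" and N: "prob_space N" and sets: "sets M = sets N"
    and [measurable]: "X \<in> borel_measurable M" "Z \<in> borel_measurable M"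
    and Z: "\<And>\<omega>. \<omega> \<in> space M \<Longrightarrow> 1 \<le> Z \<omega>" "\<And>\<omega>. \<omega> \<in> space M \<Longrightarrow> Z \<omega> \<le> C"
    and cos: "\<And>a. (\<integral>\<omega>. Z \<omega> * cos (a * X \<omega>) \<partial>M) = (\<integral>\<omega>. Z \<omega> * cos (a * X \<omega>) \<partial>N)"
    and sin: "\<And>a. (\<integral>\<omega>. Z \<omega> * sin (a * X \<omega>) \<partial>M) = (\<integral>\<omega>. Z \<omega> * sin (a * X \<omega>) \<partial>N)"
    and A: "A \<in> sets borel"
  shows "(\<integral>\<omega>. Z \<omega> * indicator A (X \<omega>) \<partial>M) = (\<integral>\<omega>. Z \<omega> * indicator A (X \<omega>) \<partial>N)"
proof -
  have sp: "space N = space M"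
    using sets_eq_imp_space_eq[OF sets] by simp
  define m where "m = (\<integral>\<omega>. Z \<omega> \<partial>M)"
  have m_N: "m = (\<integral>\<omega>. Z \<omega> \<partial>N)"
    using cos[of 0] by (simp add: m_def)
  have intZ: "integrable K (\<lambda>\<omega>. Z \<omega> * f \<omega>)"
    if "prob_space K" "sets K = sets M" and [measurable]: "f \<in> borel_measurable K"
      and f: "\<And>\<omega>. \<bar>f \<omega>\<bar> \<le> 1" for K f
  proof -
    interpret K: prob_space K by fact
    have [measurable]: "Z \<in> borel_measurable K"
      using \<open>sets K = sets M\<close> by (simp cong: measurable_cong_sets)
    have "\<bar>Z \<omega> * f \<omega>\<bar> \<le> C * 1" if "\<omega> \<in> space K" for \<omega>
      unfolding abs_mult using Z[of \<omega>] f that sets_eq_imp_space_eq[OF \<open>sets K = sets M\<close>]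
      by (intro mult_mono) auto
    then show ?thesis
      by (intro K.integrable_const_bound[where B = C]) auto
  qed
  have m: "0 < m"
  proof -
    interpret M: prob_space M by fact
    have "(\<integral>\<omega>. 1 \<partial>M) \<le> m"
      unfolding m_def using intZ[OF M, of "\<lambda>_. 1"] Z by (intro integral_mono) auto
    then show ?thesis by (simp add: M.prob_space)
  qed
  \<comment> \<open>The normalising constant \<open>m\<close> is common to \<open>M\<close> and
    \<open>N\<close>, by the cosine identity at a = 0.\<close>
  define D where "D K = density K (\<lambda>\<omega>. ennreal (Z \<omega> / m))" for K
  have key: "prob_space (D K) \<and> (\<forall>t. char (distr (D K) borel X) t =
      Complex ((\<integral>\<omega>. Z \<omega> * cos (t * X \<omega>) \<partial>K) / m) ((\<integral>\<omega>. Z \<omega> * sin (t * X \<omega>) \<partial>K) / m)) \<and>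
      measure (distr (D K) borel X) A = (\<integral>\<omega>. Z \<omega> * indicator A (X \<omega>) \<partial>K) / m"
    if K: "prob_space K" and setsK: "sets K = sets M" and mK: "m = (\<integral>\<omega>. Z \<omega> \<partial>K)" for K
  proof (intro conjI allI)
    interpret K: prob_space K by fact
    have [measurable]: "Z \<in> borel_measurable K" "X \<in> borel_measurable K"
      using setsK by (simp_all cong: measurable_cong_sets)
    have Z0: "AE \<omega> in K. 0 \<le> Z \<omega> / m"
      using Z(1) m sets_eq_imp_space_eq[OF setsK] by (intro AE_I2) (force intro!: divide_nonneg_pos)
    note int = intZ[OF K setsK]
    have "emeasure (D K) (space (D K)) = (\<integral>\<^sup>+\<omega>. ennreal (Z \<omega> / m) \<partial>K)"
      unfolding D_def by (simp add: emeasure_density cong: nn_integral_cong)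
    also have "\<dots> = ennreal (\<integral>\<omega>. Z \<omega> / m \<partial>K)"
      using int[of "\<lambda>_. 1"] Z0 by (intro nn_integral_eq_integral) auto
    also have "\<dots> = 1"
      using m mK by simp
    finally show DK: "prob_space (D K)"
      by (rule prob_spaceI)
    interpret D: prob_space "D K" by fact
    have [measurable]: "X \<in> borel_measurable (D K)"
      by (simp add: D_def)
    show "char (distr (D K) borel X) t =
      Complex ((\<integral>\<omega>. Z \<omega> * cos (t * X \<omega>) \<partial>K) / m) ((\<integral>\<omega>. Z \<omega> * sin (t * X \<omega>) \<partial>K) / m)" for t
    proof -
      have "char (distr (D K) borel X) t = (CLINT \<omega>|K. (Z \<omega> / m) *\<^sub>R iexp (t * X \<omega>))"
        unfolding char_def using Z0 by (simp add: integral_distr D_def integral_density del: of_real_mult)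
      also have "\<dots> = (CLINT \<omega>|K. complex_of_real (Z \<omega> * cos (t * X \<omega>) / m)
          + \<i> * complex_of_real (Z \<omega> * sin (t * X \<omega>) / m))"
        by (intro Bochner_Integration.integral_cong) (auto simp: complex_eq_iff Re_exp Im_exp)
      also have "\<dots> = complex_of_real (\<integral>\<omega>. Z \<omega> * cos (t * X \<omega>) / m \<partial>K)
          + \<i> * complex_of_real (\<integral>\<omega>. Z \<omega> * sin (t * X \<omega>) / m \<partial>K)"
        using int[of "\<lambda>\<omega>. cos (t * X \<omega>)"] int[of "\<lambda>\<omega>. sin (t * X \<omega>)"]
        by (subst Bochner_Integration.integral_add)
          (auto simp del: of_real_mult of_real_divide intro!: integrable_of_real integrable_mult_right)
      finally show ?thesis
        by (simp add: complex_eq_iff)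
    qed
    have "measure (distr (D K) borel X) A = measure (D K) (X -` A \<inter> space (D K))"
      using A by (intro measure_distr) auto
    also have "\<dots> = (\<integral>\<omega>. indicator A (X \<omega>) \<partial>D K)"
    proof -
      have "(\<integral>\<omega>. (indicator A (X \<omega>) :: real) \<partial>D K) = (\<integral>\<omega>. indicator (X -` A \<inter> space (D K)) \<omega> \<partial>D K)"
        by (intro Bochner_Integration.integral_cong) (auto simp: indicator_def)
      then show ?thesis
        using A by simp
    qed
    also have "\<dots> = (\<integral>\<omega>. (Z \<omega> / m) *\<^sub>R indicator A (X \<omega>) \<partial>K)"
      unfolding D_def using Z0 A by (intro integral_density) auto
    finally show "measure (distr (D K) borel X) A = (\<integral>\<omega>. Z \<omega> * indicator A (X \<omega>) \<partial>K) / m"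
      by simp
  qed
  have kM: "sets M = sets M" "m = (\<integral>\<omega>. Z \<omega> \<partial>M)"
    by (simp_all add: m_def)
  note kM = key[OF M this] and kN = key[OF N sets[symmetric] m_N]
  have real: "real_distribution (distr (D K) borel X)" if "prob_space (D K)" "X \<in> borel_measurable (D K)" for K
    using that by (simp add: prob_space.real_distribution_distr)
  have "X \<in> borel_measurable (D M)" "X \<in> borel_measurable (D N)"
    using sets by (simp_all add: D_def cong: measurable_cong_sets)
  then have "distr (D M) borel X = distr (D N) borel X"
    using kM kN cos sin by (intro Levy_uniqueness real ext) auto
  then show ?thesis
    using kM kN m by simp
qed

text \<open>A signed weight is not a density, but \<open>Z + 2\<close> takes values in [1, 3]. The
  unweighted identities \<open>cos1\<close> and \<open>sin1\<close> then remove the contribution of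
  the constant 2.\<close>

lemma weighted_measure_eq_if_char_eq:
  fixes X Z :: "'a \<Rightarrow> real"
  assumes M: "prob_space M" and N: "prob_space N" and sets: "sets M = sets N"
    and X [measurable]: "X \<in> borel_measurable M" and Z_meas [measurable]: "Z \<in> borel_measurable M"
    and Z: "\<And>\<omega>. \<bar>Z \<omega>\<bar> \<le> 1"
    and cos1: "\<And>a. (\<integral>\<omega>. cos (a * X \<omega>) \<partial>M) = (\<integral>\<omega>. cos (a * X \<omega>) \<partial>N)"
    and sin1: "\<And>a. (\<integral>\<omega>. sin (a * X \<omega>) \<partial>M) = (\<integral>\<omega>. sin (a * X \<omega>) \<partial>N)"
    and cos: "\<And>a. (\<integral>\<omega>. Z \<omega> * cos (a * X \<omega>) \<partial>M) = (\<integral>\<omega>. Z \<omega> * cos (a * X \<omega>) \<partial>N)"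
    and sin: "\<And>a. (\<integral>\<omega>. Z \<omega> * sin (a * X \<omega>) \<partial>M) = (\<integral>\<omega>. Z \<omega> * sin (a * X \<omega>) \<partial>N)"
    and A: "A \<in> sets borel"
  shows "(\<integral>\<omega>. Z \<omega> * indicator A (X \<omega>) \<partial>M) = (\<integral>\<omega>. Z \<omega> * indicator A (X \<omega>) \<partial>N)"
proof -
  have split: "(\<integral>\<omega>. (Z \<omega> + 2) * f \<omega> \<partial>K) = (\<integral>\<omega>. Z \<omega> * f \<omega> \<partial>K) + 2 * (\<integral>\<omega>. f \<omega> \<partial>K)"
    if "prob_space K" "sets K = sets M" and [measurable]: "f \<in> borel_measurable K"
      and f: "\<And>\<omega>. \<bar>f \<omega>\<bar> \<le> 1" for K f
  proof -
    interpret K: prob_space K by fact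
    have [measurable]: "Z \<in> borel_measurable K"
      using \<open>sets K = sets M\<close> by (simp cong: measurable_cong_sets)
    have "\<bar>Z \<omega> * f \<omega>\<bar> \<le> 1 * 1" for \<omega>
      unfolding abs_mult using Z f by (intro mult_mono) auto
    then have "integrable K (\<lambda>\<omega>. Z \<omega> * f \<omega>)" "integrable K f"
      using f by (auto intro!: K.integrable_const_bound[where B = 1])
    then show ?thesis
      by (simp add: distrib_right)
  qed
  have [measurable]: "X \<in> borel_measurable N" "Z \<in> borel_measurable N"
    using sets by (simp_all cong: measurable_cong_sets)
  have Z': "1 \<le> Z \<omega> + 2" "Z \<omega> + 2 \<le> 3" for \<omega>
    using Z[of \<omega>] by auto
  note split = split[OF M refl] split[OF N sets[symmetric]]
  have "(\<integral>\<omega>. (Z \<omega> + 2) * indicator A (X \<omega>) \<partial>M) = (\<integral>\<omega>. (Z \<omega> + 2) * indicator A (X \<omega>) \<partial>N)"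
    by (rule measure_eq_if_weighted_char_eq_pos[OF M N sets, where C = 3])
      (use Z' A in \<open>auto simp: split cos sin cos1 sin1\<close>)
  moreover have "(\<integral>\<omega>. 1 * indicator A (X \<omega>) \<partial>M) = (\<integral>\<omega>. (1::real) * indicator A (X \<omega>) \<partial>N)"
    by (rule measure_eq_if_weighted_char_eq_pos[OF M N sets, where C = 1 and Z = "\<lambda>_. 1"])
      (use A in \<open>auto simp: cos1 sin1\<close>)
  ultimately show ?thesis
    using A by (simp add: split indicator_le_1 abs_indicator)
qed

text \<open>The exponentials are replaced by indicators one coordinate at a time, which reduces the
  finite-dimensional uniqueness theorem to Levy's theorem on the line.\<close>

lemma integral_prod_indicator_cos_eq:
  fixes X :: "'i \<Rightarrow> 'a \<Rightarrow> real"
  assumes M: "prob_space M" and N: "prob_space N" and sets: "sets M = sets N"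
    and X: "\<And>i. i \<in> I \<Longrightarrow> X i \<in> borel_measurable M"
    and char: "\<And>J a. finite J \<Longrightarrow> J \<subseteq> I \<Longrightarrow>
      (CLINT \<omega>|M. iexp (\<Sum>j\<in>J. a j * X j \<omega>)) = (CLINT \<omega>|N. iexp (\<Sum>j\<in>J. a j * X j \<omega>))"
    and K: "finite K" "K \<subseteq> I" and A: "\<And>i. i \<in> K \<Longrightarrow> A i \<in> sets borel"
    and J: "finite J" "J \<subseteq> I"
  shows "(\<integral>\<omega>. (\<Prod>i\<in>K. indicator (A i) (X i \<omega>)) * cos ((\<Sum>j\<in>J. a j * X j \<omega>) + \<beta>) \<partial>M)
       = (\<integral>\<omega>. (\<Prod>i\<in>K. indicator (A i) (X i \<omega>)) * cos ((\<Sum>j\<in>J. a j * X j \<omega>) + \<beta>) \<partial>N)"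
  using K A J
proof (induction K arbitrary: J a \<beta> rule: finite_induct)
  case empty
  have [measurable]: "X i \<in> borel_measurable M" "X i \<in> borel_measurable N" if "i \<in> J" for i
    using X sets that empty by (auto cong: measurable_cong_sets)
  have "(\<integral>\<omega>. cos ((\<Sum>j\<in>J. a j * X j \<omega>) + \<beta>) \<partial>K) = Re (iexp \<beta> * (CLINT \<omega>|K. iexp (\<Sum>j\<in>J. a j * X j \<omega>)))"
    if "prob_space K" and [measurable]: "(\<lambda>\<omega>. \<Sum>j\<in>J. a j * X j \<omega>) \<in> borel_measurable K" for K
  proof -
    interpret K: prob_space K by fact
    have "integrable K (\<lambda>\<omega>. iexp \<beta> * iexp (\<Sum>j\<in>J. a j * X j \<omega>))"
      by (intro integrable_mult_right K.integrable_iexp) (auto simp del: of_real_sum of_real_mult)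
    then have "Re (CLINT \<omega>|K. iexp \<beta> * iexp (\<Sum>j\<in>J. a j * X j \<omega>))
        = (\<integral>\<omega>. Re (iexp \<beta> * iexp (\<Sum>j\<in>J. a j * X j \<omega>)) \<partial>K)"
      by (rule integral_Re[symmetric])
    also have "\<dots> = (\<integral>\<omega>. cos ((\<Sum>j\<in>J. a j * X j \<omega>) + \<beta>) \<partial>K)"
      by (intro Bochner_Integration.integral_cong refl)
        (simp add: exp_add[symmetric] distrib_left[symmetric] of_real_add[symmetric] Re_exp add.commute
          del: of_real_add of_real_sum)
    finally show ?thesis by simp
  qed
  from this[OF M] this[OF N] show ?case
    using char[of J a] empty by simp
next
  case (insert i K)
  have i: "i \<in> I" "A i \<in> sets borel" using insert.prems by auto
  have [measurable]: "X k \<in> borel_measurable M" "X k \<in> borel_measurable N" if "k \<in> I" for k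
    using X sets that by (auto cong: measurable_cong_sets)
  have meas [measurable]: "X i \<in> borel_measurable M" "X i \<in> borel_measurable N"
    "\<And>k. k \<in> K \<Longrightarrow> X k \<in> borel_measurable M" "\<And>k. k \<in> K \<Longrightarrow> X k \<in> borel_measurable N"
    "\<And>k. k \<in> J \<Longrightarrow> X k \<in> borel_measurable M" "\<And>k. k \<in> J \<Longrightarrow> X k \<in> borel_measurable N"
    using i insert.prems by auto
  have [measurable]: "A k \<in> sets borel" if "k \<in> K" for k
    using insert.prems that by auto
  define S where "S \<omega> = (\<Sum>j\<in>J. a j * X j \<omega>)" for \<omega>
  define p where "p \<omega> = (\<Prod>k\<in>K. indicator (A k) (X k \<omega>) :: real)" for \<omega>
  have S [measurable]: "S \<in> borel_measurable M" "S \<in> borel_measurable N"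
    unfolding S_def by measurable
  have p [measurable]: "p \<in> borel_measurable M" "p \<in> borel_measurable N"
    unfolding p_def by measurable
  have p01: "\<bar>p \<omega>\<bar> \<le> 1" for \<omega>
  proof -
    have "0 \<le> p \<omega>" unfolding p_def by (intro prod_nonneg) auto
    moreover have "p \<omega> \<le> 1" unfolding p_def by (intro prod_le_1) auto
    ultimately show ?thesis by simp
  qed
  have IH: "(\<integral>\<omega>. p \<omega> * cos (S \<omega> + b * X i \<omega> + \<gamma>) \<partial>M) = (\<integral>\<omega>. p \<omega> * cos (S \<omega> + b * X i \<omega> + \<gamma>) \<partial>N)" for b \<gamma>
  proof -
    \<comment> \<open>\<open>i\<close> may already occur in \<open>J\<close>, so the two
      coefficients are added.\<close>
    let ?a = "\<lambda>j. (if j \<in> J then a j else 0) + (if j = i then b else 0)"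
    have "(\<Sum>j\<in>insert i J. ?a j * X j \<omega>) = S \<omega> + b * X i \<omega>" for \<omega>
    proof -
      have "(\<Sum>j\<in>insert i J. ?a j * X j \<omega>)
          = (\<Sum>j\<in>insert i J. if j \<in> J then a j * X j \<omega> else 0) + (\<Sum>j\<in>insert i J. if j = i then b * X j \<omega> else 0)"
        unfolding sum.distrib[symmetric] by (intro sum.cong) (auto simp: distrib_right)
      also have "(\<Sum>j\<in>insert i J. if j \<in> J then a j * X j \<omega> else 0) = S \<omega>"
        unfolding S_def using insert.prems by (intro sum.mono_neutral_cong_right) auto
      finally show ?thesis using insert.prems by (simp add: sum.delta)
    qed
    then show ?thesis
      using insert.IH[of "insert i J" ?a \<gamma>] insert.prems by (simp add: p_def)
  qed
  have IH0: "(\<integral>\<omega>. p \<omega> * cos (S \<omega> + \<gamma>) \<partial>M) = (\<integral>\<omega>. p \<omega> * cos (S \<omega> + \<gamma>) \<partial>N)" for \<gamma>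
    using IH[of 0] by simp
  have one: "(CLINT \<omega>|M. iexp (b * X i \<omega>)) = (CLINT \<omega>|N. iexp (b * X i \<omega>))" for b
    using char[of "{i}" "\<lambda>_. b"] i by simp
  have int: "integrable K (\<lambda>\<omega>. p \<omega> * f \<omega>)"
    if "prob_space K" and [measurable]: "p \<in> borel_measurable K" "f \<in> borel_measurable K"
      and f: "\<And>\<omega>. \<bar>f \<omega>\<bar> \<le> 1" for K and f :: "'a \<Rightarrow> real"
  proof -
    interpret K: prob_space K by fact
    have "\<bar>p \<omega> * f \<omega>\<bar> \<le> 1 * 1" for \<omega>
      unfolding abs_mult using p01 f by (intro mult_mono) auto
    then show ?thesis
      by (intro K.integrable_const_bound[where B = 1]) auto
  qed
  note int = int[OF M p(1)] int[OF N p(2)]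
  have "(\<integral>\<omega>. (p \<omega> * cos (S \<omega> + \<beta>)) * indicator (A i) (X i \<omega>) \<partial>M)
      = (\<integral>\<omega>. (p \<omega> * cos (S \<omega> + \<beta>)) * indicator (A i) (X i \<omega>) \<partial>N)"
  proof (rule weighted_measure_eq_if_char_eq[OF M N sets])
    show "\<bar>p \<omega> * cos (S \<omega> + \<beta>)\<bar> \<le> 1" for \<omega>
      unfolding abs_mult using mult_mono[OF p01[of \<omega>] abs_cos_le_one[of "S \<omega> + \<beta>"]] by simp
    interpret M: prob_space M by fact
    interpret N: prob_space N by fact
    have "Re (CLINT \<omega>|M. iexp (b * X i \<omega>)) = Re (CLINT \<omega>|N. iexp (b * X i \<omega>))"
      "Im (CLINT \<omega>|M. iexp (b * X i \<omega>)) = Im (CLINT \<omega>|N. iexp (b * X i \<omega>))" for b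
      using one by simp_all
    then show "(\<integral>\<omega>. cos (b * X i \<omega>) \<partial>M) = (\<integral>\<omega>. cos (b * X i \<omega>) \<partial>N)"
      "(\<integral>\<omega>. sin (b * X i \<omega>) \<partial>M) = (\<integral>\<omega>. sin (b * X i \<omega>) \<partial>N)" for b
      by (simp_all add: integral_Re[symmetric] integral_Im[symmetric] M.integrable_iexp N.integrable_iexp
          Re_exp Im_exp del: integral_Re integral_Im of_real_mult)
    \<comment> \<open>Product-to-sum formula: what remains is the induction hypothesis for
      \<open>b\<close> and \<open>- b\<close>.\<close>
    have c: "(p \<omega> * cos (S \<omega> + \<beta>)) * cos (b * X i \<omega>)
        = (p \<omega> * cos (S \<omega> + b * X i \<omega> + \<beta>) + p \<omega> * cos (S \<omega> + (- b) * X i \<omega> + \<beta>)) / 2" for b \<omega>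
    proof -
      have "cos (S \<omega> + b * X i \<omega> + \<beta>) = cos ((S \<omega> + \<beta>) + b * X i \<omega>)"
        by (rule arg_cong[of _ _ cos]) simp
      note e1 = this[unfolded cos_add[of "S \<omega> + \<beta>"]]
      have "cos (S \<omega> + (- b) * X i \<omega> + \<beta>) = cos ((S \<omega> + \<beta>) - b * X i \<omega>)"
        by (rule arg_cong[of _ _ cos]) simp
      note e2 = this[unfolded cos_diff]
      show ?thesis
        unfolding e1 e2 by (simp add: algebra_simps)
    qed
    show "(\<integral>\<omega>. (p \<omega> * cos (S \<omega> + \<beta>)) * cos (b * X i \<omega>) \<partial>M)
        = (\<integral>\<omega>. (p \<omega> * cos (S \<omega> + \<beta>)) * cos (b * X i \<omega>) \<partial>N)" for b
      unfolding c using IH[of b \<beta>] IH[of "-b" \<beta>] by (simp add: int)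
    \<comment> \<open>The sine is a cosine with phase shifted by pi / 2. This is why the induction
      carries a free phase \<beta>.\<close>
    have s: "(p \<omega> * cos (S \<omega> + \<beta>)) * sin (b * X i \<omega>)
        = (p \<omega> * cos (S \<omega> + b * X i \<omega> + (\<beta> - pi / 2)) - p \<omega> * cos (S \<omega> + (- b) * X i \<omega> + (\<beta> - pi / 2))) / 2" for b \<omega>
    proof -
      have e: "cos (y - pi / 2) = sin y" for y :: real by (simp add: cos_diff)
      have "cos (S \<omega> + b * X i \<omega> + (\<beta> - pi / 2)) = sin ((S \<omega> + \<beta>) + b * X i \<omega>)"
        unfolding e[symmetric] by (rule arg_cong[of _ _ cos]) simp
      note e1 = this[unfolded sin_add[of "S \<omega> + \<beta>"]]
      have "cos (S \<omega> + (- b) * X i \<omega> + (\<beta> - pi / 2)) = sin ((S \<omega> + \<beta>) - b * X i \<omega>)"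
        unfolding e[symmetric] by (rule arg_cong[of _ _ cos]) simp
      note e2 = this[unfolded sin_diff]
      show ?thesis
        unfolding e1 e2 by (simp add: algebra_simps)
    qed
    show "(\<integral>\<omega>. (p \<omega> * cos (S \<omega> + \<beta>)) * sin (b * X i \<omega>) \<partial>M)
        = (\<integral>\<omega>. (p \<omega> * cos (S \<omega> + \<beta>)) * sin (b * X i \<omega>) \<partial>N)" for b
      unfolding s using IH[of b "\<beta> - pi / 2"] IH[of "-b" "\<beta> - pi / 2"] by (simp add: int)
  qed (use i in auto)
  then show ?case
    using insert.hyps by (simp add: p_def S_def mult_ac)
qed

text \<open>The probability of a cylinder is the integral of a product of indicators, i.e. the
  preceding lemma with \<open>J\<close> empty. Cylinders over finite index sets form an
  intersection-stable generator, whatever the size of \<open>I\<close>.\<close>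

lemma emeasure_eq_if_char_eq:
  fixes X :: "'i \<Rightarrow> 'a \<Rightarrow> real"
  assumes M: "prob_space M" and N: "prob_space N" and sets: "sets M = sets N"
    and X: "\<And>i. i \<in> I \<Longrightarrow> X i \<in> borel_measurable M"
    and char: "\<And>J a. finite J \<Longrightarrow> J \<subseteq> I \<Longrightarrow>
      (CLINT \<omega>|M. iexp (\<Sum>j\<in>J. a j * X j \<omega>)) = (CLINT \<omega>|N. iexp (\<Sum>j\<in>J. a j * X j \<omega>))"
    and B: "B \<in> sets (process_sigma M borel X I)"
  shows "emeasure M B = emeasure N B"
proof -
  interpret M: prob_space M by fact
  interpret N: prob_space N by fact
  have sp: "space N = space M"
    using sets_eq_imp_space_eq[OF sets] by simp
  let ?cyl = "\<lambda>K A. {\<omega> \<in> space M. \<forall>i\<in>K. X i \<omega> \<in> A i}"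
  define G where "G = {?cyl K A | K A. finite K \<and> K \<subseteq> I \<and> (\<forall>i\<in>K. A i \<in> sets borel)}"
  have cyl_meas: "?cyl K A \<in> sets M" if "finite K" "K \<subseteq> I" "\<forall>i\<in>K. A i \<in> sets borel" for K A
  proof -
    have "{\<omega> \<in> space M. X i \<omega> \<in> A i} \<in> sets M" if "i \<in> K" for i
      using measurable_sets[OF X, of i "A i"] that \<open>K \<subseteq> I\<close> \<open>\<forall>i\<in>K. A i \<in> sets borel\<close>
      by (auto simp: vimage_def Int_def conj_commute)
    then show ?thesis
      using that(1) by (intro sets.sets_Collect_finite_All) auto
  qed
  have G_eq: "emeasure M C = emeasure N C" if "C \<in> G" for C
  proof -
    obtain K A where KA: "finite K" "K \<subseteq> I" "\<forall>i\<in>K. A i \<in> sets borel" "C = ?cyl K A"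
      using \<open>C \<in> G\<close> unfolding G_def by blast
    have "(\<integral>\<omega>. (\<Prod>i\<in>K. indicator (A i) (X i \<omega>)) * cos ((\<Sum>j\<in>{}. 0 * X j \<omega>) + 0) \<partial>M)
        = (\<integral>\<omega>. (\<Prod>i\<in>K. indicator (A i) (X i \<omega>)) * cos ((\<Sum>j\<in>{}. 0 * X j \<omega>) + 0) \<partial>N)"
      by (rule integral_prod_indicator_cos_eq[OF M N sets X char]) (use KA in auto)
    then have "(\<integral>\<omega>. (\<Prod>i\<in>K. indicator (A i) (X i \<omega>)) \<partial>M) = (\<integral>\<omega>. (\<Prod>i\<in>K. indicator (A i) (X i \<omega>) :: real) \<partial>N)"
      by simp
    moreover have ind: "(\<Prod>i\<in>K. indicator (A i) (X i \<omega>)) = (indicator C \<omega> :: real)" if \<omega>: "\<omega> \<in> space M" for \<omega>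
    proof (cases "\<omega> \<in> C")
      case True
      then show ?thesis by (auto simp: KA intro!: prod.neutral)
    next
      case False
      then obtain i where "i \<in> K" "X i \<omega> \<notin> A i" using \<omega> by (auto simp: KA)
      then show ?thesis using False KA(1) by (auto intro!: prod_zero bexI[of _ i])
    qed
    have "(\<integral>\<omega>. (\<Prod>i\<in>K. indicator (A i) (X i \<omega>) :: real) \<partial>M) = (\<integral>\<omega>. indicator C \<omega> \<partial>M)"
      by (intro Bochner_Integration.integral_cong) (auto simp: ind)
    moreover have "(\<integral>\<omega>. (\<Prod>i\<in>K. indicator (A i) (X i \<omega>) :: real) \<partial>N) = (\<integral>\<omega>. indicator C \<omega> \<partial>N)"
      by (intro Bochner_Integration.integral_cong) (auto simp: ind sp)
    ultimately have "measure M C = measure N C"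
      using cyl_meas[OF KA(1-3)] sets KA(4) by simp
    then show ?thesis
      by (simp add: M.emeasure_eq_measure N.emeasure_eq_measure)
  qed
  have "Int_stable G"
  proof (rule Int_stableI)
    fix C D assume "C \<in> G" "D \<in> G"
    then obtain K A L E where "finite K" "K \<subseteq> I" "\<forall>i\<in>K. A i \<in> sets borel" "C = ?cyl K A"
      "finite L" "L \<subseteq> I" "\<forall>i\<in>L. E i \<in> sets borel" "D = ?cyl L E"
      unfolding G_def by blast
    \<comment> \<open>An index constrained in only one of the cylinders gets \<open>UNIV\<close>
      from the other.\<close>
    then show "C \<inter> D \<in> G"
      unfolding G_def
      by (intro CollectI exI[of _ "K \<union> L"]
          exI[of _ "\<lambda>i. (if i \<in> K then A i else UNIV) \<inter> (if i \<in> L then E i else UNIV)"]) auto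
  qed
  moreover have G_Pow: "G \<subseteq> Pow (space M)" by (auto simp: G_def)
  moreover have "B \<in> sigma_sets (space M) G"
  proof -
    have "(\<Union>i\<in>I. {X i -` A \<inter> space M | A. A \<in> sets borel}) \<subseteq> G"
    proof safe
      fix i and A :: "real set" assume "i \<in> I" "A \<in> sets borel"
      then show "X i -` A \<inter> space M \<in> G"
        unfolding G_def by (intro CollectI exI[of _ "{i}"] exI[of _ "\<lambda>_. A"]) auto
    qed
    then show ?thesis
      using B unfolding sets_process_sigma by (meson sigma_sets_mono' subsetD)
  qed
  ultimately show ?thesis
  proof (induction rule: sigma_sets_induct_disjoint)
    case (basic A)
    then show ?case by (rule G_eq)
  next
    case (compl A)
    have "sigma_sets (space M) G \<subseteq> sets M"
      by (intro sets.sigma_sets_subset) (auto simp: G_def intro: cyl_meas)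
    then have A: "A \<in> sets M" "A \<in> sets N" using compl sets by auto
    then show ?case
      using compl emeasure_compl[OF A(1)] emeasure_compl[OF A(2)]
      by (simp add: sp M.emeasure_space_1 N.emeasure_space_1[unfolded sp])
  next
    case (union A)
    have "sigma_sets (space M) G \<subseteq> sets M"
      by (intro sets.sigma_sets_subset) (auto simp: G_def intro: cyl_meas)
    then have A: "range A \<subseteq> sets M" "range A \<subseteq> sets N" using union sets by auto
    show ?case
      using suminf_emeasure[OF A(1) union(1)] suminf_emeasure[OF A(2) union(1)] union(3) by simp
  qed auto
qed

text \<open>Independence says that the image of \<open>P\<close> on the diagonal of
  \<open>P \<Otimes>\<^sub>M P\<close> agrees with the product on rectangles. Factorisation of
  characteristic functions is precisely equality of characteristic functions under these two
  measures, so the uniqueness lemma applies.\<close>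

lemma indep_set_process_sigma_if_char:
  fixes X :: "'i \<Rightarrow> 'a \<Rightarrow> real" and Y :: "'j \<Rightarrow> 'a \<Rightarrow> real"
  assumes P: "prob_space P"
    and X: "\<And>i. i \<in> I \<Longrightarrow> X i \<in> borel_measurable P"
    and Y: "\<And>j. j \<in> J \<Longrightarrow> Y j \<in> borel_measurable P"
    and char: "\<And>K L a b. finite K \<Longrightarrow> K \<subseteq> I \<Longrightarrow> finite L \<Longrightarrow> L \<subseteq> J \<Longrightarrow>
      (CLINT \<omega>|P. iexp ((\<Sum>i\<in>K. a i * X i \<omega>) + (\<Sum>j\<in>L. b j * Y j \<omega>)))
        = (CLINT \<omega>|P. iexp (\<Sum>i\<in>K. a i * X i \<omega>)) * (CLINT \<omega>|P. iexp (\<Sum>j\<in>L. b j * Y j \<omega>))"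
  shows "prob_space.indep_set P (sets (process_sigma P borel X I)) (sets (process_sigma P borel Y J))"
proof -
  interpret P: prob_space P by fact
  interpret PP: pair_prob_space P P ..
  let ?N = "P \<Otimes>\<^sub>M P"
  let ?M = "distr P ?N (\<lambda>\<omega>. (\<omega>, \<omega>))"
  \<comment> \<open>Indices of \<open>X\<close> read the first factor and indices of
    \<open>Y\<close> the second; on the diagonal both read the same point.\<close>
  define Z where "Z k z = (case k of Inl i \<Rightarrow> X i (fst z) | Inr j \<Rightarrow> Y j (snd z))" for k z
  have subX: "sets (process_sigma P borel X I) \<subseteq> sets P"
    by (rule sets_process_sigma_subset) (use X in auto)
  have subY: "sets (process_sigma P borel Y J) \<subseteq> sets P"
    by (rule sets_process_sigma_subset) (use Y in auto)
  have M: "prob_space ?M" by (rule P.prob_space_distr) measurable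
  have Z_meas: "Z k \<in> borel_measurable ?N" if "k \<in> I <+> J" for k
    using that X Y by (auto simp: Z_def[abs_def] intro: measurable_compose[OF measurable_fst] measurable_compose[OF measurable_snd])
  have eq: "emeasure ?M C = emeasure ?N C" if "C \<in> sets (process_sigma ?M borel Z (I <+> J))" for C
  proof (rule emeasure_eq_if_char_eq[OF M PP.prob_space_axioms _ _ _ that])
    fix H :: "('i + 'j) set" and a assume H: "finite H" "H \<subseteq> I <+> J"
    define K L where "K = Inl -` H" and "L = Inr -` H"
    have "x \<in> H \<longleftrightarrow> x \<in> K <+> L" for x
      by (cases x) (auto simp: K_def L_def)
    then have KL: "H = K <+> L" "finite K" "finite L" "K \<subseteq> I" "L \<subseteq> J"
      using H finite_vimageI[OF H(1) inj_Inl] finite_vimageI[OF H(1) inj_Inr]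
      by (auto simp: K_def L_def)
    have S: "(\<Sum>k\<in>H. a k * Z k z) = (\<Sum>i\<in>K. a (Inl i) * X i (fst z)) + (\<Sum>j\<in>L. a (Inr j) * Y j (snd z))" for z
      unfolding KL(1) by (simp add: sum.Plus[OF KL(2,3)] Z_def)
    have mX [measurable]: "(\<lambda>\<omega>. \<Sum>i\<in>K. a (Inl i) * X i \<omega>) \<in> borel_measurable P"
      using X KL by (intro borel_measurable_sum borel_measurable_times) auto
    have mY [measurable]: "(\<lambda>\<omega>. \<Sum>j\<in>L. a (Inr j) * Y j \<omega>) \<in> borel_measurable P"
      using Y KL by (intro borel_measurable_sum borel_measurable_times) auto
    have mZ [measurable]: "(\<lambda>z. \<Sum>k\<in>H. a k * Z k z) \<in> borel_measurable ?N"
      using Z_meas H by (intro borel_measurable_sum borel_measurable_times) auto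
    have "(CLINT \<omega>|?M. iexp (\<Sum>k\<in>H. a k * Z k \<omega>))
        = (CLINT \<omega>|P. iexp ((\<Sum>i\<in>K. a (Inl i) * X i \<omega>) + (\<Sum>j\<in>L. a (Inr j) * Y j \<omega>)))"
      by (subst integral_distr) (auto simp: S simp del: of_real_sum of_real_mult of_real_add)
    also have "\<dots> = (CLINT \<omega>|P. iexp (\<Sum>i\<in>K. a (Inl i) * X i \<omega>)) * (CLINT \<omega>|P. iexp (\<Sum>j\<in>L. a (Inr j) * Y j \<omega>))"
      using KL by (intro char) auto
    also have "\<dots> = (CLINT z|?N. iexp (\<Sum>i\<in>K. a (Inl i) * X i (fst z)) * iexp (\<Sum>j\<in>L. a (Inr j) * Y j (snd z)))"
      by (rule integral_pair_mult[symmetric, OF P P]) (auto simp del: of_real_sum of_real_mult of_real_add)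
    also have "\<dots> = (CLINT z|?N. iexp (\<Sum>k\<in>H. a k * Z k z))"
      by (simp add: S exp_add distrib_left)
    finally show "(CLINT \<omega>|?M. iexp (\<Sum>k\<in>H. a k * Z k \<omega>)) = (CLINT z|?N. iexp (\<Sum>k\<in>H. a k * Z k z))" .
  qed (use Z_meas in auto)
  have "P.prob (A \<inter> B) = P.prob A * P.prob B"
    if A: "A \<in> sets (process_sigma P borel X I)" and B: "B \<in> sets (process_sigma P borel Y J)" for A B
  proof -
    \<comment> \<open>The strips \<open>A \<times> space P\<close> and
      \<open>space P \<times> B\<close> are both events of \<open>?C\<close>, hence so is the
      rectangle.\<close>
    let ?C = "process_sigma ?M borel Z (I <+> J)"
    have sp: "space ?C = space P \<times> space P"
      by (simp add: space_pair_measure)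
    have "fst \<in> ?C \<rightarrow>\<^sub>M process_sigma P borel X I"
      unfolding process_sigma_def[of P borel X]
    proof (rule measurable_measure_of)
      fix D assume "D \<in> (\<Union>i\<in>I. {X i -` A \<inter> space P |A. A \<in> sets borel})"
      then obtain i S where D: "i \<in> I" "S \<in> sets borel" "D = X i -` S \<inter> space P" by auto
      have "Z (Inl i) -` S \<inter> space ?C \<in> sets ?C"
        using D by (intro measurable_sets[OF measurable_process_sigma]) auto
      also have "Z (Inl i) -` S \<inter> space ?C = fst -` D \<inter> space ?C"
        using D by (auto simp: Z_def space_pair_measure)
      finally show "fst -` D \<inter> space ?C \<in> sets ?C" .
    qed (auto simp: space_pair_measure)
    from measurable_sets[OF this A] have A': "A \<times> space P \<in> sets ?C"
      using sets.sets_into_space[OF A] by (auto simp: space_pair_measure elim!: back_subst[of "\<lambda>x. x \<in> sets ?C"])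
    have "snd \<in> ?C \<rightarrow>\<^sub>M process_sigma P borel Y J"
      unfolding process_sigma_def[of P borel Y]
    proof (rule measurable_measure_of)
      fix D assume "D \<in> (\<Union>i\<in>J. {Y i -` A \<inter> space P |A. A \<in> sets borel})"
      then obtain i S where D: "i \<in> J" "S \<in> sets borel" "D = Y i -` S \<inter> space P" by auto
      have "Z (Inr i) -` S \<inter> space ?C \<in> sets ?C"
        using D by (intro measurable_sets[OF measurable_process_sigma]) auto
      also have "Z (Inr i) -` S \<inter> space ?C = snd -` D \<inter> space ?C"
        using D by (auto simp: Z_def space_pair_measure)
      finally show "snd -` D \<inter> space ?C \<in> sets ?C" .
    qed (auto simp: space_pair_measure)
    from measurable_sets[OF this B] have B': "space P \<times> B \<in> sets ?C"
      using sets.sets_into_space[OF B] by (auto simp: space_pair_measure elim!: back_subst[of "\<lambda>x. x \<in> sets ?C"])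
    have "(A \<times> space P) \<inter> (space P \<times> B) = A \<times> B"
      using sets.sets_into_space[OF A] sets.sets_into_space[OF B] by auto
    then have AB: "A \<times> B \<in> sets ?C"
      using sets.Int[OF A' B'] by simp
    have [measurable]: "A \<in> sets P" "B \<in> sets P"
      using A B subX subY by auto
    have "emeasure P (A \<inter> B) = emeasure ?M (A \<times> B)"
      using sets.sets_into_space[OF A]
      by (subst emeasure_distr) (auto intro!: arg_cong[of _ _ "emeasure P"])
    also have "\<dots> = emeasure P A * emeasure P B"
      using eq[OF AB] by (simp add: P.emeasure_pair_measure_Times)
    finally show ?thesis
      by (simp add: P.emeasure_eq_measure measure_nonneg flip: ennreal_mult)
  qed
  then show ?thesis
    unfolding P.indep_sets2_eq using subX subY by blast
qed

section \<open>Increments of the cylindrical Wiener process\<close>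

lemma tensor_integrable:
  fixes u :: "'a \<Rightarrow> real" and v :: "'b \<Rightarrow> real"
  assumes "sigma_finite_measure A" "sigma_finite_measure B" and u: "integrable A u" and v: "integrable B v"
  shows "integrable (A \<Otimes>\<^sub>M B) (\<lambda>(s, x). u s * v x)"
    and "(\<integral>z. (case z of (s, x) \<Rightarrow> u s * v x) \<partial>(A \<Otimes>\<^sub>M B)) = (\<integral>s. u s \<partial>A) * (\<integral>x. v x \<partial>B)"
proof -
  interpret A: sigma_finite_measure A by fact
  interpret B: sigma_finite_measure B by fact
  interpret AB: pair_sigma_finite A B ..
  have [measurable]: "u \<in> borel_measurable A" "v \<in> borel_measurable B"
    using u v by auto
  show int: "integrable (A \<Otimes>\<^sub>M B) (\<lambda>(s, x). u s * v x)"
  proof (rule AB.Fubini_integrable)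
    show "integrable A (\<lambda>s. \<integral>x. norm (case (s, x) of (s, x) \<Rightarrow> u s * v x) \<partial>B)"
      using u by (simp add: abs_mult)
    show "AE s in A. integrable B (\<lambda>x. case (s, x) of (s, x) \<Rightarrow> u s * v x)"
      using v by simp
  qed measurable
  from AB.integral_fst'[OF int] show "(\<integral>z. (case z of (s, x) \<Rightarrow> u s * v x) \<partial>(A \<Otimes>\<^sub>M B)) = (\<integral>s. u s \<partial>A) * (\<integral>x. v x \<partial>B)"
    by simp
qed

lemma tensor_L2:
  assumes "sigma_finite_measure A" "sigma_finite_measure B" and f: "f \<in> L2 A" and g: "g \<in> L2 B"
  shows "(\<lambda>(s, x). f s * g x) \<in> L2 (A \<Otimes>\<^sub>M B)"
proof -
  note [measurable] = L2_measurable[OF f] L2_measurable[OF g]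
  have "(\<lambda>(s, x). f s * g x) \<in> borel_measurable (A \<Otimes>\<^sub>M B)"
    by measurable
  moreover have "(\<lambda>z. (case z of (s, x) \<Rightarrow> f s * g x)\<^sup>2) = (\<lambda>(s, x). (f s)\<^sup>2 * (g x)\<^sup>2)"
    by (auto simp: power_mult_distrib)
  ultimately show ?thesis
    using tensor_integrable(1)[OF assms(1,2) L2_integrable_square[OF f] L2_integrable_square[OF g]]
    by (simp add: L2_def)
qed

lemma tensor_inner:
  assumes "sigma_finite_measure A" "sigma_finite_measure B"
    and "f \<in> L2 A" "g \<in> L2 B" "f' \<in> L2 A" "g' \<in> L2 B"
  shows "l2_inner (A \<Otimes>\<^sub>M B) (\<lambda>(s, x). f s * g x) (\<lambda>(s, x). f' s * g' x) = l2_inner A f f' * l2_inner B g g'"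
proof -
  have "(\<lambda>z. (case z of (s, x) \<Rightarrow> f s * g x) * (case z of (s, x) \<Rightarrow> f' s * g' x))
      = (\<lambda>(s, x). (f s * f' s) * (g x * g' x))"
    by (auto simp: mult_ac)
  then show ?thesis
    using tensor_integrable(2)[OF assms(1,2) L2_integrable_mult[OF assms(3,5)] L2_integrable_mult[OF assms(4,6)]]
    by (simp add: l2_inner_def)
qed

lemma indicator_Ioc_L2 [simp]: "(indicator {a<..b} :: real \<Rightarrow> real) \<in> L2 lborel"
proof -
  have "(\<lambda>x. (indicator {a<..b} x :: real)\<^sup>2) = indicator {a<..b}"
    by (auto simp: indicator_def)
  moreover have "integrable lborel (indicator {a<..b} :: real \<Rightarrow> real)"
    by (cases "a \<le> b") (auto intro!: integrable_real_indicator)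
  ultimately show ?thesis
    by (simp add: L2_def)
qed

lemma norm_indicator_Ioc: "a \<le> b \<Longrightarrow> (l2_norm lborel (indicator {a<..b} :: real \<Rightarrow> real))\<^sup>2 = b - a"
proof -
  assume "a \<le> b"
  have "(\<lambda>x. (indicator {a<..b} x :: real)\<^sup>2) = indicator {a<..b}"
    by (auto simp: indicator_def)
  then show ?thesis
    using \<open>a \<le> b\<close> by (simp add: l2_norm_square_integral)
qed

section \<open>Normal variables and independence of pairs\<close>

lemma (in prob_space) normal_second_moment:
  assumes "0 < \<sigma>" "distributed M lborel X (normal_density 0 \<sigma>)"
  shows "integrable M (\<lambda>x. (X x)\<^sup>2)" "(\<integral>x. (X x)\<^sup>2 \<partial>M) = \<sigma>\<^sup>2"
proof -
  have "integrable lborel (\<lambda>x. normal_density 0 \<sigma> x * (x - 0) ^ 2)"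
    using assms(1) by (rule integrable_normal_moment)
  then show "integrable M (\<lambda>x. (X x)\<^sup>2)"
    using distributed_integrable[OF assms(2), of "\<lambda>x. x\<^sup>2"] by simp
  show "(\<integral>x. (X x)\<^sup>2 \<partial>M) = \<sigma>\<^sup>2"
    using distributed_integral[OF assms(2), of "\<lambda>x. x\<^sup>2"] integral_normal_moment_even[OF assms(1), of 0 1]
    by (simp add: eval_nat_numeral)
qed

lemma (in prob_space) normal_char:
  assumes "0 < \<sigma>" "distributed M lborel X (normal_density 0 \<sigma>)"
  shows "char (distr M borel X) t = complex_of_real (exp (- (t\<^sup>2 * \<sigma>\<^sup>2) / 2))"
proof -
  have D: "distributed M lborel (\<lambda>x. X x / \<sigma>) std_normal_density"
    using normal_standard_normal_convert[OF assms(1), of X 0] assms(2) by simp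
  have [measurable]: "X \<in> borel_measurable M"
    using distributed_measurable[OF assms(2)] by simp
  have "distr M borel (\<lambda>x. X x / \<sigma>) = distr M lborel (\<lambda>x. X x / \<sigma>)"
    by (intro distr_cong) auto
  also have "\<dots> = std_normal_distribution"
    using D by (simp add: distributed_distr_eq_density)
  finally have "char (distr M borel (\<lambda>x. X x / \<sigma>)) (t * \<sigma>) = complex_of_real (exp (- ((t * \<sigma>)\<^sup>2) / 2))"
    by (simp add: char_std_normal_distribution)
  then show ?thesis
    using assms(1) by (simp add: char_def integral_distr power_mult_distrib)
qed

lemma iexp_measurable [measurable (raw)]:
  "f \<in> borel_measurable M \<Longrightarrow> (\<lambda>x. iexp (f x)) \<in> borel_measurable M"
  by simp

text \<open>Bridge from independence of whole sigma-algebras, such as \<open>Fil s\<close> or the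
  one generated by \<open>u0\<close>, to a single pair of variables, for which characteristic
  functions multiply.\<close>

lemma (in prob_space) indep_var_if_indep_set:
  assumes ind: "indep_set (sets A) (sets B)" and sp: "space A = space M" "space B = space M"
    and U: "U \<in> borel_measurable A" and V: "V \<in> borel_measurable B"
  shows "indep_var borel U borel V"
  unfolding indep_var_eq
proof (intro conjI)
  have AB: "sets A \<subseteq> events" "sets B \<subseteq> events"
    using indep_setD_ev1[OF ind] indep_setD_ev2[OF ind] by auto
  show "random_variable borel U" "random_variable borel V"
    using U V sp AB measurable_mono[of borel borel A M] measurable_mono[of borel borel B M] by auto
  have "indep_sets (case_bool (sets A) (sets B)) UNIV"
    using ind by (simp add: indep_set_def)
  then show "indep_set (sigma_sets (space M) {U -` A \<inter> space M |A. A \<in> sets borel})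
      (sigma_sets (space M) {V -` A \<inter> space M |A. A \<in> sets borel})"
    unfolding indep_set_def
  proof (rule indep_sets_mono_sets)
    have "sigma_sets (space M) {U -` A \<inter> space M |A. A \<in> sets borel} \<subseteq> sets A"
      using U by (intro sets.sigma_sets_subset[of _ A, unfolded sp]) (auto dest: measurable_sets simp: sp)
    moreover have "sigma_sets (space M) {V -` A \<inter> space M |A. A \<in> sets borel} \<subseteq> sets B"
      using V by (intro sets.sigma_sets_subset[of _ B, unfolded sp]) (auto dest: measurable_sets simp: sp)
    ultimately show "case_bool (sigma_sets (space M) {U -` A \<inter> space M |A. A \<in> sets borel})
      (sigma_sets (space M) {V -` A \<inter> space M |A. A \<in> sets borel}) i
      \<subseteq> case_bool (sets A) (sets B) i" for i
      by (cases i) auto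
  qed
qed

text \<open>An entry \<open>(c, \<tau>, h)\<close> stands for the term
  \<open>c * W \<tau> h\<close>. A list can be sorted by time and its head merged into the next
  entry.\<close>

type_synonym 'a comb = "(real \<times> real \<times> ('a \<Rightarrow> real)) list"

section \<open>Values of the cylindrical Wiener process and the law of its increments\<close>

locale cylindrical_wiener = prob_space P + mu: prob_space \<mu>
  for P :: "'w measure" and \<mu> :: "'a measure" +
  fixes Fil :: "real \<Rightarrow> 'w measure" and W :: "real \<Rightarrow> ('a \<Rightarrow> real) \<Rightarrow> 'w \<Rightarrow> real"
  assumes Fil: "filtration (space P) Fil" and subalg: "\<And>t. subalgebra P (Fil t)"
    and W: "cylindrical_wiener_process P Fil \<mu> W"
begin

lemma space_Fil [simp]: "space (Fil t) = space P"
  using subalg by (simp add: subalgebra_def)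

lemma Fil_mono: "s \<le> t \<Longrightarrow> sets (Fil s) \<subseteq> sets (Fil t)"
  using Fil by (rule filtration.sets_F_mono)

lemma Fil_measurable_mono: "s \<le> t \<Longrightarrow> f \<in> borel_measurable (Fil s) \<Longrightarrow> f \<in> borel_measurable (Fil t)"
  using measurable_mono[of borel borel "Fil s" "Fil t"] Fil_mono by auto

lemma Fil_measurable: "f \<in> borel_measurable (Fil s) \<Longrightarrow> f \<in> borel_measurable P"
  using measurable_from_subalg[OF subalg] by blast

lemma W_Fil: "0 \<le> t \<Longrightarrow> h \<in> L2 \<mu> \<Longrightarrow> W t h \<in> borel_measurable (Fil t)"
  using W by (simp add: cylindrical_wiener_process_def)

lemma W_meas: "0 \<le> t \<Longrightarrow> h \<in> L2 \<mu> \<Longrightarrow> W t h \<in> borel_measurable P"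
  using W_Fil Fil_measurable by blast

lemma W_linear: "0 \<le> t \<Longrightarrow> g \<in> L2 \<mu> \<Longrightarrow> h \<in> L2 \<mu> \<Longrightarrow>
    AE \<omega> in P. W t (\<lambda>x. a * g x + b * h x) \<omega> = a * W t g \<omega> + b * W t h \<omega>"
  using W by (simp add: cylindrical_wiener_process_def)

lemma W_scale: "0 \<le> t \<Longrightarrow> h \<in> L2 \<mu> \<Longrightarrow> AE \<omega> in P. W t (\<lambda>x. a * h x) \<omega> = a * W t h \<omega>"
  using W_linear[of t h h a 0] by simp

lemma W_unit: "h \<in> L2 \<mu> \<Longrightarrow> l2_norm \<mu> h = 1 \<Longrightarrow> wiener_process P Fil (\<lambda>t. W t h)"
  using W by (simp add: cylindrical_wiener_process_def)

text \<open>The law of \<open>W t h\<close> is given only for unit vectors, so null vectors need an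
  argument. The constant 1 is a unit vector because \<mu> is a probability measure, and as
  \<open>h\<close> is orthogonal to everything, 1 + h and 1 - h are unit vectors too. The
  parallelogram identity then computes the second moment of \<open>W t h\<close> as (t + t) / 2 - t
  = 0.\<close>

lemma W_null:
  assumes h: "h \<in> L2 \<mu>" and null: "l2_norm \<mu> h = 0" and t: "0 \<le> t"
  shows "AE \<omega> in P. W t h \<omega> = 0"
proof -
  let ?e = "\<lambda>_::'a. 1 :: real"
  have e: "?e \<in> L2 \<mu>" by (simp add: L2_def)
  have norm_e: "(l2_norm \<mu> ?e)\<^sup>2 = 1"
    by (simp add: l2_norm_square_integral mu.prob_space)
  have "l2_inner \<mu> ?e h = 0"
    using l2_cauchy_schwarz[OF e h] null by simp
  moreover from this have "l2_inner \<mu> ?e (\<lambda>x. (-1) * h x) = 0"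
    unfolding l2_inner_commute[of \<mu> ?e] l2_inner_scale_left by simp
  ultimately have "(l2_norm \<mu> (\<lambda>x. ?e x + h x))\<^sup>2 = 1" "(l2_norm \<mu> (\<lambda>x. ?e x + (-1) * h x))\<^sup>2 = 1"
    unfolding l2_norm_add_square[OF e h] l2_norm_add_square[OF e L2_scale[OF h]] l2_norm_scale
    by (simp_all only: norm_e null)
      simp_all
  then have unit: "l2_norm \<mu> (\<lambda>x. 1 * ?e x + 1 * h x) = 1" "l2_norm \<mu> (\<lambda>x. 1 * ?e x + (-1) * h x) = 1"
    using l2_norm_nonneg by (auto simp: power2_eq_1_iff) (smt (verit) l2_norm_nonneg)+
  define X where "X b = W t (\<lambda>x. 1 * ?e x + b * h x)" for b
  define X0 where "X0 b = W 0 (\<lambda>x. 1 * ?e x + b * h x)" for b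
  have mem: "(\<lambda>x. 1 * ?e x + b * h x) \<in> L2 \<mu>" for b
    by (intro L2_add L2_scale e h)
  have lin: "AE \<omega> in P. X b \<omega> = W t ?e \<omega> + b * W t h \<omega>" for b
    using W_linear[OF t e h, of 1 b] by (simp add: X_def)
  have zero: "AE \<omega> in P. X0 1 \<omega> = 0" "AE \<omega> in P. X0 (-1) \<omega> = 0"
    using W_unit[OF mem unit(1)] W_unit[OF mem unit(2)] by (simp_all add: wiener_process_def X0_def)
  have [measurable]: "X b \<in> borel_measurable P" "X0 b \<in> borel_measurable P" "W t ?e \<in> borel_measurable P"
      "W t h \<in> borel_measurable P" for b
    unfolding X_def X0_def by (auto intro!: W_meas mem t e h)
  show ?thesis
  proof (cases "t = 0")
    \<comment> \<open>Increments over an interval of length 0 have no density. Here the vanishing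
      initial values in the directions 1 + h and 1 - h together force the claim.\<close>
    case True
    have "AE \<omega> in P. X0 b \<omega> = W 0 ?e \<omega> + b * W 0 h \<omega>" for b
      using lin[of b] by (simp add: True X_def X0_def)
    from zero(1) zero(2) this[of 1] this[of "-1"] show ?thesis
      unfolding True by eventually_elim auto
  next
    case False
    then have t: "0 < t" using \<open>0 \<le> t\<close> by simp
    have *: "integrable P (\<lambda>\<omega>. (X b \<omega>)\<^sup>2) \<and> (\<integral>\<omega>. (X b \<omega>)\<^sup>2 \<partial>P) = t" if b: "b = 1 \<or> b = -1" for b
    proof -
      have u: "l2_norm \<mu> (\<lambda>x. 1 * ?e x + b * h x) = 1"
        using b unit by auto
      have z: "AE \<omega> in P. X0 b \<omega> = 0"
        using b zero by auto
      have D: "distributed P lborel (\<lambda>\<omega>. X b \<omega> - X0 b \<omega>) (normal_density 0 (sqrt (t - 0)))"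
        using W_unit[OF mem u] t unfolding wiener_process_def X_def X0_def by blast
      have ae: "AE \<omega> in P. (X b \<omega> - X0 b \<omega>)\<^sup>2 = (X b \<omega>)\<^sup>2"
        using z by eventually_elim simp
      have "integrable P (\<lambda>\<omega>. (X b \<omega> - X0 b \<omega>)\<^sup>2)" "(\<integral>\<omega>. (X b \<omega> - X0 b \<omega>)\<^sup>2 \<partial>P) = t"
        using normal_second_moment[OF _ D] t by auto
      moreover have "integrable P (\<lambda>\<omega>. (X b \<omega> - X0 b \<omega>)\<^sup>2) \<longleftrightarrow> integrable P (\<lambda>\<omega>. (X b \<omega>)\<^sup>2)"
        by (intro integrable_cong_AE ae) auto
      moreover have "(\<integral>\<omega>. (X b \<omega> - X0 b \<omega>)\<^sup>2 \<partial>P) = (\<integral>\<omega>. (X b \<omega>)\<^sup>2 \<partial>P)"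
        by (intro integral_cong_AE ae) auto
      ultimately show ?thesis by simp
    qed
    have int: "integrable P (\<lambda>\<omega>. (X 1 \<omega>)\<^sup>2)" "integrable P (\<lambda>\<omega>. (X (-1) \<omega>)\<^sup>2)"
      and val: "(\<integral>\<omega>. (X 1 \<omega>)\<^sup>2 \<partial>P) = t" "(\<integral>\<omega>. (X (-1) \<omega>)\<^sup>2 \<partial>P) = t"
      using *[of 1] *[of "-1"] by auto
    have D: "distributed P lborel (\<lambda>\<omega>. W t ?e \<omega> - W 0 ?e \<omega>) (normal_density 0 (sqrt (t - 0)))"
      and z: "AE \<omega> in P. W 0 ?e \<omega> = 0"
      using W_unit[OF e] norm_e t l2_norm_nonneg[of \<mu> ?e] unfolding wiener_process_def
      by (auto simp: power2_eq_1_iff)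
    have [measurable]: "W 0 ?e \<in> borel_measurable P"
      by (auto intro!: W_meas e)
    have ae: "AE \<omega> in P. (W t ?e \<omega> - W 0 ?e \<omega>)\<^sup>2 = (W t ?e \<omega>)\<^sup>2"
      using z by eventually_elim simp
    have "integrable P (\<lambda>\<omega>. (W t ?e \<omega> - W 0 ?e \<omega>)\<^sup>2)" "(\<integral>\<omega>. (W t ?e \<omega> - W 0 ?e \<omega>)\<^sup>2 \<partial>P) = t"
      using normal_second_moment[OF _ D] t by auto
    moreover have "integrable P (\<lambda>\<omega>. (W t ?e \<omega> - W 0 ?e \<omega>)\<^sup>2) \<longleftrightarrow> integrable P (\<lambda>\<omega>. (W t ?e \<omega>)\<^sup>2)"
      by (intro integrable_cong_AE ae) auto
    moreover have "(\<integral>\<omega>. (W t ?e \<omega> - W 0 ?e \<omega>)\<^sup>2 \<partial>P) = (\<integral>\<omega>. (W t ?e \<omega>)\<^sup>2 \<partial>P)"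
      by (intro integral_cong_AE ae) auto
    ultimately have intE: "integrable P (\<lambda>\<omega>. (W t ?e \<omega>)\<^sup>2)" and valE: "(\<integral>\<omega>. (W t ?e \<omega>)\<^sup>2 \<partial>P) = t"
      by auto
    have par: "AE \<omega> in P. (W t h \<omega>)\<^sup>2 = ((X 1 \<omega>)\<^sup>2 + (X (-1) \<omega>)\<^sup>2) / 2 - (W t ?e \<omega>)\<^sup>2"
      using lin[of 1] lin[of "-1"]
    proof eventually_elim
      case (elim \<omega>)
      show ?case
        unfolding elim by (simp add: power2_eq_square algebra_simps)
    qed
    have R: "integrable P (\<lambda>\<omega>. ((X 1 \<omega>)\<^sup>2 + (X (-1) \<omega>)\<^sup>2) / 2 - (W t ?e \<omega>)\<^sup>2)"
      using int intE by auto
    have "integrable P (\<lambda>\<omega>. (W t h \<omega>)\<^sup>2) \<longleftrightarrow> integrable P (\<lambda>\<omega>. ((X 1 \<omega>)\<^sup>2 + (X (-1) \<omega>)\<^sup>2) / 2 - (W t ?e \<omega>)\<^sup>2)"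
      by (intro integrable_cong_AE par) auto
    moreover have "(\<integral>\<omega>. (W t h \<omega>)\<^sup>2 \<partial>P) = (\<integral>\<omega>. ((X 1 \<omega>)\<^sup>2 + (X (-1) \<omega>)\<^sup>2) / 2 - (W t ?e \<omega>)\<^sup>2 \<partial>P)"
      by (intro integral_cong_AE par) auto
    moreover have "\<dots> = 0"
      using int intE val valE by simp
    ultimately have "integrable P (\<lambda>\<omega>. (W t h \<omega>)\<^sup>2)" "(\<integral>\<omega>. (W t h \<omega>)\<^sup>2 \<partial>P) = 0"
      using R by auto
    then show ?thesis
      by (simp add: integral_nonneg_eq_0_iff_AE)
  qed
qed

lemma W_0:
  assumes h: "h \<in> L2 \<mu>"
  shows "AE \<omega> in P. W 0 h \<omega> = 0"
proof (cases "l2_norm \<mu> h = 0")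
  case True
  then show ?thesis using W_null[OF h] by simp
next
  case False
  let ?n = "l2_norm \<mu> h"
  let ?e = "\<lambda>x. (1 / ?n) * h x"
  have e: "?e \<in> L2 \<mu>" "l2_norm \<mu> ?e = 1"
    using h False l2_norm_nonneg[of \<mu> h] by (auto simp only: l2_norm_scale) auto
  have "AE \<omega> in P. W 0 ?e \<omega> = 0"
    using W_unit[OF e] by (simp add: wiener_process_def)
  moreover have "AE \<omega> in P. W 0 ?e \<omega> = (1 / ?n) * W 0 h \<omega>"
    by (rule W_scale) (auto simp: h)
  ultimately show ?thesis
    by eventually_elim (use False in simp)
qed

text \<open>After scaling \<open>h\<close> to a unit vector the increment is normal and independent
  of \<open>Fil s\<close>, so the characteristic function of the sum factorises. For a null vector
  or s = t the increment vanishes almost surely and the exponential factor is 1.\<close>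

lemma increment_char:
  assumes st: "0 \<le> s" "s \<le> t" and h: "h \<in> L2 \<mu>" and V: "V \<in> borel_measurable (Fil s)"
  shows "(CLINT \<omega>|P. iexp (c * (W t h \<omega> - W s h \<omega>) + V \<omega>))
    = complex_of_real (exp (- (c\<^sup>2 * ((t - s) * (l2_norm \<mu> h)\<^sup>2)) / 2)) * (CLINT \<omega>|P. iexp (V \<omega>))"
proof -
  have t: "0 \<le> t" using st by simp
  have [measurable]: "V \<in> borel_measurable P" "W t h \<in> borel_measurable P" "W s h \<in> borel_measurable P"
    using Fil_measurable[OF V] W_meas h st by auto
  show ?thesis
  proof (cases "l2_norm \<mu> h = 0 \<or> s = t")
    case True
    then have "AE \<omega> in P. c * (W t h \<omega> - W s h \<omega>) = 0"
    proof
      assume n: "l2_norm \<mu> h = 0"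
      from W_null[OF h n t] W_null[OF h n st(1)] show ?thesis
        by eventually_elim simp
    qed simp
    then have "(CLINT \<omega>|P. iexp (c * (W t h \<omega> - W s h \<omega>) + V \<omega>)) = (CLINT \<omega>|P. iexp (V \<omega>))"
      by (intro integral_cong_AE) (auto elim!: eventually_mono simp del: of_real_mult of_real_diff of_real_add)
    then show ?thesis using True by auto
  next
    case False
    then have st': "s < t" and n: "l2_norm \<mu> h \<noteq> 0" using st by auto
    let ?n = "l2_norm \<mu> h"
    let ?e = "\<lambda>x. (1 / ?n) * h x"
    have e: "?e \<in> L2 \<mu>" "l2_norm \<mu> ?e = 1"
      using n by (simp_all only: l2_norm_scale L2_scale[OF h]) simp
    define D where "D \<omega> = W t ?e \<omega> - W s ?e \<omega>" for \<omega>
    have [measurable]: "D \<in> borel_measurable P"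
      unfolding D_def using W_meas[OF _ e(1)] st t by auto
    have dist: "distributed P lborel D (normal_density 0 (sqrt (t - s)))"
      and ind: "indep_set (sets (Fil s)) (sets (vimage_algebra (space P) D borel))"
      using W_unit[OF e] st st' unfolding wiener_process_def D_def by blast+
    have "AE \<omega> in P. W t h \<omega> - W s h \<omega> = ?n * D \<omega>"
      using W_scale[OF t h, of "1 / ?n"] W_scale[OF st(1) h, of "1 / ?n"]
      by eventually_elim (use n in \<open>simp add: D_def field_simps\<close>)
    then have "(CLINT \<omega>|P. iexp (c * (W t h \<omega> - W s h \<omega>) + V \<omega>))
        = (CLINT \<omega>|P. iexp ((c * ?n) * D \<omega> + V \<omega>))"
      by (intro integral_cong_AE) (auto elim!: eventually_mono simp: mult.assoc simp del: of_real_mult of_real_diff of_real_add)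
    also have "\<dots> = char (distr P borel (\<lambda>\<omega>. V \<omega> + (c * ?n) * D \<omega>)) 1"
      by (simp add: char_def integral_distr add.commute del: of_real_mult of_real_add)
    also have "\<dots> = char (distr P borel V) 1 * char (distr P borel (\<lambda>\<omega>. (c * ?n) * D \<omega>)) 1"
    proof (rule char_distr_add)
      have "(\<lambda>\<omega>. (c * ?n) * D \<omega>) \<in> borel_measurable (vimage_algebra (space P) D borel)"
        using measurable_vimage_algebra1[of D "space P" borel] by auto
      then show "indep_var borel V borel (\<lambda>\<omega>. (c * ?n) * D \<omega>)"
        using ind V by (intro indep_var_if_indep_set[OF ind]) auto
    qed
    also have "char (distr P borel (\<lambda>\<omega>. (c * ?n) * D \<omega>)) 1 = char (distr P borel D) (c * ?n)"
      by (simp add: char_def integral_distr)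
    also have "\<dots> = complex_of_real (exp (- ((c * ?n)\<^sup>2 * (sqrt (t - s))\<^sup>2) / 2))"
      using st' by (intro normal_char dist) auto
    also have "(c * ?n)\<^sup>2 * (sqrt (t - s))\<^sup>2 = c\<^sup>2 * ((t - s) * ?n\<^sup>2)"
      using st' by (simp add: power_mult_distrib mult_ac)
    finally show ?thesis
      by (simp add: char_def integral_distr)
  qed
qed

end

section \<open>Integrals of deterministic integrands\<close>

definition comb_on :: "'a measure \<Rightarrow> 'a comb \<Rightarrow> bool" where
  "comb_on \<mu> xs \<longleftrightarrow> (\<forall>(c, \<tau>, h)\<in>set xs. 0 \<le> \<tau> \<and> h \<in> L2 \<mu>)"

definition comb_sum :: "(real \<Rightarrow> ('a \<Rightarrow> real) \<Rightarrow> 'w \<Rightarrow> real) \<Rightarrow> 'a comb \<Rightarrow> 'w \<Rightarrow> real" where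
  "comb_sum W xs \<omega> = (\<Sum>(c, \<tau>, h)\<leftarrow>xs. c * W \<tau> h \<omega>)"

text \<open>The integrand of \<open>comb_sum\<close>, as an element of \<open>L\<^sup>2\<close> of the product of time and space.\<close>

definition comb_fun :: "'a comb \<Rightarrow> real \<times> 'a \<Rightarrow> real" where
  "comb_fun xs z = (\<Sum>(c, \<tau>, h)\<leftarrow>xs. c * (indicator {0<..\<tau>} (fst z) * h (snd z)))"

lemma comb_on_simps [simp]:
  "comb_on \<mu> []" "comb_on \<mu> ((c, \<tau>, h) # xs) \<longleftrightarrow> 0 \<le> \<tau> \<and> h \<in> L2 \<mu> \<and> comb_on \<mu> xs"
  "comb_on \<mu> (xs @ ys) \<longleftrightarrow> comb_on \<mu> xs \<and> comb_on \<mu> ys"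
  by (simp_all add: comb_on_def ball_Un)

lemma comb_sum_simps [simp]:
  "comb_sum W [] \<omega> = 0" "comb_sum W ((c, \<tau>, h) # xs) \<omega> = c * W \<tau> h \<omega> + comb_sum W xs \<omega>"
  "comb_sum W (xs @ ys) \<omega> = comb_sum W xs \<omega> + comb_sum W ys \<omega>"
  by (simp_all add: comb_sum_def)

lemma comb_fun_simps [simp]:
  "comb_fun [] z = 0"
  "comb_fun ((c, \<tau>, h) # xs) z = c * (indicator {0<..\<tau>} (fst z) * h (snd z)) + comb_fun xs z"
  "comb_fun (xs @ ys) z = comb_fun xs z + comb_fun ys z"
  by (simp_all add: comb_fun_def)

definition comb_scale :: "real \<Rightarrow> 'a comb \<Rightarrow> 'a comb" where
  "comb_scale a = map (\<lambda>(c, \<tau>, h). (a * c, \<tau>, h))"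

lemma comb_scale_simps [simp]:
  "comb_on \<mu> (comb_scale a xs) \<longleftrightarrow> comb_on \<mu> xs"
  "comb_sum W (comb_scale a xs) \<omega> = a * comb_sum W xs \<omega>"
  "comb_fun (comb_scale a xs) z = a * comb_fun xs z"
  by (induction xs) (auto simp: comb_scale_def comb_on_def distrib_left)

section \<open>Joint normality of finitely many values of \<open>W\<close>, and passage to
  limits\<close>

context cylindrical_wiener
begin

text \<open>Square integrable functions on \<open>K\<close> represent the square integrable
  functions of time with values in \<open>L2 \<mu>\<close>, so the scalar theory above serves for
  integrands as well.\<close>

abbreviation "K \<equiv> lborel \<Otimes>\<^sub>M \<mu> :: (real \<times> 'a) measure"

lemma tensor_in_L2K: "f \<in> L2 lborel \<Longrightarrow> h \<in> L2 \<mu> \<Longrightarrow> (\<lambda>z. f (fst z) * h (snd z)) \<in> L2 K"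
  using tensor_L2[of lborel \<mu> f h] by (simp add: sigma_finite_lborel mu.sigma_finite_measure_axioms case_prod_beta')

lemma norm_tensor:
  "f \<in> L2 lborel \<Longrightarrow> h \<in> L2 \<mu> \<Longrightarrow>
    (l2_norm K (\<lambda>z. f (fst z) * h (snd z)))\<^sup>2 = (l2_norm lborel f)\<^sup>2 * (l2_norm \<mu> h)\<^sup>2"
  using tensor_inner[of lborel \<mu> f h f h]
  by (simp add: sigma_finite_lborel mu.sigma_finite_measure_axioms case_prod_beta' l2_norm_square)

lemma inner_tensor:
  "f \<in> L2 lborel \<Longrightarrow> h \<in> L2 \<mu> \<Longrightarrow> f' \<in> L2 lborel \<Longrightarrow> h' \<in> L2 \<mu> \<Longrightarrow>
    l2_inner K (\<lambda>z. f (fst z) * h (snd z)) (\<lambda>z. f' (fst z) * h' (snd z)) = l2_inner lborel f f' * l2_inner \<mu> h h'"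
  using tensor_inner[of lborel \<mu> f h f' h']
  by (simp add: sigma_finite_lborel mu.sigma_finite_measure_axioms case_prod_beta')

lemma comb_fun_L2: "comb_on \<mu> xs \<Longrightarrow> comb_fun xs \<in> L2 K"
proof (induction xs)
  case Nil
  then show ?case by (simp add: comb_fun_simps(1)[abs_def])
next
  case (Cons a xs)
  then show ?case
    by (cases a) (auto simp: comb_fun_simps(2)[abs_def] intro!: L2_add L2_scale tensor_in_L2K)
qed

lemma comb_sum_Fil: "comb_on \<mu> xs \<Longrightarrow> (\<And>c \<tau> h. (c, \<tau>, h) \<in> set xs \<Longrightarrow> \<tau> \<le> t) \<Longrightarrow>
    comb_sum W xs \<in> borel_measurable (Fil t)"
proof (induction xs)
  case Nil
  then show ?case by (simp add: comb_sum_simps(1)[abs_def])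
next
  case (Cons a xs)
  obtain c \<tau> h where a: "a = (c, \<tau>, h)" by (cases a)
  have "W \<tau> h \<in> borel_measurable (Fil t)"
    using Cons.prems a by (intro Fil_measurable_mono[of \<tau> t] W_Fil) auto
  moreover have "comb_sum W xs \<in> borel_measurable (Fil t)"
    using Cons a by (intro Cons.IH) auto
  ultimately show ?case
    by (simp add: a comb_sum_simps(2)[abs_def])
qed

lemma comb_sum_meas: "comb_on \<mu> xs \<Longrightarrow> comb_sum W xs \<in> borel_measurable P"
proof (induction xs)
  case (Cons a xs)
  then show ?case
    by (cases a) (auto simp: comb_sum_simps(2)[abs_def] intro!: borel_measurable_add borel_measurable_times W_meas)
qed (simp add: comb_sum_simps(1)[abs_def])

lemma comb_sum_W_sigma: "comb_on \<mu> xs \<Longrightarrow> comb_sum W xs \<in> borel_measurable (W_sigma P \<mu> W {0..})"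
proof (induction xs)
  case (Cons a xs)
  obtain c \<tau> h where a: "a = (c, \<tau>, h)" by (cases a)
  have "W \<tau> h \<in> borel_measurable (W_sigma P \<mu> W {0..})"
    using measurable_process_sigma[of "(\<tau>, h)" "{0..} \<times> L2 \<mu>" P "\<lambda>(s, h). W s h" borel] Cons a
    by (simp add: W_sigma_def)
  then show ?case
    using Cons by (simp add: a comb_sum_simps(2)[abs_def])
qed (simp add: comb_sum_simps(1)[abs_def])

lemma comb_fun_zero_after:
  "(\<And>c \<tau> h. (c, \<tau>, h) \<in> set xs \<Longrightarrow> \<tau> \<le> t) \<Longrightarrow> t < fst z \<Longrightarrow> comb_fun xs z = 0"
proof (induction xs)
  case (Cons a xs)
  obtain c \<tau> h where a: "a = (c, \<tau>, h)" by (cases a)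
  have "\<tau> \<le> t" using Cons.prems(1)[of c \<tau> h] a by simp
  moreover have "comb_fun xs z = 0" using Cons by auto
  ultimately show ?case using Cons.prems a by simp
qed simp

text \<open>Pythagoras: \<open>G\<close> vanishes after \<open>t'\<close>, where alone the other
  term lives. This is the variance counterpart of \<open>increment_char\<close>.\<close>

lemma norm_comb_split:
  assumes t: "0 \<le> t'" "t' \<le> t" and h: "h \<in> L2 \<mu>" and G: "G \<in> L2 K" "\<And>z. t' < fst z \<Longrightarrow> G z = 0"
    and F: "\<And>z. F z = c * (indicator {t'<..t} (fst z) * h (snd z)) + G z"
  shows "(l2_norm K F)\<^sup>2 = c\<^sup>2 * ((t - t') * (l2_norm \<mu> h)\<^sup>2) + (l2_norm K G)\<^sup>2"
proof -
  let ?H = "\<lambda>z. indicator {t'<..t} (fst z) * h (snd z)"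
  have H: "?H \<in> L2 K" by (rule tensor_in_L2K) (auto simp: h)
  have "(\<lambda>z. ?H z * G z) = (\<lambda>z. 0)"
    using G(2) by (auto simp: indicator_def)
  then have 0: "l2_inner K (\<lambda>z. c * ?H z) G = 0"
    by (simp add: l2_inner_scale_left) (simp add: l2_inner_def)
  have "F = (\<lambda>z. c * ?H z + G z)"
    using F by auto
  then show ?thesis
    using l2_norm_add_square[OF L2_scale[OF H] G(1), of c] norm_tensor[of "indicator {t'<..t}" h]
      norm_indicator_Ioc[OF t(2)] h 0
    by (simp add: l2_norm_scale power_mult_distrib)
qed

text \<open>With the latest time \<tau> first and \<tau>' the next one, \<open>W \<tau> h\<close> is
  the increment from \<tau>' to \<tau> plus \<open>W \<tau>' h\<close>, and the latter is absorbed
  into the second entry by linearity. What remains is measurable at time \<tau>', so the increment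
  splits off. The merged list is not a tail of the original one, hence the induction on the
  length.\<close>

lemma comb_char_sorted:
  assumes "comb_on \<mu> xs" "sorted_wrt (\<lambda>x y. fst (snd y) \<le> fst (snd x)) xs"
  shows "(CLINT \<omega>|P. iexp (comb_sum W xs \<omega>)) = complex_of_real (exp (- (l2_norm K (comb_fun xs))\<^sup>2 / 2))"
  using assms
proof (induction "length xs" arbitrary: xs)
  case 0
  then show ?case
    by (simp add: comb_fun_simps(1)[abs_def] prob_space)
next
  case (Suc n)
  obtain c \<tau> h ys where xs: "xs = (c, \<tau>, h) # ys"
    using Suc.hyps(2) by (cases xs) auto
  have \<tau>: "0 \<le> \<tau>" and h: "h \<in> L2 \<mu>" and ys: "comb_on \<mu> ys"
    using Suc.prems by (auto simp: xs)
  show ?case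
  proof (cases ys)
    case Nil
    \<comment> \<open>With a single entry left, time 0 takes the place of the next time, because
      \<open>W 0 h\<close> vanishes almost surely.\<close>
    have eq: "AE \<omega> in P. comb_sum W xs \<omega> = c * (W \<tau> h \<omega> - W 0 h \<omega>) + 0"
      using W_0[OF h] by eventually_elim (simp add: xs Nil)
    have [measurable]: "W \<tau> h \<in> borel_measurable P" "W 0 h \<in> borel_measurable P" "comb_sum W xs \<in> borel_measurable P"
      using W_meas h \<tau> comb_sum_meas Suc.prems by auto
    have "(CLINT \<omega>|P. iexp (comb_sum W xs \<omega>)) = (CLINT \<omega>|P. iexp (c * (W \<tau> h \<omega> - W 0 h \<omega>) + 0))"
      using eq by (intro integral_cong_AE) (auto elim!: eventually_mono simp del: of_real_mult of_real_diff)
    also have "\<dots> = complex_of_real (exp (- (c\<^sup>2 * ((\<tau> - 0) * (l2_norm \<mu> h)\<^sup>2)) / 2)) * (CLINT \<omega>|P. iexp 0)"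
      using \<tau> h by (intro increment_char) auto
    also have "c\<^sup>2 * ((\<tau> - 0) * (l2_norm \<mu> h)\<^sup>2) = (l2_norm K (comb_fun xs))\<^sup>2"
      using norm_comb_split[of 0 \<tau> h "\<lambda>_. 0" "comb_fun xs" c] \<tau> h by (simp add: xs Nil)
    finally show ?thesis by (simp add: prob_space)
  next
    case (Cons y zs)
    obtain c' \<tau>' h' where y: "y = (c', \<tau>', h')" by (cases y)
    have \<tau>': "0 \<le> \<tau>'" "\<tau>' \<le> \<tau>" and h': "h' \<in> L2 \<mu>" and zs: "comb_on \<mu> zs"
      and zs': "\<And>c t k. (c, t, k) \<in> set zs \<Longrightarrow> t \<le> \<tau>'"
      using Suc.prems by (auto simp: xs Cons y)
    \<comment> \<open>The direction of the merged entry at time \<tau>'; both coefficients go into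
      it, so its own coefficient is 1.\<close>
    let ?g = "\<lambda>x. c * h x + c' * h' x"
    let ?ws = "(1, \<tau>', ?g) # zs"
    have g: "?g \<in> L2 \<mu>" using h h' by auto
    have ws: "comb_on \<mu> ?ws" using \<tau>' g zs by auto
    have IH: "(CLINT \<omega>|P. iexp (comb_sum W ?ws \<omega>)) = complex_of_real (exp (- (l2_norm K (comb_fun ?ws))\<^sup>2 / 2))"
      using Suc.hyps(2) Suc.prems ws by (intro Suc.hyps(1)) (auto simp: xs Cons y)
    have ws_Fil: "comb_sum W ?ws \<in> borel_measurable (Fil \<tau>')"
      using zs' by (intro comb_sum_Fil ws) auto
    have eq: "AE \<omega> in P. comb_sum W xs \<omega> = c * (W \<tau> h \<omega> - W \<tau>' h \<omega>) + comb_sum W ?ws \<omega>"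
      using W_linear[OF \<tau>'(1) h h', of c c'] by eventually_elim (simp add: xs Cons y algebra_simps)
    have [measurable]: "W \<tau> h \<in> borel_measurable P" "W \<tau>' h \<in> borel_measurable P"
        "comb_sum W xs \<in> borel_measurable P" "comb_sum W ?ws \<in> borel_measurable P"
      using W_meas h \<tau> \<tau>' comb_sum_meas Suc.prems ws by auto
    have "(CLINT \<omega>|P. iexp (comb_sum W xs \<omega>))
        = (CLINT \<omega>|P. iexp (c * (W \<tau> h \<omega> - W \<tau>' h \<omega>) + comb_sum W ?ws \<omega>))"
      using eq
      by (intro integral_cong_AE)
        (auto elim!: eventually_mono simp del: of_real_mult of_real_diff of_real_add comb_sum_simps)
    also have "\<dots> = complex_of_real (exp (- (c\<^sup>2 * ((\<tau> - \<tau>') * (l2_norm \<mu> h)\<^sup>2)) / 2)) * (CLINT \<omega>|P. iexp (comb_sum W ?ws \<omega>))"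
      by (rule increment_char[OF \<tau>' h ws_Fil])
    also have "\<dots> = complex_of_real (exp (- (c\<^sup>2 * ((\<tau> - \<tau>') * (l2_norm \<mu> h)\<^sup>2)) / 2)) * complex_of_real (exp (- (l2_norm K (comb_fun ?ws))\<^sup>2 / 2))"
      by (simp only: IH)
    also have "\<dots> = complex_of_real (exp (- (l2_norm K (comb_fun xs))\<^sup>2 / 2))"
    proof -
      have "(l2_norm K (comb_fun xs))\<^sup>2
          = c\<^sup>2 * ((\<tau> - \<tau>') * (l2_norm \<mu> h)\<^sup>2) + (l2_norm K (comb_fun ?ws))\<^sup>2"
      proof (rule norm_comb_split[OF \<tau>' h comb_fun_L2[OF ws]])
        fix z :: "real \<times> 'a"
        show "comb_fun ?ws z = 0" if "\<tau>' < fst z"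
          using that zs' by (intro comb_fun_zero_after) auto
        show "comb_fun xs z = c * (indicator {\<tau>'<..\<tau>} (fst z) * h (snd z)) + comb_fun ?ws z"
          using \<tau>' by (auto simp: xs Cons y indicator_def algebra_simps)
      qed
      then have "exp (- (c\<^sup>2 * ((\<tau> - \<tau>') * (l2_norm \<mu> h)\<^sup>2)) / 2) * exp (- (l2_norm K (comb_fun ?ws))\<^sup>2 / 2)
          = exp (- (l2_norm K (comb_fun xs))\<^sup>2 / 2)"
        unfolding exp_add[symmetric] by (intro arg_cong[of _ _ exp]) (simp add: field_simps)
      then show ?thesis
        by (simp only: of_real_mult[symmetric])
    qed
    finally show ?thesis .
  qed
qed

lemma comb_char:
  assumes "comb_on \<mu> xs"
  shows "(CLINT \<omega>|P. iexp (comb_sum W xs \<omega>)) = complex_of_real (exp (- (l2_norm K (comb_fun xs))\<^sup>2 / 2))"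
proof -
  \<comment> \<open>The negated key sorts by decreasing time; neither sum depends on the order of
    the entries.\<close>
  let ?ys = "sort_key (\<lambda>x. - fst (snd x)) xs"
  have sum: "(\<Sum>x\<leftarrow>?ys. f x) = (\<Sum>x\<leftarrow>xs. f x)" for f :: "_ \<Rightarrow> real"
    by (simp flip: sum_mset_sum_list)
  have "sorted (map (\<lambda>x. - fst (snd x)) ?ys)"
    by (rule sorted_sort_key)
  then have "sorted_wrt (\<lambda>x y. fst (snd y) \<le> fst (snd x)) ?ys"
    by (simp add: sorted_wrt_map)
  moreover have "comb_on \<mu> ?ys"
    using assms by (simp add: comb_on_def)
  ultimately have "(CLINT \<omega>|P. iexp (comb_sum W ?ys \<omega>)) = complex_of_real (exp (- (l2_norm K (comb_fun ?ys))\<^sup>2 / 2))"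
    by (intro comb_char_sorted)
  moreover have "comb_sum W ?ys = comb_sum W xs" "comb_fun ?ys = comb_fun xs"
    by (auto simp: comb_sum_def comb_fun_def sum)
  ultimately show ?thesis by simp
qed

text \<open>\<open>wiener_integral V F\<close>: the random variable \<open>V\<close> is a version of the integral against \<open>W\<close> of
  the deterministic \<open>L\<^sup>2(\<mu>)\<close>-valued integrand \<open>F\<close> (identified with its Riesz dual).\<close>

definition wiener_integral :: "('w \<Rightarrow> real) \<Rightarrow> (real \<times> 'a \<Rightarrow> real) \<Rightarrow> bool" where
  "wiener_integral V F \<longleftrightarrow> V \<in> borel_measurable P \<and> F \<in> L2 K \<and>
    (\<exists>xs. (\<forall>n. comb_on \<mu> (xs n)) \<and>
      (\<lambda>n. l2_norm K (\<lambda>z. comb_fun (xs n) z - F z)) \<longlonglongrightarrow> 0 \<and>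
      (\<lambda>n. \<integral>\<^sup>+\<omega>. ennreal ((comb_sum W (xs n) \<omega> - V \<omega>)\<^sup>2) \<partial>P) \<longlonglongrightarrow> 0)"

lemma wiener_integral_comb: "comb_on \<mu> xs \<Longrightarrow> wiener_integral (comb_sum W xs) (comb_fun xs)"
  unfolding wiener_integral_def using comb_fun_L2 comb_sum_meas by (auto intro!: exI[of _ "\<lambda>_. xs"])

lemma wiener_integral_meas: "wiener_integral V F \<Longrightarrow> V \<in> borel_measurable P"
  by (simp add: wiener_integral_def)

lemma wiener_integral_zero: "wiener_integral (\<lambda>_. 0) (\<lambda>_. 0)"
  using wiener_integral_comb[of "[]"] by (simp add: comb_sum_simps(1)[abs_def] comb_fun_simps(1)[abs_def])

lemma wiener_integral_lin:
  assumes "wiener_integral V F" "wiener_integral V' F'"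
  shows "wiener_integral (\<lambda>\<omega>. a * V \<omega> + b * V' \<omega>) (\<lambda>z. a * F z + b * F' z)"
proof -
  have [measurable]: "V \<in> borel_measurable P" "V' \<in> borel_measurable P" and F: "F \<in> L2 K" "F' \<in> L2 K"
    using assms by (auto simp: wiener_integral_def)
  obtain xs where xs: "\<And>n. comb_on \<mu> (xs n)" "(\<lambda>n. l2_norm K (\<lambda>z. comb_fun (xs n) z - F z)) \<longlonglongrightarrow> 0"
      "(\<lambda>n. \<integral>\<^sup>+\<omega>. ennreal ((comb_sum W (xs n) \<omega> - V \<omega>)\<^sup>2) \<partial>P) \<longlonglongrightarrow> 0"
    using assms(1) by (auto simp: wiener_integral_def)
  obtain ys where ys: "\<And>n. comb_on \<mu> (ys n)" "(\<lambda>n. l2_norm K (\<lambda>z. comb_fun (ys n) z - F' z)) \<longlonglongrightarrow> 0"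
      "(\<lambda>n. \<integral>\<^sup>+\<omega>. ennreal ((comb_sum W (ys n) \<omega> - V' \<omega>)\<^sup>2) \<partial>P) \<longlonglongrightarrow> 0"
    using assms(2) by (auto simp: wiener_integral_def)
  have [measurable]: "comb_sum W (xs n) \<in> borel_measurable P" "comb_sum W (ys n) \<in> borel_measurable P" for n
    using comb_sum_meas xs(1) ys(1) by auto
  let ?zs = "\<lambda>n. comb_scale a (xs n) @ comb_scale b (ys n)"
  show ?thesis
    unfolding wiener_integral_def
  proof (intro conjI exI[of _ ?zs] allI)
    show "(\<lambda>z. a * F z + b * F' z) \<in> L2 K" using F by auto
    show "comb_on \<mu> (?zs n)" for n using xs ys by simp
    show "(\<lambda>n. l2_norm K (\<lambda>z. comb_fun (?zs n) z - (a * F z + b * F' z))) \<longlonglongrightarrow> 0"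
    proof (rule tendsto_sandwich[OF _ _ tendsto_const])
      show "(\<lambda>n. \<bar>a\<bar> * l2_norm K (\<lambda>z. comb_fun (xs n) z - F z) + \<bar>b\<bar> * l2_norm K (\<lambda>z. comb_fun (ys n) z - F' z)) \<longlonglongrightarrow> 0"
        using tendsto_add[OF tendsto_mult_left[OF xs(2), of "\<bar>a\<bar>"] tendsto_mult_left[OF ys(2), of "\<bar>b\<bar>"]] by simp
      have "l2_norm K (\<lambda>z. comb_fun (?zs n) z - (a * F z + b * F' z))
          \<le> \<bar>a\<bar> * l2_norm K (\<lambda>z. comb_fun (xs n) z - F z) + \<bar>b\<bar> * l2_norm K (\<lambda>z. comb_fun (ys n) z - F' z)" for n
        using l2_norm_triangle[OF L2_scale[OF L2_diff[OF comb_fun_L2[OF xs(1)] F(1)]]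
            L2_scale[OF L2_diff[OF comb_fun_L2[OF ys(1)] F(2)]], of a n b n]
        unfolding l2_norm_scale by (simp add: algebra_simps)
      then show "\<forall>\<^sub>F n in sequentially. l2_norm K (\<lambda>z. comb_fun (?zs n) z - (a * F z + b * F' z))
          \<le> \<bar>a\<bar> * l2_norm K (\<lambda>z. comb_fun (xs n) z - F z) + \<bar>b\<bar> * l2_norm K (\<lambda>z. comb_fun (ys n) z - F' z)"
        by simp
    qed auto
    let ?X = "\<lambda>n \<omega>. ennreal ((comb_sum W (xs n) \<omega> - V \<omega>)\<^sup>2)"
    let ?Y = "\<lambda>n \<omega>. ennreal ((comb_sum W (ys n) \<omega> - V' \<omega>)\<^sup>2)"
    show "(\<lambda>n. \<integral>\<^sup>+\<omega>. ennreal ((comb_sum W (?zs n) \<omega> - (a * V \<omega> + b * V' \<omega>))\<^sup>2) \<partial>P) \<longlonglongrightarrow> 0"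
    proof (rule tendsto_sandwich[OF _ _ tendsto_const])
      show "(\<lambda>n. ennreal (2 * a\<^sup>2) * (\<integral>\<^sup>+\<omega>. ?X n \<omega> \<partial>P) + ennreal (2 * b\<^sup>2) * (\<integral>\<^sup>+\<omega>. ?Y n \<omega> \<partial>P)) \<longlonglongrightarrow> 0"
        using tendsto_add[OF ennreal_tendsto_cmult[OF _ xs(3), of "ennreal (2 * a\<^sup>2)"]
            ennreal_tendsto_cmult[OF _ ys(3), of "ennreal (2 * b\<^sup>2)"]] by simp
      have "(\<integral>\<^sup>+\<omega>. ennreal ((comb_sum W (?zs n) \<omega> - (a * V \<omega> + b * V' \<omega>))\<^sup>2) \<partial>P)
          \<le> (\<integral>\<^sup>+\<omega>. ennreal (2 * a\<^sup>2) * ?X n \<omega> + ennreal (2 * b\<^sup>2) * ?Y n \<omega> \<partial>P)" for n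
      proof (intro nn_integral_mono)
        fix \<omega>
        have sq: "(x + y)\<^sup>2 \<le> 2 * x\<^sup>2 + 2 * y\<^sup>2" for x y :: real
          using zero_le_power2[of "x - y"] by (simp add: power2_sum power2_diff)
        have "(comb_sum W (?zs n) \<omega> - (a * V \<omega> + b * V' \<omega>))\<^sup>2
            = (a * (comb_sum W (xs n) \<omega> - V \<omega>) + b * (comb_sum W (ys n) \<omega> - V' \<omega>))\<^sup>2"
          by (simp add: algebra_simps)
        also have "\<dots> \<le> 2 * a\<^sup>2 * (comb_sum W (xs n) \<omega> - V \<omega>)\<^sup>2 + 2 * b\<^sup>2 * (comb_sum W (ys n) \<omega> - V' \<omega>)\<^sup>2"
          using sq[of "a * (comb_sum W (xs n) \<omega> - V \<omega>)" "b * (comb_sum W (ys n) \<omega> - V' \<omega>)"]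
          by (simp add: power_mult_distrib mult.assoc)
        finally show "ennreal ((comb_sum W (?zs n) \<omega> - (a * V \<omega> + b * V' \<omega>))\<^sup>2)
            \<le> ennreal (2 * a\<^sup>2) * ?X n \<omega> + ennreal (2 * b\<^sup>2) * ?Y n \<omega>"
          by (simp add: ennreal_mult[symmetric] ennreal_plus[symmetric] ennreal_leI del: ennreal_plus)
      qed
      then show "\<forall>\<^sub>F n in sequentially. (\<integral>\<^sup>+\<omega>. ennreal ((comb_sum W (?zs n) \<omega> - (a * V \<omega> + b * V' \<omega>))\<^sup>2) \<partial>P)
          \<le> ennreal (2 * a\<^sup>2) * (\<integral>\<^sup>+\<omega>. ?X n \<omega> \<partial>P) + ennreal (2 * b\<^sup>2) * (\<integral>\<^sup>+\<omega>. ?Y n \<omega> \<partial>P)"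
        by (simp add: nn_integral_add nn_integral_cmult)
    qed auto
  qed measurable
qed

lemma wiener_integral_sum:
  "(\<And>i. i \<in> I \<Longrightarrow> wiener_integral (V i) (F i)) \<Longrightarrow>
    wiener_integral (\<lambda>\<omega>. \<Sum>i\<in>I. a i * V i \<omega>) (\<lambda>z. \<Sum>i\<in>I. a i * F i z)"
proof (induction I rule: infinite_finite_induct)
  case (insert i I)
  then show ?case
    using wiener_integral_lin[of "V i" "F i" "\<lambda>\<omega>. \<Sum>i\<in>I. a i * V i \<omega>" "\<lambda>z. \<Sum>i\<in>I. a i * F i z" "a i" 1]
    by simp
qed (simp_all add: wiener_integral_zero)

text \<open>Characteristic functions converge because exp(i x) is 1-Lipschitz, and variances
  converge because norms do. \<open>U\<close> is meant for the contribution of the initial value.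
  Its independence is required only against finite combinations, since \<open>V\<close> is a version
  that need not be measurable for the sigma-algebra of \<open>W\<close>.\<close>

lemma wiener_integral_char:
  assumes V: "wiener_integral V F" and [measurable]: "U \<in> borel_measurable P"
    and U: "\<And>xs. comb_on \<mu> xs \<Longrightarrow> (CLINT \<omega>|P. iexp (U \<omega> + comb_sum W xs \<omega>))
      = (CLINT \<omega>|P. iexp (U \<omega>)) * (CLINT \<omega>|P. iexp (comb_sum W xs \<omega>))"
  shows "(CLINT \<omega>|P. iexp (U \<omega> + V \<omega>)) = (CLINT \<omega>|P. iexp (U \<omega>)) * complex_of_real (exp (- (l2_norm K F)\<^sup>2 / 2))"
proof -
  have [measurable]: "V \<in> borel_measurable P" and F: "F \<in> L2 K"
    using V by (auto simp: wiener_integral_def)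
  obtain xs where xs: "\<And>n. comb_on \<mu> (xs n)" "(\<lambda>n. l2_norm K (\<lambda>z. comb_fun (xs n) z - F z)) \<longlonglongrightarrow> 0"
      "(\<lambda>n. \<integral>\<^sup>+\<omega>. ennreal ((comb_sum W (xs n) \<omega> - V \<omega>)\<^sup>2) \<partial>P) \<longlonglongrightarrow> 0"
    using V by (auto simp: wiener_integral_def)
  have [measurable]: "comb_sum W (xs n) \<in> borel_measurable P" for n
    using comb_sum_meas xs(1) by auto
  \<comment> \<open>\<open>g\<close> is bounded by 2, hence square integrable with no information on
    \<open>V\<close>, and it is dominated by the error of the approximation, so its norm tends to
    0.\<close>
  define g where "g n \<omega> = norm (iexp (U \<omega> + comb_sum W (xs n) \<omega>) - iexp (U \<omega> + V \<omega>))" for n \<omega>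
  have g_meas [measurable]: "g n \<in> borel_measurable P" for n
    unfolding g_def by measurable
  have g_le: "g n \<omega> \<le> \<bar>comb_sum W (xs n) \<omega> - V \<omega>\<bar>" for n \<omega>
  proof -
    have "iexp (U \<omega> + comb_sum W (xs n) \<omega>) - iexp (U \<omega> + V \<omega>)
        = iexp (U \<omega> + V \<omega>) * (iexp (comb_sum W (xs n) \<omega> - V \<omega>) - 1)"
      by (simp add: right_diff_distrib flip: exp_add) (simp add: algebra_simps)
    moreover have "norm (iexp (comb_sum W (xs n) \<omega> - V \<omega>) - 1) \<le> \<bar>comb_sum W (xs n) \<omega> - V \<omega>\<bar>"
      using iexp_approx1[of "comb_sum W (xs n) \<omega> - V \<omega>" 0] by simp
    ultimately show ?thesis
      by (simp add: g_def norm_mult del: of_real_add of_real_diff)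
  qed
  have g_nonneg: "0 \<le> g n \<omega>" for n \<omega> by (simp add: g_def)
  have g_le2: "g n \<omega> \<le> 2" for n \<omega>
    unfolding g_def using norm_triangle_ineq4[of "iexp (U \<omega> + comb_sum W (xs n) \<omega>)" "iexp (U \<omega> + V \<omega>)"]
    by (simp del: of_real_add)
  have g_L2: "g n \<in> L2 P" for n
    unfolding L2_def using power_mono[OF g_le2 g_nonneg, of n _ 2]
    by (auto intro!: integrable_const_bound[where B = 4])
  have "ennreal ((l2_norm P (g n))\<^sup>2) \<le> (\<integral>\<^sup>+\<omega>. ennreal ((comb_sum W (xs n) \<omega> - V \<omega>)\<^sup>2) \<partial>P)" for n
    unfolding nn_integral_square[OF g_L2, symmetric]
    using power_mono[OF g_le g_nonneg, of n _ 2] by (intro nn_integral_mono ennreal_leI) simp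
  then have "(\<lambda>n. ennreal ((l2_norm P (g n))\<^sup>2)) \<longlonglongrightarrow> 0"
    by (intro tendsto_sandwich[OF _ _ tendsto_const xs(3)]) auto
  then have "(\<lambda>n. ennreal ((l2_norm P (g n))\<^sup>2)) \<longlonglongrightarrow> ennreal 0"
    by simp
  then have "(\<lambda>n. (l2_norm P (g n))\<^sup>2) \<longlonglongrightarrow> 0"
    by (subst (asm) tendsto_ennreal_iff) auto
  from tendsto_real_sqrt[OF this] have norm0: "(\<lambda>n. l2_norm P (g n)) \<longlonglongrightarrow> 0"
    by simp
  have one: "(\<lambda>_. 1) \<in> L2 P" "l2_norm P (\<lambda>_. 1) = 1"
    by (auto simp: L2_def l2_norm_def l2_inner_def prob_space)
  have int: "integrable P (\<lambda>\<omega>. iexp (f \<omega>))" if "f \<in> borel_measurable P" for f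
    using that by (intro integrable_iexp) auto
  have "(\<lambda>n. (CLINT \<omega>|P. iexp (U \<omega> + comb_sum W (xs n) \<omega>)) - (CLINT \<omega>|P. iexp (U \<omega> + V \<omega>))) \<longlonglongrightarrow> 0"
  proof (rule Lim_null_comparison[OF _ norm0], intro always_eventually allI)
    fix n
    have "norm ((CLINT \<omega>|P. iexp (U \<omega> + comb_sum W (xs n) \<omega>)) - (CLINT \<omega>|P. iexp (U \<omega> + V \<omega>)))
        = norm (CLINT \<omega>|P. iexp (U \<omega> + comb_sum W (xs n) \<omega>) - iexp (U \<omega> + V \<omega>))"
      by (subst Bochner_Integration.integral_diff) (auto intro!: int simp del: of_real_add)
    also have "\<dots> \<le> (\<integral>\<omega>. g n \<omega> \<partial>P)"
      unfolding g_def by (rule integral_norm_bound)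
    also have "\<dots> \<le> l2_norm P (g n)"
      using l2_cauchy_schwarz[OF g_L2 one(1), of n] one(2) by (simp add: l2_inner_def)
    finally show "norm ((CLINT \<omega>|P. iexp (U \<omega> + comb_sum W (xs n) \<omega>)) - (CLINT \<omega>|P. iexp (U \<omega> + V \<omega>)))
        \<le> l2_norm P (g n)" .
  qed
  then have "(\<lambda>n. (CLINT \<omega>|P. iexp (U \<omega> + comb_sum W (xs n) \<omega>))) \<longlonglongrightarrow> (CLINT \<omega>|P. iexp (U \<omega> + V \<omega>))"
    by (rule LIM_zero_cancel)
  moreover have "(\<lambda>n. (CLINT \<omega>|P. iexp (U \<omega> + comb_sum W (xs n) \<omega>)))
      \<longlonglongrightarrow> (CLINT \<omega>|P. iexp (U \<omega>)) * complex_of_real (exp (- (l2_norm K F)\<^sup>2 / 2))"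
  proof -
    have "has_l2_limit K (\<lambda>n. comb_fun (xs n)) F"
      using F xs(2) by (simp add: has_l2_limit_def)
    then have "(\<lambda>n. l2_norm K (comb_fun (xs n))) \<longlonglongrightarrow> l2_norm K F"
      by (rule tendsto_l2_norm) (intro comb_fun_L2 xs)
    then have "(\<lambda>n. exp (- (l2_norm K (comb_fun (xs n)))\<^sup>2 / 2)) \<longlonglongrightarrow> exp (- (l2_norm K F)\<^sup>2 / 2)"
      by (intro tendsto_intros) auto
    then show ?thesis
      unfolding U[OF xs(1)] comb_char[OF xs(1)] by (intro tendsto_mult_left tendsto_of_real)
  qed
  ultimately show ?thesis
    by (rule LIMSEQ_unique)
qed

end

section \<open>The stochastic convolution\<close>

lemma l2_norm_sum_orthogonal:
  assumes "finite I" "\<And>i. i \<in> I \<Longrightarrow> f i \<in> L2 M"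
    and "\<And>i j. i \<in> I \<Longrightarrow> j \<in> I \<Longrightarrow> i \<noteq> j \<Longrightarrow> l2_inner M (f i) (f j) = 0"
  shows "(l2_norm M (\<lambda>x. \<Sum>i\<in>I. f i x))\<^sup>2 = (\<Sum>i\<in>I. (l2_norm M (f i))\<^sup>2)"
  using assms
proof (induction I rule: finite_induct)
  case (insert i I)
  have "l2_inner M (\<lambda>x. \<Sum>j\<in>I. f j x) (f i) = (\<Sum>j\<in>I. l2_inner M (f j) (f i))"
    using insert by (intro l2_inner_sum_left) auto
  also have "\<dots> = 0"
    using insert by (intro sum.neutral) auto
  finally have "l2_inner M (f i) (\<lambda>x. \<Sum>j\<in>I. f j x) = 0"
    by (simp add: l2_inner_commute)
  moreover have "(l2_norm M (\<lambda>x. \<Sum>i\<in>I. f i x))\<^sup>2 = (\<Sum>i\<in>I. (l2_norm M (f i))\<^sup>2)"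
    using insert by auto
  ultimately show ?case
    using insert l2_norm_add_square[of "f i" M "\<lambda>x. \<Sum>j\<in>I. f j x"] by (simp add: L2_sum)
qed simp

lemma l2_norm_add_square_le:
  assumes "f \<in> L2 M" "g \<in> L2 M"
  shows "(l2_norm M (\<lambda>x. f x + g x))\<^sup>2 \<le> 2 * (l2_norm M f)\<^sup>2 + 2 * (l2_norm M g)\<^sup>2"
proof -
  have "(l2_norm M (\<lambda>x. f x + g x))\<^sup>2 \<le> (l2_norm M f + l2_norm M g)\<^sup>2"
    using l2_norm_triangle[OF assms] by (intro power_mono) auto
  also have "\<dots> \<le> 2 * (l2_norm M f)\<^sup>2 + 2 * (l2_norm M g)\<^sup>2"
    using zero_le_power2[of "l2_norm M f - l2_norm M g"] by (simp add: power2_sum power2_diff)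
  finally show ?thesis .
qed

section \<open>Components of elementary integrals\<close>

lemma elementary_on_simps [simp]:
  "elementary_on \<mu> t []"
  "elementary_on \<mu> t ((a, b, g, h) # xs) \<longleftrightarrow>
    0 \<le> a \<and> a \<le> b \<and> b \<le> t \<and> g \<in> L2 \<mu> \<and> h \<in> L2 \<mu> \<and> elementary_on \<mu> t xs"
  by (simp_all add: elementary_on_def)

lemma elementary_op_simps [simp]:
  "elementary_op \<mu> [] s f = (\<lambda>x. 0)"
  "elementary_op \<mu> ((a, b, g, h) # xs) s f =
    (\<lambda>x. (indicator {a<..b} s * l2_inner \<mu> f g) * h x + elementary_op \<mu> xs s f x)"
  by (simp_all add: elementary_op_def)

lemma elementary_integral_simps [simp]:
  "elementary_integral W [] \<omega> = (\<lambda>x. 0)"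
  "elementary_integral W ((a, b, g, h) # xs) \<omega> =
    (\<lambda>x. (W b g \<omega> - W a g \<omega>) * h x + elementary_integral W xs \<omega> x)"
  by (simp_all add: elementary_integral_def)

lemma elementary_op_L2: "elementary_on \<mu> t xs \<Longrightarrow> elementary_op \<mu> xs s f \<in> L2 \<mu>"
proof (induction xs)
  case (Cons a xs)
  then show ?case by (cases a) (auto intro!: L2_add L2_scale)
qed simp

lemma elementary_integral_L2: "elementary_on \<mu> t xs \<Longrightarrow> elementary_integral W xs \<omega> \<in> L2 \<mu>"
proof (induction xs)
  case (Cons a xs)
  then show ?case by (cases a) (auto intro!: L2_add L2_scale)
qed simp

text \<open>Pairing the term \<open>(W b g - W a g) h\<close> with \<open>e\<close> leaves two
  values of \<open>W\<close> in the direction \<open>g\<close>, with weights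
  \<open>l2_inner \<mu> h e\<close> and its negative.\<close>

fun comb_component :: "'a measure \<Rightarrow> ('a \<Rightarrow> real) \<Rightarrow> 'a elementary \<Rightarrow> 'a comb" where
  "comb_component \<mu> e [] = []"
| "comb_component \<mu> e ((a, b, g, h) # xs) =
    (l2_inner \<mu> h e, b, g) # (- l2_inner \<mu> h e, a, g) # comb_component \<mu> e xs"

lemma comb_on_component: "elementary_on \<mu> t xs \<Longrightarrow> comb_on \<mu> (comb_component \<mu> e xs)"
  by (induction \<mu> e xs rule: comb_component.induct) auto

lemma comb_sum_component:
  assumes "elementary_on \<mu> t xs" "e \<in> L2 \<mu>"
  shows "comb_sum W (comb_component \<mu> e xs) \<omega> = l2_inner \<mu> (elementary_integral W xs \<omega>) e"
  using assms
proof (induction \<mu> e xs rule: comb_component.induct)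
  case (2 \<mu> e a b g h xs)
  then show ?case
    using elementary_integral_L2[of \<mu> t xs W \<omega>]
    by (simp add: l2_inner_add_left L2_scale l2_inner_scale_left) (simp add: algebra_simps)
qed simp

lemma comb_fun_component_L2:
  "elementary_on \<mu> t xs \<Longrightarrow> (\<lambda>x. comb_fun (comb_component \<mu> e xs) (s, x)) \<in> L2 \<mu>"
proof (induction \<mu> e xs rule: comb_component.induct)
  case (2 \<mu> e a b g h xs)
  then have "(\<lambda>x. (l2_inner \<mu> h e * indicator {0<..b} s) * g x + ((- l2_inner \<mu> h e * indicator {0<..a} s) * g x
      + comb_fun (comb_component \<mu> e xs) (s, x))) \<in> L2 \<mu>"
    by (intro L2_add L2_scale) auto
  then show ?case by (simp add: mult_ac)
qed simp

text \<open>In other words, the integrand of the \<open>e\<close>-component at time \<open>s\<close>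
  is the adjoint of \<open>elementary_op \<mu> xs s\<close> applied to \<open>e\<close>. This turns
  convergence of operators into convergence of scalar-type integrands.\<close>

lemma inner_comb_fun_component:
  assumes "elementary_on \<mu> t xs" "e \<in> L2 \<mu>" "f \<in> L2 \<mu>"
  shows "l2_inner \<mu> (\<lambda>x. comb_fun (comb_component \<mu> e xs) (s, x)) f = l2_inner \<mu> (elementary_op \<mu> xs s f) e"
  using assms
proof (induction \<mu> e xs rule: comb_component.induct)
  case (2 \<mu> e a b g h xs)
  have i: "indicator {0<..b} s - indicator {0<..a} s = (indicator {a<..b} s :: real)"
    using 2 by (auto simp: indicator_def)
  have eq: "(\<lambda>x. comb_fun (comb_component \<mu> e ((a, b, g, h) # xs)) (s, x))
      = (\<lambda>x. (l2_inner \<mu> h e * (indicator {0<..b} s - indicator {0<..a} s)) * g x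
          + comb_fun (comb_component \<mu> e xs) (s, x))"
    by (auto simp: algebra_simps)
  have "l2_inner \<mu> (\<lambda>x. comb_fun (comb_component \<mu> e ((a, b, g, h) # xs)) (s, x)) f = (l2_inner \<mu> h e * indicator {a<..b} s) * l2_inner \<mu> g f
      + l2_inner \<mu> (\<lambda>x. comb_fun (comb_component \<mu> e xs) (s, x)) f"
    unfolding eq i using 2 comb_fun_component_L2[of \<mu> t xs e s]
    by (subst l2_inner_add_left) (auto simp: l2_inner_scale_left)
  also have "\<dots> = l2_inner \<mu> (elementary_op \<mu> ((a, b, g, h) # xs) s f) e"
    using 2 elementary_op_L2[of \<mu> t xs s f]
    by (simp add: l2_inner_add_left L2_scale l2_inner_scale_left l2_inner_commute[of \<mu> g f]; simp add: mult_ac)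
  finally show ?case .
qed simp

lemma comb_fun_component_zero:
  "elementary_on \<mu> t xs \<Longrightarrow> \<not> (0 < fst z \<and> fst z \<le> t) \<Longrightarrow> comb_fun (comb_component \<mu> e xs) z = 0"
  by (induction \<mu> e xs rule: comb_component.induct) (auto simp: indicator_def)

section \<open>Functional calculus in coordinates and Hilbert-Schmidt bounds\<close>

context l2_basis
begin

lemma norm_phi: "1 \<le> k \<Longrightarrow> l2_norm \<mu> (\<phi> k) = 1"
  by (simp add: l2_norm_def phi_inner)

lemma spectral_op_eq_synth: "spectral_op \<mu> \<phi> lam p f = synth (\<lambda>k. p (lam k) * l2_inner \<mu> f (\<phi> k))"
  by (simp add: spectral_op_def synth_def psum_def[abs_def])

text \<open>The bound on \<open>p\<close> keeps the coefficients square summable, so that the series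
  converges and \<open>l2_lim\<close> does not fall back to its default value.\<close>

lemma inner_spectral_op:
  assumes f: "f \<in> L2 \<mu>" and p: "\<And>k. 1 \<le> k \<Longrightarrow> \<bar>p (lam k)\<bar> \<le> 1" and k: "1 \<le> k"
  shows "l2_inner \<mu> (spectral_op \<mu> \<phi> lam p f) (\<phi> k) = p (lam k) * l2_inner \<mu> f (\<phi> k)"
  unfolding spectral_op_eq_synth
proof (rule inner_synth[OF _ k])
  have *: "norm ((p (lam (Suc k)) * l2_inner \<mu> f (\<phi> (Suc k)))\<^sup>2) \<le> (l2_inner \<mu> f (\<phi> (Suc k)))\<^sup>2" for k
  proof -
    have "(p (lam (Suc k)))\<^sup>2 \<le> 1\<^sup>2"
      using p[of "Suc k"] by (intro abs_le_square_iff[THEN iffD1]) auto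
    then have "(p (lam (Suc k)))\<^sup>2 * (l2_inner \<mu> f (\<phi> (Suc k)))\<^sup>2 \<le> 1 * (l2_inner \<mu> f (\<phi> (Suc k)))\<^sup>2"
      by (intro mult_right_mono) auto
    then show ?thesis by (simp add: power_mult_distrib)
  qed
  show "summable (\<lambda>k. (p (lam (Suc k)) * l2_inner \<mu> f (\<phi> (Suc k)))\<^sup>2)"
    by (rule summable_comparison_test'[OF summable_coords[OF f], of 0]) (rule *)
qed

lemma spectral_op_L2: "spectral_op \<mu> \<phi> lam p f \<in> L2 \<mu>"
  unfolding spectral_op_eq_synth by (rule synth_L2)

text \<open>Elementary operators have finite rank: each entry contributes at most the squared
  Hilbert-Schmidt norm of a rank one operator, at any time. The factors 2 come from (x + y)^2 \<le>
  2 x^2 + 2 y^2. The bound, uniform in time, is what later controls the trace of the limiting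
  covariance.\<close>

lemma elementary_op_hs_bounded:
  "elementary_on \<mu> t xs \<Longrightarrow> \<exists>C\<ge>0. \<forall>s N. (\<Sum>j<N. (l2_norm \<mu> (elementary_op \<mu> xs s (\<phi> (Suc j))))\<^sup>2) \<le> C"
proof (induction xs)
  case Nil
  then show ?case by (auto intro!: exI[of _ 0])
next
  case (Cons x xs)
  obtain a b g h where x: "x = (a, b, g, h)" by (cases x)
  have g: "g \<in> L2 \<mu>" and h: "h \<in> L2 \<mu>" and xs: "elementary_on \<mu> t xs"
    using Cons.prems by (auto simp: x)
  obtain C where C: "0 \<le> C" "\<And>s N. (\<Sum>j<N. (l2_norm \<mu> (elementary_op \<mu> xs s (\<phi> (Suc j))))\<^sup>2) \<le> C"
    using Cons.IH[OF xs] by blast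
  let ?C = "2 * ((l2_norm \<mu> g)\<^sup>2 * (l2_norm \<mu> h)\<^sup>2) + 2 * C"
  have "(\<Sum>j<N. (l2_norm \<mu> (elementary_op \<mu> (x # xs) s (\<phi> (Suc j))))\<^sup>2) \<le> ?C" for s N
  proof -
    have "(l2_norm \<mu> (elementary_op \<mu> (x # xs) s (\<phi> (Suc j))))\<^sup>2
        \<le> 2 * ((l2_inner \<mu> g (\<phi> (Suc j)))\<^sup>2 * (l2_norm \<mu> h)\<^sup>2)
          + 2 * (l2_norm \<mu> (elementary_op \<mu> xs s (\<phi> (Suc j))))\<^sup>2" for j
    proof -
      have "(l2_norm \<mu> (elementary_op \<mu> (x # xs) s (\<phi> (Suc j))))\<^sup>2
          \<le> 2 * (l2_norm \<mu> (\<lambda>x. (indicator {a<..b} s * l2_inner \<mu> (\<phi> (Suc j)) g) * h x))\<^sup>2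
            + 2 * (l2_norm \<mu> (elementary_op \<mu> xs s (\<phi> (Suc j))))\<^sup>2"
        unfolding x elementary_op_simps
        by (rule l2_norm_add_square_le[OF L2_scale[OF h] elementary_op_L2[OF xs]])
      also have "(l2_norm \<mu> (\<lambda>x. (indicator {a<..b} s * l2_inner \<mu> (\<phi> (Suc j)) g) * h x))\<^sup>2
          \<le> (l2_inner \<mu> g (\<phi> (Suc j)))\<^sup>2 * (l2_norm \<mu> h)\<^sup>2"
        unfolding l2_norm_scale l2_inner_commute[of \<mu> g]
        by (auto simp: indicator_def power_mult_distrib)
      finally show ?thesis by simp
    qed
    then have "(\<Sum>j<N. (l2_norm \<mu> (elementary_op \<mu> (x # xs) s (\<phi> (Suc j))))\<^sup>2)
        \<le> (\<Sum>j<N. 2 * ((l2_inner \<mu> g (\<phi> (Suc j)))\<^sup>2 * (l2_norm \<mu> h)\<^sup>2)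
          + 2 * (l2_norm \<mu> (elementary_op \<mu> xs s (\<phi> (Suc j))))\<^sup>2)"
      by (rule sum_mono)
    also have "\<dots> = 2 * ((\<Sum>j<N. (l2_inner \<mu> g (\<phi> (Suc j)))\<^sup>2) * (l2_norm \<mu> h)\<^sup>2)
        + 2 * (\<Sum>j<N. (l2_norm \<mu> (elementary_op \<mu> xs s (\<phi> (Suc j))))\<^sup>2)"
      by (simp add: sum.distrib sum_distrib_left sum_distrib_right mult.assoc)
    also have "\<dots> \<le> ?C"
    proof -
      have "(\<Sum>j<N. (l2_inner \<mu> g (\<phi> (Suc j)))\<^sup>2) \<le> (l2_norm \<mu> g)\<^sup>2"
      proof -
        have "(\<Sum>j<N. (l2_inner \<mu> g (\<phi> (Suc j)))\<^sup>2) \<le> (\<Sum>j. (l2_inner \<mu> g (\<phi> (Suc j)))\<^sup>2)"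
          using summable_coords[OF g] by (intro sum_le_suminf) auto
        then show ?thesis
          using sums_unique[OF parseval(1)[OF g]] by simp
      qed
      then show ?thesis
        using C(2)[of s N] by (intro add_mono mult_left_mono mult_right_mono) auto
    qed
    finally show ?thesis .
  qed
  then show ?case using C(1) by (intro exI[of _ ?C]) auto
qed

end

locale heat_eigenvalues = l2_basis \<mu> \<phi> + mu: prob_space \<mu> for \<mu> :: "'a measure" and \<phi> +
  fixes lam :: "nat \<Rightarrow> real" and \<alpha> :: real
  assumes lam_1: "lam 1 = 0" and lam_2: "0 < lam 2" and lam_ge: "\<And>k. 2 \<le> k \<Longrightarrow> lam 2 \<le> lam k"
    and alpha: "0 \<le> \<alpha>"
begin

lemma lam_Suc_0 [simp]: "lam (Suc 0) = 0"
  using lam_1 by simp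

lemma lam_pos: "2 \<le> k \<Longrightarrow> 0 < lam k"
  using lam_2 lam_ge[of k] by simp

lemma lam_nonneg: "1 \<le> k \<Longrightarrow> 0 \<le> lam k"
  using lam_1 lam_pos[of k] by (cases "k = 1") auto

definition noise_coef :: "nat \<Rightarrow> real" where "noise_coef k = (1 + lam k) powr (- \<alpha> / 2)"

lemma noise_coef_1: "noise_coef 1 = 1"
  by (simp add: noise_coef_def)

lemma noise_coef_bounds: "1 \<le> k \<Longrightarrow> \<bar>noise_coef k\<bar> \<le> 1"
  using powr_mono[of "- \<alpha> / 2" 0 "1 + lam k"] alpha lam_nonneg[of k] by (simp add: noise_coef_def)

lemma exp_lam_le_1: "0 \<le> t \<Longrightarrow> 1 \<le> k \<Longrightarrow> exp (- t * lam k) \<le> 1"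
  using lam_nonneg[of k] by simp

lemma inner_semigroup:
  "f \<in> L2 \<mu> \<Longrightarrow> 0 \<le> t \<Longrightarrow> 1 \<le> k \<Longrightarrow>
    l2_inner \<mu> (semigroup \<mu> \<phi> lam t f) (\<phi> k) = exp (- t * lam k) * l2_inner \<mu> f (\<phi> k)"
  unfolding semigroup_def using exp_lam_le_1 by (intro inner_spectral_op) auto

lemma semigroup_L2: "semigroup \<mu> \<phi> lam t f \<in> L2 \<mu>"
  unfolding semigroup_def by (rule spectral_op_L2)

abbreviation "Phi t s \<equiv> semigroup \<mu> \<phi> lam (t - s) \<circ> noise_op \<mu> \<phi> lam \<alpha>"

lemma inner_Phi:
  assumes "f \<in> L2 \<mu>" "s \<le> t" "1 \<le> k"
  shows "l2_inner \<mu> (Phi t s f) (\<phi> k) = exp (- (t - s) * lam k) * noise_coef k * l2_inner \<mu> f (\<phi> k)"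
proof -
  have "l2_inner \<mu> (noise_op \<mu> \<phi> lam \<alpha> f) (\<phi> k) = noise_coef k * l2_inner \<mu> f (\<phi> k)"
    unfolding noise_op_def noise_coef_def using assms noise_coef_bounds unfolding noise_coef_def by (intro inner_spectral_op) auto
  moreover have "noise_op \<mu> \<phi> lam \<alpha> f \<in> L2 \<mu>"
    unfolding noise_op_def by (rule spectral_op_L2)
  ultimately show ?thesis
    using assms by (simp add: inner_semigroup)
qed

lemma Phi_L2: "Phi t s f \<in> L2 \<mu>"
  by (simp add: semigroup_L2)

text \<open>Time profile of the \<open>k\<close>-th component of the stochastic convolution at time \<open>t\<close>.\<close>

definition profile :: "real \<Rightarrow> nat \<Rightarrow> real \<Rightarrow> real" where
  "profile t k s = indicator {0<..t} s * (exp (- (t - s) * lam k) * noise_coef k)"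

lemma profile_L2: "1 \<le> k \<Longrightarrow> profile t k \<in> L2 lborel"
proof -
  assume k: "1 \<le> k"
  have [measurable]: "profile t k \<in> borel_measurable borel"
    unfolding profile_def by measurable
  have "integrable lborel (\<lambda>s. (profile t k s)\<^sup>2)"
  proof (rule Bochner_Integration.integrable_bound)
    show "integrable lborel (indicator {0<..t} :: real \<Rightarrow> real)"
      by (cases "0 \<le> t") (auto intro!: integrable_real_indicator)
    have "(profile t k s)\<^sup>2 \<le> indicator {0<..t} s" for s
    proof (cases "s \<in> {0<..t}")
      case True
      have "\<bar>exp (- (t - s) * lam k) * noise_coef k\<bar> \<le> 1 * 1"
        unfolding abs_mult using True k exp_lam_le_1[of "t - s" k] noise_coef_bounds[OF k]
        by (intro mult_mono) auto
      then have "(exp (- (t - s) * lam k) * noise_coef k)\<^sup>2 \<le> 1\<^sup>2"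
        by (intro abs_le_square_iff[THEN iffD1]) auto
      then show ?thesis using True by (simp add: profile_def)
    qed (simp add: profile_def)
    then show "AE s in lborel. norm ((profile t k s)\<^sup>2) \<le> norm (indicator {0<..t} s :: real)"
      by (auto simp: abs_indicator)
  qed measurable
  then show "profile t k \<in> L2 lborel"
    by (simp add: L2_def)
qed

text \<open>The antiderivative of exp(-2 (t - s) lam k) in s is the same function divided by 2 lam
  k. The half-open interval of \<open>profile\<close> and the closed one of the fundamental theorem
  differ by the null set {0}.\<close>

lemma norm_profile:
  assumes k: "2 \<le> k" and t: "0 \<le> t"
  shows "(l2_norm lborel (profile t k))\<^sup>2 = (noise_coef k)\<^sup>2 * (1 - (exp (- t * lam k))\<^sup>2) / (2 * lam k)"
proof -
  let ?l = "lam k"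
  have l: "0 < ?l" by (rule lam_pos[OF k])
  let ?f = "\<lambda>s. (exp (- (t - s) * ?l))\<^sup>2"
  let ?F = "\<lambda>s. (exp (- (t - s) * ?l))\<^sup>2 / (2 * ?l)"
  have "has_bochner_integral lborel (\<lambda>s. ?f s * indicator {0..t} s) (?F t - ?F 0)"
    using t l
    by (intro has_bochner_integral_FTC_Icc_nonneg)
      (auto intro!: derivative_eq_intros continuous_intros simp: power2_eq_square field_simps)
  then have "(\<integral>s. ?f s * indicator {0..t} s \<partial>lborel) = (1 - (exp (- t * ?l))\<^sup>2) / (2 * ?l)"
    by (simp add: has_bochner_integral_iff diff_divide_distrib)
  moreover have "(l2_norm lborel (profile t k))\<^sup>2 = (\<integral>s. (noise_coef k)\<^sup>2 * (?f s * indicator {0..t} s) \<partial>lborel)"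
    unfolding l2_norm_square_integral
  proof (rule integral_cong_AE)
    show "(\<lambda>s. (profile t k s)\<^sup>2) \<in> borel_measurable lborel"
      using L2_measurable[OF profile_L2[of k t]] k by auto
    show "AE s in lborel. (profile t k s)\<^sup>2 = (noise_coef k)\<^sup>2 * (?f s * indicator {0..t} s)"
      using AE_lborel_singleton[of 0]
      by eventually_elim (auto simp: profile_def indicator_def power_mult_distrib)
  qed measurable
  ultimately show ?thesis by simp
qed

lemma profile_1: "profile t 1 s = indicator {0<..t} s"
  using noise_coef_1 by (simp add: profile_def)

text \<open>The coefficient of \<open>Z k\<close> in \<open>nu_infinity\<close>, extended by 0 at k
  = 1. The extension lets the series start at 1 as \<open>synth\<close> does, and makes the variance
  formulas valid for the constant mode, where lam 1 = 0 rules out the closed expression.\<close>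

definition stationary_sd :: "nat \<Rightarrow> real" where
  "stationary_sd k = (if 2 \<le> k then (1 + lam k) powr (- \<alpha> / 2) * (2 * lam k) powr (- 1 / 2) else 0)"

lemma stationary_sd_square: "2 \<le> k \<Longrightarrow> (stationary_sd k)\<^sup>2 = (noise_coef k)\<^sup>2 / (2 * lam k)"
proof -
  assume k: "2 \<le> k"
  have "((2 * lam k) powr (- 1 / 2))\<^sup>2 = (2 * lam k) powr (- 1)"
    by (simp only: power2_eq_square powr_add[symmetric]) simp
  also have "\<dots> = 1 / (2 * lam k)"
    using lam_pos[OF k] by (intro powr_neg_one) simp
  finally show ?thesis
    using k by (simp add: stationary_sd_def noise_coef_def power_mult_distrib)
qed

lemma norm_profile_stationary_sd:
  "2 \<le> k \<Longrightarrow> 0 \<le> t \<Longrightarrow> (l2_norm lborel (profile t k))\<^sup>2 = (stationary_sd k)\<^sup>2 * (1 - (exp (- t * lam k))\<^sup>2)"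
  by (simp add: norm_profile stationary_sd_square)

text \<open>The function on the left is the adjoint of the error \<open>elementary_op - Phi\<close>
  applied to \<open>\<phi> k\<close>, so its norm is at most the Hilbert-Schmidt norm of the error.
  In coordinates: by Parseval its norm is the sum of squared entries of the error in row
  \<open>k\<close>, and each entry is bounded by the norm of its column.\<close>

lemma comb_component_error:
  assumes xs: "elementary_on \<mu> t xs" and s: "s \<in> {0..t}" and k: "1 \<le> k"
  shows "ennreal ((l2_norm \<mu> (\<lambda>x. comb_fun (comb_component \<mu> (\<phi> k) xs) (s, x)
        - exp (- (t - s) * lam k) * noise_coef k * \<phi> k x))\<^sup>2)
    \<le> hs_norm2 \<mu> \<phi> (\<lambda>f x. elementary_op \<mu> xs s f x - Phi t s f x)"
proof -
  let ?a = "\<lambda>x. comb_fun (comb_component \<mu> (\<phi> k) xs) (s, x)"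
  let ?c = "exp (- (t - s) * lam k) * noise_coef k"
  let ?d = "\<lambda>x. ?a x - ?c * \<phi> k x"
  have a: "?a \<in> L2 \<mu>" by (rule comb_fun_component_L2[OF xs])
  have d: "?d \<in> L2 \<mu>" by (intro L2_diff L2_scale phi_L2 a k)
  have coef: "l2_inner \<mu> ?d (\<phi> (Suc j))
      = l2_inner \<mu> (\<lambda>x. elementary_op \<mu> xs s (\<phi> (Suc j)) x - Phi t s (\<phi> (Suc j)) x) (\<phi> k)" for j
  proof -
    have "l2_inner \<mu> ?d (\<phi> (Suc j)) = l2_inner \<mu> (elementary_op \<mu> xs s (\<phi> (Suc j))) (\<phi> k)
        - ?c * l2_inner \<mu> (\<phi> k) (\<phi> (Suc j))"
      using a k by (subst l2_inner_diff_left) (auto simp: l2_inner_scale_left inner_comb_fun_component[OF xs])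
    also have "?c * l2_inner \<mu> (\<phi> k) (\<phi> (Suc j)) = l2_inner \<mu> (Phi t s (\<phi> (Suc j))) (\<phi> k)"
      using s k by (simp add: inner_Phi l2_inner_commute[of \<mu> "\<phi> k"] del: o_apply)
    finally show ?thesis
      using k elementary_op_L2[OF xs] Phi_L2 by (simp add: l2_inner_diff_left del: o_apply)
  qed
  have "ennreal ((l2_norm \<mu> ?d)\<^sup>2) = (\<Sum>j. ennreal ((l2_inner \<mu> ?d (\<phi> (Suc j)))\<^sup>2))"
    using parseval(1)[OF d] by (subst suminf_ennreal2) (auto simp: sums_iff)
  also have "\<dots> \<le> hs_norm2 \<mu> \<phi> (\<lambda>f x. elementary_op \<mu> xs s f x - Phi t s f x)"
    unfolding hs_norm2_def
  proof (intro suminf_le ennreal_leI)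
    fix j
    let ?e = "\<lambda>x. elementary_op \<mu> xs s (\<phi> (Suc j)) x - Phi t s (\<phi> (Suc j)) x"
    have "\<bar>l2_inner \<mu> ?e (\<phi> k)\<bar> \<le> l2_norm \<mu> ?e"
      using l2_cauchy_schwarz[OF L2_diff[OF elementary_op_L2[OF xs] Phi_L2] phi_L2[OF k]] norm_phi[OF k]
      by (simp del: o_apply)
    then have "(l2_inner \<mu> ?e (\<phi> k))\<^sup>2 \<le> (l2_norm \<mu> ?e)\<^sup>2"
      by (intro abs_le_square_iff[THEN iffD1]) auto
    then show "(l2_inner \<mu> ?d (\<phi> (Suc j)))\<^sup>2 \<le> (l2_norm \<mu> ?e)\<^sup>2"
      unfolding coef .
  qed auto
  finally show ?thesis .
qed

end

section \<open>Components of the stochastic convolution\<close>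

locale stochastic_heat = heat_eigenvalues \<mu> \<phi> lam \<alpha> + cylindrical_wiener P \<mu> Fil W
  for \<mu> :: "'a measure" and \<phi> lam \<alpha> and P :: "'w measure" and Fil W
begin

text \<open>For times in (0, t] this is the adjoint of \<open>Phi t s\<close> applied to
  \<open>\<phi> k\<close>, which is an eigenvector; it is the integrand of the \<open>k\<close>-th
  component of the stochastic convolution.\<close>

definition mode :: "real \<Rightarrow> nat \<Rightarrow> real \<times> 'a \<Rightarrow> real" where
  "mode t k z = profile t k (fst z) * \<phi> k (snd z)"

lemma mode_L2: "1 \<le> k \<Longrightarrow> mode t k \<in> L2 K"
  unfolding mode_def[abs_def] by (intro tensor_in_L2K profile_L2) auto

text \<open>Tonelli reduces the claim to a fixed time \<open>s\<close>. In (0, t] it is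
  \<open>comb_component_error\<close>; elsewhere the combination and the mode both vanish.\<close>

lemma norm_comb_component_le:
  assumes xs: "elementary_on \<mu> t xs" and k: "1 \<le> k"
  shows "ennreal ((l2_norm K (\<lambda>z. comb_fun (comb_component \<mu> (\<phi> k) xs) z - mode t k z))\<^sup>2)
    \<le> (\<integral>\<^sup>+s\<in>{0..t}. hs_norm2 \<mu> \<phi> (\<lambda>f x. elementary_op \<mu> xs s f x - Phi t s f x) \<partial>lborel)"
proof -
  let ?D = "\<lambda>z. comb_fun (comb_component \<mu> (\<phi> k) xs) z - mode t k z"
  have D: "?D \<in> L2 K"
    by (intro L2_diff comb_fun_L2 comb_on_component[OF xs] mode_L2 k)
  have [measurable]: "?D \<in> borel_measurable K"
    using D by (rule L2_measurable)
  have "ennreal ((l2_norm K ?D)\<^sup>2) = (\<integral>\<^sup>+s. \<integral>\<^sup>+x. ennreal ((?D (s, x))\<^sup>2) \<partial>\<mu> \<partial>lborel)"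
    unfolding nn_integral_square[OF D, symmetric] by (subst mu.nn_integral_fst[symmetric]) auto
  also have "\<dots> \<le> (\<integral>\<^sup>+s\<in>{0..t}. hs_norm2 \<mu> \<phi> (\<lambda>f x. elementary_op \<mu> xs s f x - Phi t s f x) \<partial>lborel)"
  proof (rule nn_integral_mono)
    fix s :: real
    show "(\<integral>\<^sup>+x. ennreal ((?D (s, x))\<^sup>2) \<partial>\<mu>)
        \<le> hs_norm2 \<mu> \<phi> (\<lambda>f x. elementary_op \<mu> xs s f x - Phi t s f x) * indicator {0..t} s"
    proof (cases "0 < s \<and> s \<le> t")
      case True
      have "(\<lambda>x. ?D (s, x)) = (\<lambda>x. comb_fun (comb_component \<mu> (\<phi> k) xs) (s, x)
          - exp (- (t - s) * lam k) * noise_coef k * \<phi> k x)"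
        using True by (simp add: mode_def profile_def)
      moreover have "(\<lambda>x. comb_fun (comb_component \<mu> (\<phi> k) xs) (s, x)
          - exp (- (t - s) * lam k) * noise_coef k * \<phi> k x) \<in> L2 \<mu>"
        using k by (intro L2_diff L2_scale comb_fun_component_L2[OF xs]) auto
      ultimately show ?thesis
        using comb_component_error[OF xs _ k, of s] nn_integral_square[of "\<lambda>x. ?D (s, x)" \<mu>] True
        by (simp del: o_apply)
    next
      case False
      then have "?D (s, x) = 0" for x
        using comb_fun_component_zero[OF xs, of "(s, x)" "\<phi> k"] by (auto simp: mode_def profile_def)
      then show ?thesis by simp
    qed
  qed
  finally show ?thesis .
qed

text \<open>Pairing the approximating elementary integrals with \<open>\<phi> k\<close> gives finite
  combinations of values of \<open>W\<close>. Both convergences in the definition of the integral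
  survive: that of the integrands by \<open>norm_comb_component_le\<close>, that of the values by
  Cauchy-Schwarz.\<close>

lemma stochastic_integral_component:
  assumes I: "has_stochastic_integral P W \<mu> \<phi> (\<lambda>s. Phi t s) t I" and k: "1 \<le> k"
  shows "wiener_integral (\<lambda>\<omega>. l2_inner \<mu> (I \<omega>) (\<phi> k)) (mode t k)"
proof -
  obtain xs where I_meas: "I \<in> P \<rightarrow>\<^sub>M L2_borel \<mu>"
    and xs: "\<And>n. elementary_on \<mu> t (xs n)"
    and hs: "(\<lambda>n. \<integral>\<^sup>+s\<in>{0..t}. hs_norm2 \<mu> \<phi> (\<lambda>f x. elementary_op \<mu> (xs n) s f x - Phi t s f x) \<partial>lborel) \<longlonglongrightarrow> 0"
    and L2: "(\<lambda>n. \<integral>\<^sup>+\<omega>. ennreal ((l2_norm \<mu> (\<lambda>x. elementary_integral W (xs n) \<omega> x - I \<omega> x))\<^sup>2) \<partial>P) \<longlonglongrightarrow> 0"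
    using I unfolding has_stochastic_integral_def by blast
  let ?ys = "\<lambda>n. comb_component \<mu> (\<phi> k) (xs n)"
  have I_L2: "I \<omega> \<in> L2 \<mu>" if "\<omega> \<in> space P" for \<omega>
    using measurable_space[OF I_meas that] by simp
  show ?thesis
    unfolding wiener_integral_def
  proof (intro conjI exI[of _ ?ys] allI)
    show "(\<lambda>\<omega>. l2_inner \<mu> (I \<omega>) (\<phi> k)) \<in> borel_measurable P"
      using measurable_compose[OF I_meas borel_measurable_l2_inner] k by auto
    show "mode t k \<in> L2 K" using k by (rule mode_L2)
    show "comb_on \<mu> (?ys n)" for n by (rule comb_on_component[OF xs])
    have "(\<lambda>n. ennreal ((l2_norm K (\<lambda>z. comb_fun (?ys n) z - mode t k z))\<^sup>2)) \<longlonglongrightarrow> 0"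
      using norm_comb_component_le[OF xs k]
      by (intro tendsto_sandwich[OF _ _ tendsto_const hs]) auto
    then have "(\<lambda>n. ennreal ((l2_norm K (\<lambda>z. comb_fun (?ys n) z - mode t k z))\<^sup>2)) \<longlonglongrightarrow> ennreal 0"
      by simp
    then have "(\<lambda>n. (l2_norm K (\<lambda>z. comb_fun (?ys n) z - mode t k z))\<^sup>2) \<longlonglongrightarrow> 0"
      by (subst (asm) tendsto_ennreal_iff) auto
    from tendsto_real_sqrt[OF this]
    show "(\<lambda>n. l2_norm K (\<lambda>z. comb_fun (?ys n) z - mode t k z)) \<longlonglongrightarrow> 0"
      by simp
    have "(\<integral>\<^sup>+\<omega>. ennreal ((comb_sum W (?ys n) \<omega> - l2_inner \<mu> (I \<omega>) (\<phi> k))\<^sup>2) \<partial>P)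
        \<le> (\<integral>\<^sup>+\<omega>. ennreal ((l2_norm \<mu> (\<lambda>x. elementary_integral W (xs n) \<omega> x - I \<omega> x))\<^sup>2) \<partial>P)" for n
    proof (intro nn_integral_mono ennreal_leI)
      fix \<omega> assume \<omega>: "\<omega> \<in> space P"
      note E = elementary_integral_L2[OF xs[of n], of W \<omega>]
      have "comb_sum W (?ys n) \<omega> - l2_inner \<mu> (I \<omega>) (\<phi> k)
          = l2_inner \<mu> (\<lambda>x. elementary_integral W (xs n) \<omega> x - I \<omega> x) (\<phi> k)"
        using k by (simp add: comb_sum_component[OF xs] l2_inner_diff_left E I_L2[OF \<omega>])
      also have "\<bar>\<dots>\<bar> \<le> l2_norm \<mu> (\<lambda>x. elementary_integral W (xs n) \<omega> x - I \<omega> x)"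
        using l2_cauchy_schwarz[OF L2_diff[OF E I_L2[OF \<omega>]] phi_L2[OF k]] norm_phi[OF k] by simp
      finally show "(comb_sum W (?ys n) \<omega> - l2_inner \<mu> (I \<omega>) (\<phi> k))\<^sup>2
          \<le> (l2_norm \<mu> (\<lambda>x. elementary_integral W (xs n) \<omega> x - I \<omega> x))\<^sup>2"
        by (intro abs_le_square_iff[THEN iffD1]) auto
    qed
    then show "(\<lambda>n. \<integral>\<^sup>+\<omega>. ennreal ((comb_sum W (?ys n) \<omega> - l2_inner \<mu> (I \<omega>) (\<phi> k))\<^sup>2) \<partial>P) \<longlonglongrightarrow> 0"
      by (intro tendsto_sandwich[OF _ _ tendsto_const L2]) auto
  qed
qed

text \<open>The existence of the stochastic convolution forces the trace of the limiting covariance to be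
  finite, so no spectral asymptotics of the Laplacian are needed.\<close>

lemma summable_stationary_sd_if_integral:
  assumes I: "has_stochastic_integral P W \<mu> \<phi> (\<lambda>s. Phi 1 s) 1 I"
  shows "summable (\<lambda>k. (stationary_sd (Suc k))\<^sup>2)"
proof -
  obtain xs where xs: "\<And>n. elementary_on \<mu> 1 (xs n)"
    and hs: "(\<lambda>n. \<integral>\<^sup>+s\<in>{0..1}. hs_norm2 \<mu> \<phi> (\<lambda>f x. elementary_op \<mu> (xs n) s f x - Phi 1 s f x) \<partial>lborel) \<longlonglongrightarrow> 0"
    using I unfolding has_stochastic_integral_def by blast
  \<comment> \<open>A single elementary approximant at finite distance is enough; the threshold 1 is
    arbitrary.\<close>
  have "\<forall>\<^sub>F n in sequentially.
      (\<integral>\<^sup>+s\<in>{0..1}. hs_norm2 \<mu> \<phi> (\<lambda>f x. elementary_op \<mu> (xs n) s f x - Phi 1 s f x) \<partial>lborel) < 1"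
    by (rule order_tendstoD(2)[OF hs]) simp
  then obtain n where n:
      "(\<integral>\<^sup>+s\<in>{0..1}. hs_norm2 \<mu> \<phi> (\<lambda>f x. elementary_op \<mu> (xs n) s f x - Phi 1 s f x) \<partial>lborel) < 1"
    by (auto simp: eventually_sequentially simp del: o_apply)
  obtain C where C: "0 \<le> C" "\<And>s N. (\<Sum>j<N. (l2_norm \<mu> (elementary_op \<mu> (xs n) s (\<phi> (Suc j))))\<^sup>2) \<le> C"
    using elementary_op_hs_bounded[OF xs] by blast
  have norm_Phi: "(profile 1 (Suc j) s)\<^sup>2 \<le> (l2_norm \<mu> (Phi 1 s (\<phi> (Suc j))))\<^sup>2" if s: "0 < s" "s \<le> 1" for s j
  proof -
    have "\<bar>l2_inner \<mu> (Phi 1 s (\<phi> (Suc j))) (\<phi> (Suc j))\<bar> \<le> l2_norm \<mu> (Phi 1 s (\<phi> (Suc j)))"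
      using l2_cauchy_schwarz[OF Phi_L2 phi_L2, of "Suc j"] norm_phi[of "Suc j"] by (simp del: o_apply)
    moreover have "l2_inner \<mu> (Phi 1 s (\<phi> (Suc j))) (\<phi> (Suc j)) = profile 1 (Suc j) s"
      using s by (simp add: inner_Phi phi_inner profile_def del: o_apply)
    ultimately show ?thesis
      by (intro abs_le_square_iff[THEN iffD1]) (auto simp del: o_apply)
  qed
  have bound: "(\<Sum>j<N. (l2_norm lborel (profile 1 (Suc j)))\<^sup>2) \<le> 2 * (1 + C)" for N
  proof -
    \<comment> \<open>By (x + y)^2 \<le> 2 x^2 + 2 y^2, \<open>g s\<close> is at most the squared
      Hilbert-Schmidt distance between \<open>Phi 1 s\<close> and the approximant. Its integral,
      half of the sum in question minus C, is therefore at most 1, whence the bound 2 (1 + C). As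
      \<open>g\<close> may be negative, \<open>max 0\<close> mediates with the nonnegative
      integral.\<close>
    define g where "g s = (\<Sum>j<N. (profile 1 (Suc j) s)\<^sup>2) / 2 - C * indicator {0<..1} s" for s :: real
    have int: "integrable lborel (\<lambda>s. (profile 1 (Suc j) s)\<^sup>2)" for j
      by (rule L2_integrable_square[OF profile_L2]) simp
    have intI: "integrable lborel (\<lambda>s. C * indicator {0<..1::real} s)"
      by (intro integrable_mult_right integrable_real_indicator) auto
    have g_int: "integrable lborel g"
      unfolding g_def using int intI by auto
    have "(\<integral>s. g s \<partial>lborel) = (\<Sum>j<N. (l2_norm lborel (profile 1 (Suc j)))\<^sup>2) / 2 - C"
      unfolding g_def l2_norm_square_integral
      using int intI by (subst Bochner_Integration.integral_diff) auto
    moreover have "(\<integral>s. g s \<partial>lborel) \<le> 1"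
    proof -
      have "(\<integral>s. g s \<partial>lborel) \<le> (\<integral>s. max 0 (g s) \<partial>lborel)"
        using g_int by (intro integral_mono) auto
      moreover have "ennreal (\<integral>s. max 0 (g s) \<partial>lborel) = (\<integral>\<^sup>+s. ennreal (max 0 (g s)) \<partial>lborel)"
        using g_int by (intro nn_integral_eq_integral[symmetric]) auto
      moreover have "\<dots> \<le> (\<integral>\<^sup>+s\<in>{0..1}. hs_norm2 \<mu> \<phi> (\<lambda>f x. elementary_op \<mu> (xs n) s f x - Phi 1 s f x) \<partial>lborel)"
      proof (rule nn_integral_mono)
        fix s :: real
        let ?d = "\<lambda>j x. elementary_op \<mu> (xs n) s (\<phi> (Suc j)) x - Phi 1 s (\<phi> (Suc j)) x"
        show "ennreal (max 0 (g s))
            \<le> hs_norm2 \<mu> \<phi> (\<lambda>f x. elementary_op \<mu> (xs n) s f x - Phi 1 s f x) * indicator {0..1} s"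
        proof (cases "0 < s \<and> s \<le> 1")
          case True
          have "(profile 1 (Suc j) s)\<^sup>2 \<le> 2 * (l2_norm \<mu> (elementary_op \<mu> (xs n) s (\<phi> (Suc j))))\<^sup>2
              + 2 * (l2_norm \<mu> (?d j))\<^sup>2" for j
          proof -
            let ?e = "elementary_op \<mu> (xs n) s (\<phi> (Suc j))" and ?p = "Phi 1 s (\<phi> (Suc j))"
            have e: "?e \<in> L2 \<mu>" and p: "?p \<in> L2 \<mu>"
              using elementary_op_L2[OF xs] Phi_L2 by auto
            have "(l2_norm \<mu> (\<lambda>x. ?e x + (?p x - ?e x)))\<^sup>2 \<le> 2 * (l2_norm \<mu> ?e)\<^sup>2 + 2 * (l2_norm \<mu> (\<lambda>x. ?p x - ?e x))\<^sup>2"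
              by (rule l2_norm_add_square_le[OF e L2_diff[OF p e]])
            moreover have "(\<lambda>x. ?e x + (?p x - ?e x)) = ?p"
              by auto
            ultimately show ?thesis
              using norm_Phi[of s j] True l2_norm_minus_commute[of \<mu> ?p ?e] by (simp del: o_apply)
          qed
          then have "(\<Sum>j<N. (profile 1 (Suc j) s)\<^sup>2)
              \<le> (\<Sum>j<N. 2 * (l2_norm \<mu> (elementary_op \<mu> (xs n) s (\<phi> (Suc j))))\<^sup>2 + 2 * (l2_norm \<mu> (?d j))\<^sup>2)"
            by (rule sum_mono)
          also have "\<dots> \<le> 2 * C + 2 * (\<Sum>j<N. (l2_norm \<mu> (?d j))\<^sup>2)"
            using C(2)[of s N] by (simp add: sum.distrib flip: sum_distrib_left)
          finally have "g s \<le> (\<Sum>j<N. (l2_norm \<mu> (?d j))\<^sup>2)"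
            using True by (simp add: g_def del: o_apply)
          then have "max 0 (g s) \<le> (\<Sum>j<N. (l2_norm \<mu> (?d j))\<^sup>2)"
            by (simp add: sum_nonneg del: o_apply)
          then have "ennreal (max 0 (g s)) \<le> ennreal (\<Sum>j<N. (l2_norm \<mu> (?d j))\<^sup>2)"
            by (rule ennreal_leI)
          also have "\<dots> = (\<Sum>j<N. ennreal ((l2_norm \<mu> (?d j))\<^sup>2))"
            by (rule sum_ennreal[symmetric]) simp
          also have "\<dots> \<le> hs_norm2 \<mu> \<phi> (\<lambda>f x. elementary_op \<mu> (xs n) s f x - Phi 1 s f x)"
            unfolding hs_norm2_def by (rule sum_le_suminf) auto
          finally show ?thesis using True by (simp del: o_apply)
        next
          case False
          then have "g s = 0"
            by (auto simp: g_def profile_def indicator_def intro!: sum.neutral)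
          then show ?thesis by simp
        qed
      qed
      ultimately have "ennreal (\<integral>s. max 0 (g s) \<partial>lborel) \<le> ennreal 1"
        using n by (simp del: o_apply)
      then have "(\<integral>s. max 0 (g s) \<partial>lborel) \<le> 1"
        by (subst (asm) ennreal_le_iff) auto
      then show ?thesis
        using \<open>(\<integral>s. g s \<partial>lborel) \<le> (\<integral>s. max 0 (g s) \<partial>lborel)\<close> by simp
    qed
    ultimately show ?thesis by simp
  qed
  have sum: "summable (\<lambda>j. (l2_norm lborel (profile 1 (Suc j)))\<^sup>2)"
    by (rule summableI_nonneg_bounded[OF _ bound]) simp
  \<comment> \<open>By the spectral gap, time 1 already produces at least the fraction
    \<open>?q\<close> of the equilibrium variance in every mode k \<ge> 2.\<close>
  let ?q = "1 - (exp (- lam 2))\<^sup>2"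
  have q: "0 < ?q"
    using lam_2 by (simp add: power_less_one_iff[of "exp (- lam 2)" 2, simplified] power_strict_mono[of "exp (- lam 2)" 1 2, simplified])
  have *: "norm ((stationary_sd (Suc j))\<^sup>2) \<le> (l2_norm lborel (profile 1 (Suc j)))\<^sup>2 / ?q" for j
  proof (cases "2 \<le> Suc j")
    case True
    have "exp (- lam (Suc j)) \<le> exp (- lam 2)"
      using lam_ge[OF True] by simp
    then have "?q \<le> 1 - (exp (- lam (Suc j)))\<^sup>2"
      by (simp add: power_mono)
    then have "(stationary_sd (Suc j))\<^sup>2 * ?q \<le> (l2_norm lborel (profile 1 (Suc j)))\<^sup>2"
      unfolding norm_profile_stationary_sd[OF True zero_le_one] by (intro mult_left_mono) auto
    then show ?thesis
      using q by (simp add: field_simps)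
  next
    case False
    then show ?thesis using q by (simp add: stationary_sd_def)
  qed
  show ?thesis
    by (rule summable_comparison_test'[OF summable_divide[OF sum, of ?q], of 0]) (rule *)
qed

end

section \<open>Laws on the Hilbert space\<close>

context l2_basis
begin

abbreviation lin :: "nat set \<Rightarrow> (nat \<Rightarrow> real) \<Rightarrow> ('a \<Rightarrow> real) \<Rightarrow> real" where
  "lin H b f \<equiv> (\<Sum>k\<in>H. b k * l2_inner \<mu> f (\<phi> k))"

lemma lin_measurable: "H \<subseteq> {1..} \<Longrightarrow> lin H b \<in> borel_measurable (L2_borel \<mu>)"
  by (intro borel_measurable_sum borel_measurable_times borel_measurable_l2_inner) auto

text \<open>The coordinates generate all Borel sets, so uniqueness on the generated sigma-algebra is
  equality of the measures.\<close>

lemma L2_borel_measure_eqI: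
  assumes M: "prob_space M" "sets M = sets (L2_borel \<mu>)" and N: "prob_space N" "sets N = sets (L2_borel \<mu>)"
    and char: "\<And>H b. finite H \<Longrightarrow> H \<subseteq> {1..} \<Longrightarrow> (CLINT f|M. iexp (lin H b f)) = (CLINT f|N. iexp (lin H b f))"
  shows "M = N"
proof (rule measure_eqI)
  show "sets M = sets N" using M N by simp
  fix B assume "B \<in> sets M"
  have "space M = space (L2_borel \<mu>)"
    using sets_eq_imp_space_eq[OF M(2)] .
  then have "B \<in> sets (process_sigma M borel (\<lambda>k f. l2_inner \<mu> f (\<phi> k)) {1..})"
    using \<open>B \<in> sets M\<close> M(2) sets_L2_borel_eq_process_sigma by (simp add: process_sigma_def)
  then show "emeasure M B = emeasure N B"
  proof (rule emeasure_eq_if_char_eq[OF M(1) N(1), rotated -1])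
    show "(\<lambda>f. l2_inner \<mu> f (\<phi> k)) \<in> borel_measurable M" if "k \<in> {1..}" for k
      using that by (subst measurable_cong_sets[OF M(2) refl]) auto
  qed (use M N char in auto)
qed

lemma l2_add_measurable:
  "(\<lambda>(f, g). \<lambda>x. f x + g x) \<in> L2_borel \<mu> \<Otimes>\<^sub>M L2_borel \<mu> \<rightarrow>\<^sub>M L2_borel \<mu>"
proof (rule measurable_L2_borelI)
  fix k :: nat assume "1 \<le> k"
  then have [measurable]: "(\<lambda>f. l2_inner \<mu> f (\<phi> k)) \<in> borel_measurable (L2_borel \<mu>)"
    by auto
  have "(\<lambda>z. l2_inner \<mu> (fst z) (\<phi> k) + l2_inner \<mu> (snd z) (\<phi> k))
      \<in> borel_measurable (L2_borel \<mu> \<Otimes>\<^sub>M L2_borel \<mu>)"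
    by measurable
  then show "(\<lambda>z. l2_inner \<mu> ((\<lambda>(f, g) x. f x + g x) z) (\<phi> k)) \<in> borel_measurable (L2_borel \<mu> \<Otimes>\<^sub>M L2_borel \<mu>)"
    using \<open>1 \<le> k\<close>
    by (subst measurable_cong[where g = "\<lambda>z. l2_inner \<mu> (fst z) (\<phi> k) + l2_inner \<mu> (snd z) (\<phi> k)"])
      (auto simp: space_pair_measure l2_inner_add_left)
qed (auto simp: space_pair_measure)

lemma prob_l2_convolution:
  assumes "l2_prob \<mu> \<nu>1" "l2_prob \<mu> \<nu>2"
  shows "l2_prob \<mu> (l2_convolution \<mu> \<nu>1 \<nu>2)"
proof -
  interpret A: prob_space \<nu>1 using assms by (simp add: l2_prob_def)
  interpret B: prob_space \<nu>2 using assms by (simp add: l2_prob_def)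
  interpret AB: pair_prob_space \<nu>1 \<nu>2 ..
  have "sets (\<nu>1 \<Otimes>\<^sub>M \<nu>2) = sets (L2_borel \<mu> \<Otimes>\<^sub>M L2_borel \<mu>)"
    using assms by (intro sets_pair_measure_cong) (auto simp: l2_prob_def)
  then have "(\<lambda>(f, g). \<lambda>x. f x + g x) \<in> \<nu>1 \<Otimes>\<^sub>M \<nu>2 \<rightarrow>\<^sub>M L2_borel \<mu>"
    using l2_add_measurable measurable_cong_sets by blast
  then show ?thesis
    unfolding l2_prob_def l2_convolution_def using AB.prob_space_distr by simp
qed

lemma char_l2_convolution:
  assumes \<nu>: "l2_prob \<mu> \<nu>1" "l2_prob \<mu> \<nu>2" and H: "finite H" "H \<subseteq> {1..}"
  shows "(CLINT f|l2_convolution \<mu> \<nu>1 \<nu>2. iexp (lin H b f))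
    = (CLINT f|\<nu>1. iexp (lin H b f)) * (CLINT f|\<nu>2. iexp (lin H b f))"
proof -
  have P: "prob_space \<nu>1" "prob_space \<nu>2" and S: "sets \<nu>1 = sets (L2_borel \<mu>)" "sets \<nu>2 = sets (L2_borel \<mu>)"
    using \<nu> by (auto simp: l2_prob_def)
  have sp: "space \<nu>1 = L2 \<mu>" "space \<nu>2 = L2 \<mu>"
    using S[THEN sets_eq_imp_space_eq] by simp_all
  have m [measurable]: "lin H b \<in> borel_measurable \<nu>1" "lin H b \<in> borel_measurable \<nu>2"
      "lin H b \<in> borel_measurable (L2_borel \<mu>)"
    using lin_measurable[OF H(2), of b] measurable_cong_sets[OF S(1) refl] measurable_cong_sets[OF S(2) refl] by auto
  have "sets (\<nu>1 \<Otimes>\<^sub>M \<nu>2) = sets (L2_borel \<mu> \<Otimes>\<^sub>M L2_borel \<mu>)"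
    using S by (intro sets_pair_measure_cong)
  then have a: "(\<lambda>(f, g). \<lambda>x. f x + g x) \<in> \<nu>1 \<Otimes>\<^sub>M \<nu>2 \<rightarrow>\<^sub>M L2_borel \<mu>"
    using l2_add_measurable measurable_cong_sets by blast
  have "(CLINT f|l2_convolution \<mu> \<nu>1 \<nu>2. iexp (lin H b f))
      = (CLINT z|\<nu>1 \<Otimes>\<^sub>M \<nu>2. iexp (lin H b ((\<lambda>(f, g). \<lambda>x. f x + g x) z)))"
    unfolding l2_convolution_def by (rule integral_distr[OF a]) (rule iexp_measurable[OF m(3)])
  also have "\<dots> = (CLINT z|\<nu>1 \<Otimes>\<^sub>M \<nu>2. iexp (lin H b (fst z)) * iexp (lin H b (snd z)))"
  proof (rule Bochner_Integration.integral_cong[OF refl])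
    fix z assume "z \<in> space (\<nu>1 \<Otimes>\<^sub>M \<nu>2)"
    then have "fst z \<in> L2 \<mu>" "snd z \<in> L2 \<mu>" by (auto simp: space_pair_measure sp)
    then have "lin H b ((\<lambda>(f, g). \<lambda>x. f x + g x) z) = lin H b (fst z) + lin H b (snd z)"
      unfolding sum.distrib[symmetric] using H
      by (intro sum.cong) (auto simp: case_prod_beta' l2_inner_add_left distrib_left subset_iff)
    then show "iexp (lin H b ((\<lambda>(f, g). \<lambda>x. f x + g x) z)) = iexp (lin H b (fst z)) * iexp (lin H b (snd z))"
      by (simp only: of_real_add distrib_left exp_add)
  qed
  also have "\<dots> = (CLINT f|\<nu>1. iexp (lin H b f)) * (CLINT f|\<nu>2. iexp (lin H b f))"
    by (rule integral_pair_mult[OF P]) (auto simp del: of_real_sum of_real_mult)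
  finally show ?thesis .
qed

lemma char_L2_distr:
  assumes "X \<in> M \<rightarrow>\<^sub>M L2_borel \<mu>" "H \<subseteq> {1..}"
  shows "(CLINT f|distr M (L2_borel \<mu>) X. iexp (lin H b f)) = (CLINT \<omega>|M. iexp (lin H b (X \<omega>)))"
  by (rule integral_distr[OF assms(1)]) (rule iexp_measurable[OF lin_measurable[OF assms(2)]])

lemma H1_inner:
  assumes "f \<in> H1 \<mu> \<phi>" "2 \<le> k"
  shows "l2_inner \<mu> f (\<phi> k) = 0"
proof -
  obtain c where f: "f \<in> L2 \<mu>" and c: "AE x in \<mu>. f x = c * \<phi> 1 x"
    using assms(1) by (auto simp: H1_def)
  have "l2_inner \<mu> f (\<phi> k) = l2_inner \<mu> (\<lambda>x. c * \<phi> 1 x) (\<phi> k)"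
    using f c assms(2) by (intro l2_inner_cong_AE L2_measurable L2_scale phi_L2) auto
  then show ?thesis
    using assms(2) phi_inner[of 1 k] by (simp add: l2_inner_scale_left)
qed

text \<open>\<open>l2_proj\<close> chooses a representative, so only its coordinates are determined.
  The multiple of \<open>\<phi> 1\<close> with the first coordinate of \<open>f\<close> shows that
  the choice is not void.\<close>

lemma l2_proj_H1:
  assumes f: "f \<in> L2 \<mu>"
  shows "l2_proj \<mu> (H1 \<mu> \<phi>) f \<in> H1 \<mu> \<phi>"
    and "l2_inner \<mu> (l2_proj \<mu> (H1 \<mu> \<phi>) f) (\<phi> 1) = l2_inner \<mu> f (\<phi> 1)"
proof -
  let ?Q = "\<lambda>g. g \<in> H1 \<mu> \<phi> \<and> (\<forall>h\<in>H1 \<mu> \<phi>. l2_inner \<mu> (\<lambda>x. f x - g x) h = 0)"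
  let ?g = "\<lambda>x. l2_inner \<mu> f (\<phi> 1) * \<phi> 1 x"
  have one: "\<phi> 1 \<in> L2 \<mu>" by auto
  have "?Q ?g"
  proof (intro conjI ballI)
    show "?g \<in> H1 \<mu> \<phi>" using one by (auto simp: H1_def)
    fix h assume "h \<in> H1 \<mu> \<phi>"
    then obtain c where h: "h \<in> L2 \<mu>" "AE x in \<mu>. h x = c * \<phi> 1 x" by (auto simp: H1_def)
    have d: "(\<lambda>x. f x - ?g x) \<in> L2 \<mu>" by (intro L2_diff L2_scale f one)
    have "l2_inner \<mu> h (\<lambda>x. f x - ?g x) = l2_inner \<mu> (\<lambda>x. c * \<phi> 1 x) (\<lambda>x. f x - ?g x)"
      using h d one by (intro l2_inner_cong_AE L2_measurable L2_scale) auto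
    also have "\<dots> = c * l2_inner \<mu> (\<lambda>x. f x - ?g x) (\<phi> 1)"
      by (simp add: l2_inner_scale_left l2_inner_commute)
    also have "l2_inner \<mu> (\<lambda>x. f x - ?g x) (\<phi> 1) = 0"
      using phi_inner[of 1 1] f one
      by (subst l2_inner_diff_left) (auto simp: l2_inner_scale_left)
    finally show "l2_inner \<mu> (\<lambda>x. f x - ?g x) h = 0" by (simp add: l2_inner_commute)
  qed
  then have Q: "?Q (l2_proj \<mu> (H1 \<mu> \<phi>) f)"
    unfolding l2_proj_def by (rule someI[of ?Q])
  then show "l2_proj \<mu> (H1 \<mu> \<phi>) f \<in> H1 \<mu> \<phi>" by blast
  then have p: "l2_proj \<mu> (H1 \<mu> \<phi>) f \<in> L2 \<mu>" by (simp add: H1_def)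
  have "\<phi> 1 \<in> H1 \<mu> \<phi>" using one by (auto simp: H1_def intro!: exI[of _ 1])
  with Q have "l2_inner \<mu> (\<lambda>x. f x - l2_proj \<mu> (H1 \<mu> \<phi>) f x) (\<phi> 1) = 0" by blast
  then show "l2_inner \<mu> (l2_proj \<mu> (H1 \<mu> \<phi>) f) (\<phi> 1) = l2_inner \<mu> f (\<phi> 1)"
    using f p one by (simp add: l2_inner_diff_left)
qed

text \<open>The choice of representatives does no harm, because Borel sets depend on the coordinates
  alone, and these are measurable functions of \<open>f\<close>.\<close>

lemma l2_proj_H1_measurable: "l2_proj \<mu> (H1 \<mu> \<phi>) \<in> L2_borel \<mu> \<rightarrow>\<^sub>M L2_borel \<mu>"
proof (rule measurable_L2_borelI)
  fix k :: nat assume k: "1 \<le> k"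
  have "l2_inner \<mu> (l2_proj \<mu> (H1 \<mu> \<phi>) f) (\<phi> k) = (if k = 1 then l2_inner \<mu> f (\<phi> 1) else 0)"
    if "f \<in> L2 \<mu>" for f
    using l2_proj_H1[OF that] H1_inner[of "l2_proj \<mu> (H1 \<mu> \<phi>) f" k] k by auto
  then show "(\<lambda>f. l2_inner \<mu> (l2_proj \<mu> (H1 \<mu> \<phi>) f) (\<phi> k)) \<in> borel_measurable (L2_borel \<mu>)"
    by (subst measurable_cong[where g = "\<lambda>f. if k = 1 then l2_inner \<mu> f (\<phi> 1) else 0"]) auto
qed (use l2_proj_H1 in \<open>auto simp: H1_def\<close>)

end

section \<open>The equilibrium law and its characteristic function\<close>

locale gaussian_family = heat_eigenvalues \<mu> \<phi> lam \<alpha> + Q: prob_space Q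
  for \<mu> :: "'a measure" and \<phi> lam \<alpha> and Q :: "'z measure" +
  fixes Z :: "nat \<Rightarrow> 'z \<Rightarrow> real"
  assumes Z_indep: "Q.indep_vars (\<lambda>_. borel) Z {1..}"
    and Z_normal: "\<And>k. 1 \<le> k \<Longrightarrow> distributed Q lborel (Z k) std_normal_density"
    and summable_stationary_sd: "summable (\<lambda>k. (stationary_sd (Suc k))\<^sup>2)"
begin

lemma Z_meas: "1 \<le> k \<Longrightarrow> Z k \<in> borel_measurable Q"
  using distributed_measurable[OF Z_normal[of k]] by simp

definition zeta :: "'z \<Rightarrow> nat \<Rightarrow> real" where "zeta \<omega> k = stationary_sd k * Z k \<omega>"

lemma zeta_1 [simp]: "zeta \<omega> (Suc 0) = 0"
  by (simp add: zeta_def stationary_sd_def)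

lemma zeta_meas: "1 \<le> k \<Longrightarrow> (\<lambda>\<omega>. zeta \<omega> k) \<in> borel_measurable Q"
  unfolding zeta_def using Z_meas by simp

text \<open>The expectation of the sum of squares is the trace of the limiting covariance, which is
  finite.\<close>

lemma zeta_summable: "AE \<omega> in Q. summable (\<lambda>k. (zeta \<omega> (Suc k))\<^sup>2)"
proof -
  have [measurable]: "(\<lambda>\<omega>. zeta \<omega> (Suc k)) \<in> borel_measurable Q" for k
    by (rule zeta_meas) simp
  have "(\<integral>\<^sup>+\<omega>. ennreal ((zeta \<omega> (Suc k))\<^sup>2) \<partial>Q) = ennreal ((stationary_sd (Suc k))\<^sup>2)" for k
  proof -
    have "integrable Q (\<lambda>\<omega>. (Z (Suc k) \<omega>)\<^sup>2)" "(\<integral>\<omega>. (Z (Suc k) \<omega>)\<^sup>2 \<partial>Q) = 1"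
      using Q.normal_second_moment[of 1 "Z (Suc k)"] Z_normal[of "Suc k"] by auto
    then have "integrable Q (\<lambda>\<omega>. (zeta \<omega> (Suc k))\<^sup>2)" "(\<integral>\<omega>. (zeta \<omega> (Suc k))\<^sup>2 \<partial>Q) = (stationary_sd (Suc k))\<^sup>2"
      by (simp_all add: zeta_def power_mult_distrib)
    then show ?thesis
      by (subst nn_integral_eq_integral) auto
  qed
  then have "(\<integral>\<^sup>+\<omega>. (\<Sum>k. ennreal ((zeta \<omega> (Suc k))\<^sup>2)) \<partial>Q) = (\<Sum>k. ennreal ((stationary_sd (Suc k))\<^sup>2))"
    by (subst nn_integral_suminf) auto
  also have "\<dots> = ennreal (\<Sum>k. (stationary_sd (Suc k))\<^sup>2)"
    by (rule suminf_ennreal2) (auto intro: summable_stationary_sd)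
  finally have "AE \<omega> in Q. (\<Sum>k. ennreal ((zeta \<omega> (Suc k))\<^sup>2)) \<noteq> \<infinity>"
    by (intro nn_integral_PInf_AE) auto
  then show ?thesis
    by eventually_elim (auto intro: summable_suminf_not_top)
qed

lemma nu_infinity_eq: "nu_infinity \<mu> \<phi> lam \<alpha> Q Z = distr Q (L2_borel \<mu>) (\<lambda>\<omega>. synth (zeta \<omega>))"
proof -
  have "(\<Sum>k=2..n. (1 + lam k) powr (- \<alpha> / 2) * (2 * lam k) powr (- 1 / 2) * Z k \<omega> * \<phi> k x)
      = (\<Sum>k=1..n. zeta \<omega> k * \<phi> k x)" for n \<omega> x
    by (rule sum.mono_neutral_cong_left) (auto simp: zeta_def stationary_sd_def)
  then show ?thesis
    by (simp add: nu_infinity_def synth_def psum_def[abs_def])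
qed

lemma synth_zeta_meas: "(\<lambda>\<omega>. synth (zeta \<omega>)) \<in> Q \<rightarrow>\<^sub>M L2_borel \<mu>"
  by (rule measurable_synth) (rule zeta_meas)

lemma nu_infinity_prob: "l2_prob \<mu> (nu_infinity \<mu> \<phi> lam \<alpha> Q Z)"
  unfolding l2_prob_def nu_infinity_eq using Q.prob_space_distr[OF synth_zeta_meas] by simp

lemma char_zeta:
  assumes H: "finite H" "H \<subseteq> {1..}"
  shows "(CLINT \<omega>|Q. iexp (\<Sum>k\<in>H. a k * zeta \<omega> k)) = complex_of_real (exp (- (\<Sum>k\<in>H. (a k)\<^sup>2 * (stationary_sd k)\<^sup>2) / 2))"
proof -
  have Zm: "Z k \<in> borel_measurable Q" if "k \<in> H" for k
    using Z_meas that H by auto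
  have "Q.indep_vars (\<lambda>_. borel) (\<lambda>k \<omega>. (a k * stationary_sd k) * Z k \<omega>) H"
    using Q.indep_vars_compose2[OF Q.indep_vars_subset[OF Z_indep H(2)], of "\<lambda>k x. (a k * stationary_sd k) * x" "\<lambda>_. borel"]
    by simp
  from Q.char_distr_sum[OF this, of 1]
  have "char (distr Q borel (\<lambda>\<omega>. \<Sum>k\<in>H. (a k * stationary_sd k) * Z k \<omega>)) 1
      = (\<Prod>k\<in>H. char (distr Q borel (\<lambda>\<omega>. (a k * stationary_sd k) * Z k \<omega>)) 1)" .
  also have "\<dots> = (\<Prod>k\<in>H. complex_of_real (exp (- ((a k)\<^sup>2 * (stationary_sd k)\<^sup>2) / 2)))"
  proof (rule prod.cong[OF refl])
    fix k assume k: "k \<in> H"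
    have "char (distr Q borel (\<lambda>\<omega>. (a k * stationary_sd k) * Z k \<omega>)) 1 = char (distr Q borel (Z k)) (a k * stationary_sd k)"
      using Zm[OF k] by (simp add: char_def integral_distr)
    also have "\<dots> = complex_of_real (exp (- ((a k * stationary_sd k)\<^sup>2 * 1\<^sup>2) / 2))"
      using Z_normal[of k] k H by (intro Q.normal_char) auto
    finally show "char (distr Q borel (\<lambda>\<omega>. (a k * stationary_sd k) * Z k \<omega>)) 1
        = complex_of_real (exp (- ((a k)\<^sup>2 * (stationary_sd k)\<^sup>2) / 2))"
      by (simp add: power_mult_distrib)
  qed
  also have "\<dots> = complex_of_real (exp (\<Sum>k\<in>H. - ((a k)\<^sup>2 * (stationary_sd k)\<^sup>2) / 2))"
    by (simp add: exp_sum[OF H(1)] of_real_prod)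
  also have "(\<Sum>k\<in>H. - ((a k)\<^sup>2 * (stationary_sd k)\<^sup>2) / 2) = - (\<Sum>k\<in>H. (a k)\<^sup>2 * (stationary_sd k)\<^sup>2) / 2"
    by (simp add: sum_negf sum_divide_distrib)
  finally have "char (distr Q borel (\<lambda>\<omega>. \<Sum>k\<in>H. (a k * stationary_sd k) * Z k \<omega>)) 1
      = complex_of_real (exp (- (\<Sum>k\<in>H. (a k)\<^sup>2 * (stationary_sd k)\<^sup>2) / 2))" .
  moreover have "(\<lambda>\<omega>. \<Sum>k\<in>H. (a k * stationary_sd k) * Z k \<omega>) \<in> borel_measurable Q"
    using Zm by (intro borel_measurable_sum borel_measurable_times) auto
  ultimately show ?thesis
    by (simp add: char_def integral_distr zeta_def mult.assoc del: of_real_sum of_real_mult)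
qed

lemma char_nu_infinity:
  assumes H: "finite H" "H \<subseteq> {1..}"
  shows "(CLINT f|nu_infinity \<mu> \<phi> lam \<alpha> Q Z. iexp (lin H b f))
    = complex_of_real (exp (- (\<Sum>k\<in>H. (b k)\<^sup>2 * (stationary_sd k)\<^sup>2) / 2))"
proof -
  have "(CLINT f|nu_infinity \<mu> \<phi> lam \<alpha> Q Z. iexp (lin H b f)) = (CLINT \<omega>|Q. iexp (lin H b (synth (zeta \<omega>))))"
    unfolding nu_infinity_eq by (rule char_L2_distr[OF synth_zeta_meas H(2)])
  also have "\<dots> = (CLINT \<omega>|Q. iexp (\<Sum>k\<in>H. b k * zeta \<omega> k))"
  proof (rule integral_cong_AE)
    show "(\<lambda>\<omega>. iexp (lin H b (synth (zeta \<omega>)))) \<in> borel_measurable Q"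
      by (rule iexp_measurable[OF measurable_compose[OF synth_zeta_meas lin_measurable[OF H(2)]]])
    show "(\<lambda>\<omega>. iexp (\<Sum>k\<in>H. b k * zeta \<omega> k)) \<in> borel_measurable Q"
      using H by (intro iexp_measurable borel_measurable_sum borel_measurable_times zeta_meas) auto
    show "AE \<omega> in Q. iexp (lin H b (synth (zeta \<omega>))) = iexp (\<Sum>k\<in>H. b k * zeta \<omega> k)"
      using zeta_summable
    proof eventually_elim
      case (elim \<omega>)
      then have "lin H b (synth (zeta \<omega>)) = (\<Sum>k\<in>H. b k * zeta \<omega> k)"
        using H by (intro sum.cong) (auto simp: inner_synth)
      then show ?case by (simp only:)
    qed
  qed
  also note char_zeta[OF H]
  finally show ?thesis .
qed

end

section \<open>The solution and its constant mode\<close>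

locale mild_heat = stochastic_heat \<mu> \<phi> lam \<alpha> P Fil W
  for \<mu> :: "'a measure" and \<phi> lam \<alpha> and P :: "'w measure" and Fil W +
  fixes u0 :: "'w \<Rightarrow> 'a \<Rightarrow> real" and u :: "real \<Rightarrow> 'w \<Rightarrow> 'a \<Rightarrow> real"
  assumes u0: "u0 \<in> P \<rightarrow>\<^sub>M L2_borel \<mu>"
    and u0_indep: "indep_set (sets (vimage_algebra (space P) u0 (L2_borel \<mu>))) (sets (W_sigma P \<mu> W {0..}))"
    and u: "neumann_mild_solution P Fil W \<mu> \<phi> lam \<alpha> u0 u"
begin

definition B :: "real \<Rightarrow> 'w \<Rightarrow> real" where "B t = W t (\<phi> 1)"

definition X :: "real \<Rightarrow> 'w \<Rightarrow> 'a \<Rightarrow> real" where "X t \<omega> = (\<lambda>x. u t \<omega> x - B t \<omega> * \<phi> 1 x)"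

lemma u0_L2: "\<omega> \<in> space P \<Longrightarrow> u0 \<omega> \<in> L2 \<mu>"
  using measurable_space[OF u0] by simp

lemma u0_inner_meas: "1 \<le> k \<Longrightarrow> (\<lambda>\<omega>. l2_inner \<mu> (u0 \<omega>) (\<phi> k)) \<in> borel_measurable P"
  by (rule measurable_compose[OF u0 borel_measurable_l2_inner]) auto

text \<open>The section at time \<open>t\<close> of each generator of the predictable sigma-algebra
  is an event or empty.\<close>

lemma u_meas:
  assumes t: "0 \<le> t"
  shows "u t \<in> P \<rightarrow>\<^sub>M L2_borel \<mu>"
proof -
  have "(\<lambda>\<omega>. (t, \<omega>)) \<in> P \<rightarrow>\<^sub>M predictable_sigma P Fil"
    unfolding predictable_sigma_def
  proof (rule measurable_measure_of)
    show "{{0} \<times> A |A. A \<in> sets (Fil 0)} \<union> {{s<..t} \<times> A |s t A. 0 \<le> s \<and> s \<le> t \<and> A \<in> sets (Fil s)}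
        \<subseteq> Pow ({0..} \<times> space P)"
      using sets.sets_into_space[of _ "Fil _"] by (fastforce simp: subset_eq)
    show "(\<lambda>\<omega>. (t, \<omega>)) \<in> space P \<rightarrow> {0..} \<times> space P" using t by auto
    have sub: "sets (Fil s) \<subseteq> sets P" for s
      using subalg by (simp add: subalgebra_def)
    fix D assume "D \<in> {{0} \<times> A |A. A \<in> sets (Fil 0)} \<union> {{s<..t} \<times> A |s t A. 0 \<le> s \<and> s \<le> t \<and> A \<in> sets (Fil s)}"
    then obtain S A s where D: "D = S \<times> A" "A \<in> sets (Fil s)" by blast
    then have A: "A \<in> sets P" using sub by auto
    have "(\<lambda>\<omega>. (t, \<omega>)) -` D \<inter> space P = (if t \<in> S then A else {})"
      using sets.sets_into_space[OF A] by (auto simp: D)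
    then show "(\<lambda>\<omega>. (t, \<omega>)) -` D \<inter> space P \<in> sets P"
      using A by simp
  qed
  moreover have "(\<lambda>(t, \<omega>). u t \<omega>) \<in> predictable_sigma P Fil \<rightarrow>\<^sub>M L2_borel \<mu>"
    using u by (simp add: neumann_mild_solution_def)
  ultimately have "(\<lambda>\<omega>. (\<lambda>(t, \<omega>). u t \<omega>) (t, \<omega>)) \<in> P \<rightarrow>\<^sub>M L2_borel \<mu>"
    by (rule measurable_compose)
  then show ?thesis by simp
qed

lemma u_L2: "0 \<le> t \<Longrightarrow> \<omega> \<in> space P \<Longrightarrow> u t \<omega> \<in> L2 \<mu>"
  using measurable_space[OF u_meas] by simp

lemma B_meas: "0 \<le> t \<Longrightarrow> B t \<in> borel_measurable P"
  unfolding B_def by (rule W_meas) auto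

lemma X_L2: "0 \<le> t \<Longrightarrow> \<omega> \<in> space P \<Longrightarrow> X t \<omega> \<in> L2 \<mu>"
  unfolding X_def by (intro L2_diff L2_scale u_L2 phi_L2) auto

lemma X_inner:
  assumes "0 \<le> t" "\<omega> \<in> space P" "1 \<le> k"
  shows "l2_inner \<mu> (X t \<omega>) (\<phi> k) = l2_inner \<mu> (u t \<omega>) (\<phi> k) - (if k = 1 then B t \<omega> else 0)"
  unfolding X_def using assms phi_inner[of 1 k] u_L2[OF assms(1,2)]
  by (subst l2_inner_diff_left) (auto simp: l2_inner_scale_left)

lemma X_inner_meas:
  assumes "0 \<le> t" "1 \<le> k"
  shows "(\<lambda>\<omega>. l2_inner \<mu> (X t \<omega>) (\<phi> k)) \<in> borel_measurable P"
proof -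
  have [measurable]: "(\<lambda>\<omega>. l2_inner \<mu> (u t \<omega>) (\<phi> k)) \<in> borel_measurable P" "B t \<in> borel_measurable P"
    using measurable_compose[OF u_meas[OF assms(1)] borel_measurable_l2_inner] B_meas assms by auto
  have "(\<lambda>\<omega>. l2_inner \<mu> (u t \<omega>) (\<phi> k) - (if k = 1 then B t \<omega> else 0)) \<in> borel_measurable P"
    by measurable
  then show ?thesis
    using X_inner[OF assms(1) _ assms(2)]
    by (subst measurable_cong[where g = "\<lambda>\<omega>. l2_inner \<mu> (u t \<omega>) (\<phi> k) - (if k = 1 then B t \<omega> else 0)"]) auto
qed

lemma X_meas: "0 \<le> t \<Longrightarrow> X t \<in> P \<rightarrow>\<^sub>M L2_borel \<mu>"
  by (rule measurable_L2_borelI) (auto intro: X_L2 X_inner_meas)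

text \<open>Since lam 1 = 0 and the noise coefficient at 1 equals 1, the first mode of the
  stochastic convolution is the bare indicator of (0, t] in the direction \<open>\<phi> 1\<close>,
  i.e. the integrand of \<open>B t\<close>.\<close>

lemma B_wiener_integral:
  assumes t: "0 \<le> t"
  shows "wiener_integral (B t) (mode t 1)"
proof -
  have "comb_sum W [(1, t, \<phi> 1)] = B t"
    by (auto simp: B_def)
  moreover have "comb_fun [(1, t, \<phi> 1)] = mode t 1"
    unfolding mode_def profile_1 by auto
  moreover have "comb_on \<mu> [(1, t, \<phi> 1)]"
    using t by auto
  ultimately show ?thesis
    using wiener_integral_comb[of "[(1, t, \<phi> 1)]"] by simp
qed

text \<open>The integrand of the random part of the \<open>k\<close>-th coordinate of
  \<open>X t\<close>: subtracting \<open>B\<close> cancels the first mode exactly and leaves the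
  others alone.\<close>

definition residual_mode :: "real \<Rightarrow> nat \<Rightarrow> real \<times> 'a \<Rightarrow> real" where
  "residual_mode t k = (if k = 1 then (\<lambda>_. 0) else mode t k)"

lemma stochastic_convolution_exists:
  assumes "0 \<le> t"
  obtains I where "has_stochastic_integral P W \<mu> \<phi> (\<lambda>s. Phi t s) t I"
    and "AE \<omega> in P. AE x in \<mu>. u t \<omega> x = semigroup \<mu> \<phi> lam t (u0 \<omega>) x + I \<omega> x"
  using u assms unfolding neumann_mild_solution_def by blast

text \<open>The mild formula read in one coordinate. The variable \<open>G\<close> is existential
  because the stochastic integral is a separate object for each \<open>t\<close>. For k = 1 it is a
  version of the integral of 0, as \<open>B\<close> cancels the noise.\<close>

lemma X_component:
  assumes t: "0 \<le> t" and k: "1 \<le> k"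
  shows "\<exists>G. wiener_integral G (residual_mode t k) \<and>
    (AE \<omega> in P. l2_inner \<mu> (X t \<omega>) (\<phi> k) = exp (- t * lam k) * l2_inner \<mu> (u0 \<omega>) (\<phi> k) + G \<omega>)"
proof -
  obtain I where I: "has_stochastic_integral P W \<mu> \<phi> (\<lambda>s. Phi t s) t I"
    and ae: "AE \<omega> in P. AE x in \<mu>. u t \<omega> x = semigroup \<mu> \<phi> lam t (u0 \<omega>) x + I \<omega> x"
    by (rule stochastic_convolution_exists[OF t])
  have I_meas: "I \<in> P \<rightarrow>\<^sub>M L2_borel \<mu>"
    using I by (simp add: has_stochastic_integral_def)
  have I_L2: "I \<omega> \<in> L2 \<mu>" if "\<omega> \<in> space P" for \<omega>
    using measurable_space[OF I_meas that] by simp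
  have u_inner: "AE \<omega> in P. l2_inner \<mu> (u t \<omega>) (\<phi> k)
      = exp (- t * lam k) * l2_inner \<mu> (u0 \<omega>) (\<phi> k) + l2_inner \<mu> (I \<omega>) (\<phi> k)"
    using ae AE_space
  proof eventually_elim
    case (elim \<omega>)
    note S = semigroup_L2[of t "u0 \<omega>"] and Io = I_L2[OF elim(2)]
    have "l2_inner \<mu> (u t \<omega>) (\<phi> k) = l2_inner \<mu> (\<lambda>x. semigroup \<mu> \<phi> lam t (u0 \<omega>) x + I \<omega> x) (\<phi> k)"
      using elim t k by (intro l2_inner_cong_AE L2_measurable u_L2 L2_add S Io phi_L2) auto
    then show ?case
      using k t S Io u0_L2[OF elim(2)] by (simp add: l2_inner_add_left inner_semigroup)
  qed
  note Ik = stochastic_integral_component[OF I k]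
  show ?thesis
  proof (cases "k = 1")
    case True
    have "wiener_integral (\<lambda>\<omega>. 1 * l2_inner \<mu> (I \<omega>) (\<phi> k) + (-1) * B t \<omega>) (\<lambda>z. 1 * mode t k z + (-1) * mode t 1 z)"
      by (rule wiener_integral_lin[OF Ik B_wiener_integral[OF t]])
    then have "wiener_integral (\<lambda>\<omega>. l2_inner \<mu> (I \<omega>) (\<phi> k) - B t \<omega>) (residual_mode t k)"
      by (simp add: True residual_mode_def)
    moreover have "AE \<omega> in P. l2_inner \<mu> (X t \<omega>) (\<phi> k)
        = exp (- t * lam k) * l2_inner \<mu> (u0 \<omega>) (\<phi> k) + (l2_inner \<mu> (I \<omega>) (\<phi> k) - B t \<omega>)"
      using u_inner AE_space by eventually_elim (use X_inner[OF t _ k] in \<open>simp add: True\<close>)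
    ultimately show ?thesis by blast
  next
    case False
    have "AE \<omega> in P. l2_inner \<mu> (X t \<omega>) (\<phi> k)
        = exp (- t * lam k) * l2_inner \<mu> (u0 \<omega>) (\<phi> k) + l2_inner \<mu> (I \<omega>) (\<phi> k)"
      using u_inner AE_space by eventually_elim (use False in \<open>simp add: X_inner[OF t _ k]\<close>)
    then show ?thesis
      using Ik False by (auto simp: residual_mode_def)
  qed
qed

lemma residual_mode_L2: "1 \<le> k \<Longrightarrow> residual_mode t k \<in> L2 K"
  by (auto simp: residual_mode_def intro: mode_L2)

section \<open>Orthogonality of the modes and joint characteristic functions\<close>

lemma inner_mode:
  assumes "1 \<le> j" "1 \<le> k" "j \<noteq> k"
  shows "l2_inner K (mode s j) (mode t k) = 0"
  unfolding mode_def[abs_def] using assms phi_inner[of j k]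
  by (subst inner_tensor) (auto intro: profile_L2)

lemma norm_residual_mode:
  assumes "1 \<le> k" "0 \<le> t"
  shows "(l2_norm K (residual_mode t k))\<^sup>2 = (stationary_sd k)\<^sup>2 * (1 - (exp (- t * lam k))\<^sup>2)"
proof (cases "k = 1")
  case True
  then show ?thesis by (simp add: residual_mode_def)
next
  case False
  then have "2 \<le> k" using assms by simp
  then show ?thesis
    using False assms norm_tensor[of "profile t k" "\<phi> k"] norm_phi[of k] profile_L2[of k t]
    by (simp add: residual_mode_def mode_def[abs_def] norm_profile_stationary_sd)
qed

lemma inner_residual_mode: "1 \<le> j \<Longrightarrow> 1 \<le> k \<Longrightarrow> j \<noteq> k \<Longrightarrow> l2_inner K (residual_mode s j) (residual_mode t k) = 0"
  using inner_mode[of j k s t] by (auto simp: residual_mode_def l2_inner_commute[of _ _ "\<lambda>_. 0"])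

lemma inner_mode_residual_mode: "1 \<le> k \<Longrightarrow> l2_inner K (mode s 1) (residual_mode t k) = 0"
  using inner_mode[of 1 k s t] by (auto simp: residual_mode_def l2_inner_commute[of _ _ "\<lambda>_. 0"])

text \<open>\<open>B\<close> and the components of \<open>X\<close> are driven by orthogonal directions of \<open>W\<close>, and \<open>u0\<close> is
  independent of \<open>W\<close>; hence the joint characteristic function factorises.\<close>

lemma char_B_X:
  assumes J: "finite J" "J \<subseteq> {0..}" and L: "finite L" "L \<subseteq> {0..} \<times> {1..}"
  shows "(CLINT \<omega>|P. iexp ((\<Sum>s\<in>J. a s * B s \<omega>) + (\<Sum>p\<in>L. b p * l2_inner \<mu> (X (fst p) \<omega>) (\<phi> (snd p)))))
    = complex_of_real (exp (- (l2_norm K (\<lambda>z. \<Sum>s\<in>J. a s * mode s 1 z))\<^sup>2 / 2)) *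
      (complex_of_real (exp (- (l2_norm K (\<lambda>z. \<Sum>p\<in>L. b p * residual_mode (fst p) (snd p) z))\<^sup>2 / 2)) *
        (CLINT \<omega>|P. iexp (\<Sum>p\<in>L. b p * exp (- fst p * lam (snd p)) * l2_inner \<mu> (u0 \<omega>) (\<phi> (snd p)))))"
proof -
  have Lp: "0 \<le> fst p" "1 \<le> snd p" if "p \<in> L" for p
    using L that by auto
  have "\<forall>p\<in>L. \<exists>G. wiener_integral G (residual_mode (fst p) (snd p)) \<and>
    (AE \<omega> in P. l2_inner \<mu> (X (fst p) \<omega>) (\<phi> (snd p))
      = exp (- fst p * lam (snd p)) * l2_inner \<mu> (u0 \<omega>) (\<phi> (snd p)) + G \<omega>)"
    using X_component Lp by blast
  from bchoice[OF this] obtain G where *: "\<forall>p\<in>L. wiener_integral (G p) (residual_mode (fst p) (snd p)) \<and>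
    (AE \<omega> in P. l2_inner \<mu> (X (fst p) \<omega>) (\<phi> (snd p))
      = exp (- fst p * lam (snd p)) * l2_inner \<mu> (u0 \<omega>) (\<phi> (snd p)) + G p \<omega>)" ..
  have G: "wiener_integral (G p) (residual_mode (fst p) (snd p))"
    and GX: "AE \<omega> in P. l2_inner \<mu> (X (fst p) \<omega>) (\<phi> (snd p))
      = exp (- fst p * lam (snd p)) * l2_inner \<mu> (u0 \<omega>) (\<phi> (snd p)) + G p \<omega>" if "p \<in> L" for p
    using bspec[OF * that] by auto
  define U where "U \<omega> = (\<Sum>p\<in>L. b p * exp (- fst p * lam (snd p)) * l2_inner \<mu> (u0 \<omega>) (\<phi> (snd p)))" for \<omega>
  define V1 where "V1 \<omega> = (\<Sum>s\<in>J. a s * B s \<omega>)" for \<omega>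
  define V2 where "V2 \<omega> = (\<Sum>p\<in>L. b p * G p \<omega>)" for \<omega>
  let ?F1 = "\<lambda>z. \<Sum>s\<in>J. a s * mode s 1 z"
  let ?F2 = "\<lambda>z. \<Sum>p\<in>L. b p * residual_mode (fst p) (snd p) z"
  have V1: "wiener_integral V1 ?F1"
    unfolding V1_def using J by (intro wiener_integral_sum B_wiener_integral) auto
  have V2: "wiener_integral V2 ?F2"
    unfolding V2_def by (intro wiener_integral_sum G)
  have V: "wiener_integral (\<lambda>\<omega>. V1 \<omega> + V2 \<omega>) (\<lambda>z. ?F1 z + ?F2 z)"
    using wiener_integral_lin[OF V1 V2, of 1 1] by simp
  let ?S = "vimage_algebra (space P) u0 (L2_borel \<mu>)"
  have U_S: "U \<in> borel_measurable ?S"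
    unfolding U_def
  proof (intro borel_measurable_sum borel_measurable_times)
    fix p assume "p \<in> L"
    have "u0 \<in> ?S \<rightarrow>\<^sub>M L2_borel \<mu>"
      using measurable_space[OF u0] by (intro measurable_vimage_algebra1) auto
    then show "(\<lambda>\<omega>. l2_inner \<mu> (u0 \<omega>) (\<phi> (snd p))) \<in> borel_measurable ?S"
      by (rule measurable_compose[OF _ borel_measurable_l2_inner]) (use Lp[OF \<open>p \<in> L\<close>] in auto)
  qed auto
  have U [measurable]: "U \<in> borel_measurable P"
    unfolding U_def using Lp by (intro borel_measurable_sum borel_measurable_times u0_inner_meas) auto
  have [measurable]: "V1 \<in> borel_measurable P" "V2 \<in> borel_measurable P"
    using V1 V2 by (auto dest: wiener_integral_meas)
  have eq: "AE \<omega> in P. V1 \<omega> + (\<Sum>p\<in>L. b p * l2_inner \<mu> (X (fst p) \<omega>) (\<phi> (snd p))) = U \<omega> + (V1 \<omega> + V2 \<omega>)"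
  proof -
    have "AE \<omega> in P. \<forall>p\<in>L. l2_inner \<mu> (X (fst p) \<omega>) (\<phi> (snd p))
      = exp (- fst p * lam (snd p)) * l2_inner \<mu> (u0 \<omega>) (\<phi> (snd p)) + G p \<omega>"
      using GX L(1) by (intro AE_finite_allI) auto
    then show ?thesis
    proof eventually_elim
      case (elim \<omega>)
      have "(\<Sum>p\<in>L. b p * l2_inner \<mu> (X (fst p) \<omega>) (\<phi> (snd p))) = U \<omega> + V2 \<omega>"
        unfolding U_def V2_def sum.distrib[symmetric] using elim by (intro sum.cong) (auto simp: distrib_left)
      then show ?case by simp
    qed
  qed
  have Xm: "(\<lambda>\<omega>. \<Sum>p\<in>L. b p * l2_inner \<mu> (X (fst p) \<omega>) (\<phi> (snd p))) \<in> borel_measurable P"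
    using Lp by (intro borel_measurable_sum borel_measurable_times X_inner_meas) auto
  have "(CLINT \<omega>|P. iexp (V1 \<omega> + (\<Sum>p\<in>L. b p * l2_inner \<mu> (X (fst p) \<omega>) (\<phi> (snd p)))))
      = (CLINT \<omega>|P. iexp (U \<omega> + (V1 \<omega> + V2 \<omega>)))"
  proof (rule integral_cong_AE)
    show "(\<lambda>\<omega>. iexp (V1 \<omega> + (\<Sum>p\<in>L. b p * l2_inner \<mu> (X (fst p) \<omega>) (\<phi> (snd p))))) \<in> borel_measurable P"
      by (intro iexp_measurable borel_measurable_add Xm) auto
    show "AE \<omega> in P. iexp (V1 \<omega> + (\<Sum>p\<in>L. b p * l2_inner \<mu> (X (fst p) \<omega>) (\<phi> (snd p)))) = iexp (U \<omega> + (V1 \<omega> + V2 \<omega>))"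
      using eq by eventually_elim (simp only:)
  qed (intro iexp_measurable borel_measurable_add; measurable)
  \<comment> \<open>\<open>V1 + V2\<close> is treated as one integral, whose variance is split
    afterwards. Independence of \<open>u0\<close> enters against finite combinations only, which are
    measurable for the sigma-algebra of \<open>W\<close>.\<close>
  also have "\<dots> = (CLINT \<omega>|P. iexp (U \<omega>)) * complex_of_real (exp (- (l2_norm K (\<lambda>z. ?F1 z + ?F2 z))\<^sup>2 / 2))"
  proof (rule wiener_integral_char[OF V U])
    fix xs :: "'a comb" assume xs: "comb_on \<mu> xs"
    have "indep_var borel U borel (comb_sum W xs)"
      by (rule indep_var_if_indep_set[OF u0_indep _ _ U_S comb_sum_W_sigma[OF xs]]) (auto simp: W_sigma_def)
    from char_distr_add[OF this, of 1] comb_sum_meas[OF xs]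
    show "(CLINT \<omega>|P. iexp (U \<omega> + comb_sum W xs \<omega>))
      = (CLINT \<omega>|P. iexp (U \<omega>)) * (CLINT \<omega>|P. iexp (comb_sum W xs \<omega>))"
      by (simp add: char_def integral_distr del: of_real_add)
  qed
  \<comment> \<open>Here \<open>B\<close> separates from the rest: the first mode is orthogonal to
    every residual mode, for all pairs of times.\<close>
  also have "(l2_norm K (\<lambda>z. ?F1 z + ?F2 z))\<^sup>2 = (l2_norm K ?F1)\<^sup>2 + (l2_norm K ?F2)\<^sup>2"
  proof -
    have m: "mode s 1 \<in> L2 K" for s by (rule mode_L2) simp
    have F1: "?F1 \<in> L2 K" by (intro L2_sum L2_scale m)
    have F2: "?F2 \<in> L2 K" using Lp by (intro L2_sum L2_scale residual_mode_L2) auto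
    have "l2_inner K (mode s 1) ?F2 = 0" for s
    proof -
      have "l2_inner K ?F2 (mode s 1) = (\<Sum>p\<in>L. l2_inner K (\<lambda>z. b p * residual_mode (fst p) (snd p) z) (mode s 1))"
        using Lp m by (intro l2_inner_sum_left L2_scale residual_mode_L2) auto
      also have "\<dots> = 0"
        using Lp inner_mode_residual_mode
        by (intro sum.neutral) (auto simp: l2_inner_scale_left l2_inner_commute[of _ _ "mode s (Suc 0)"])
      finally show ?thesis by (simp add: l2_inner_commute)
    qed
    then have "l2_inner K ?F1 ?F2 = 0"
      using m F2 by (subst l2_inner_sum_left) (auto simp: l2_inner_scale_left)
    then show ?thesis
      using l2_norm_add_square[OF F1 F2] by simp
  qed
  finally have "(CLINT \<omega>|P. iexp (V1 \<omega> + (\<Sum>p\<in>L. b p * l2_inner \<mu> (X (fst p) \<omega>) (\<phi> (snd p)))))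
      = (CLINT \<omega>|P. iexp (U \<omega>)) * complex_of_real (exp (- (l2_norm K ?F1)\<^sup>2 / 2) * exp (- (l2_norm K ?F2)\<^sup>2 / 2))"
    by (simp only: exp_add[symmetric] minus_add_distrib add_divide_distrib) 
  then show ?thesis
    unfolding V1_def U_def by (simp only: of_real_mult mult_ac)
qed

lemma char_B:
  assumes J: "finite J" "J \<subseteq> {0..}"
  shows "(CLINT \<omega>|P. iexp (\<Sum>s\<in>J. a s * B s \<omega>))
    = complex_of_real (exp (- (l2_norm K (\<lambda>z. \<Sum>s\<in>J. a s * mode s 1 z))\<^sup>2 / 2))"
  using char_B_X[OF J, of "{}" a "\<lambda>_. 0"] by (simp add: prob_space)

lemma char_X:
  assumes L: "finite L" "L \<subseteq> {0..} \<times> {1..}"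
  shows "(CLINT \<omega>|P. iexp (\<Sum>p\<in>L. b p * l2_inner \<mu> (X (fst p) \<omega>) (\<phi> (snd p))))
    = complex_of_real (exp (- (l2_norm K (\<lambda>z. \<Sum>p\<in>L. b p * residual_mode (fst p) (snd p) z))\<^sup>2 / 2)) *
        (CLINT \<omega>|P. iexp (\<Sum>p\<in>L. b p * exp (- fst p * lam (snd p)) * l2_inner \<mu> (u0 \<omega>) (\<phi> (snd p))))"
  using char_B_X[of "{}" L "\<lambda>_. 0" b] L by simp

text \<open>At one time all residual modes are mutually orthogonal, so the variance is a sum over
  the coordinates. Over several times modes with equal \<open>k\<close> would interact, hence the
  undivided norm in \<open>char_X\<close>.\<close>

lemma char_X_time:
  assumes t: "0 \<le> t" and H: "finite H" "H \<subseteq> {1..}"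
  shows "(CLINT \<omega>|P. iexp (lin H b (X t \<omega>)))
    = complex_of_real (exp (- (\<Sum>k\<in>H. (b k)\<^sup>2 * (1 - (exp (- t * lam k))\<^sup>2) * (stationary_sd k)\<^sup>2) / 2)) *
        (CLINT \<omega>|P. iexp (\<Sum>k\<in>H. b k * exp (- t * lam k) * l2_inner \<mu> (u0 \<omega>) (\<phi> k)))"
proof -
  let ?L = "Pair t ` H"
  have L: "finite ?L" "?L \<subseteq> {0..} \<times> {1..}" using H t by auto
  have inj: "inj_on (Pair t) H" by (auto simp: inj_on_def)
  have Hk: "1 \<le> k" if "k \<in> H" for k using H that by auto
  have "(l2_norm K (\<lambda>z. \<Sum>k\<in>H. b k * residual_mode t k z))\<^sup>2 = (\<Sum>k\<in>H. (l2_norm K (\<lambda>z. b k * residual_mode t k z))\<^sup>2)"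
  proof (rule l2_norm_sum_orthogonal[OF H(1)])
    show "(\<lambda>z. b k * residual_mode t k z) \<in> L2 K" if "k \<in> H" for k
      using residual_mode_L2 Hk[OF that] by auto
    show "l2_inner K (\<lambda>z. b j * residual_mode t j z) (\<lambda>z. b k * residual_mode t k z) = 0" if "j \<in> H" "k \<in> H" "j \<noteq> k" for j k
    proof -
      have "l2_inner K (residual_mode t j) (\<lambda>z. b k * residual_mode t k z) = b k * l2_inner K (residual_mode t k) (residual_mode t j)"
        by (simp add: l2_inner_commute[of _ "residual_mode t j"] l2_inner_scale_left)
      then show ?thesis
        using inner_residual_mode[of k j t t] Hk that by (simp add: l2_inner_scale_left)
    qed
  qed
  also have "\<dots> = (\<Sum>k\<in>H. (b k)\<^sup>2 * (1 - (exp (- t * lam k))\<^sup>2) * (stationary_sd k)\<^sup>2)"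
    using Hk t by (intro sum.cong refl) (simp add: l2_norm_scale power_mult_distrib norm_residual_mode)
  finally show ?thesis
    using char_X[OF L, of "\<lambda>p. b (snd p)"] by (simp only: sum.reindex[OF inj] o_def fst_conv snd_conv)
qed

section \<open>Independence of the two processes and the Wiener property\<close>

lemma process_sigma_X_subset:
  "sets (process_sigma P (L2_borel \<mu>) X {0..})
    \<subseteq> sets (process_sigma P borel (\<lambda>p \<omega>. l2_inner \<mu> (X (fst p) \<omega>) (\<phi> (snd p))) ({0..} \<times> {1..}))"
proof (rule sets_process_sigma_subset)
  fix t :: real assume "t \<in> {0..}"
  then have t: "0 \<le> t" by simp
  show "X t \<in> process_sigma P borel (\<lambda>p \<omega>. l2_inner \<mu> (X (fst p) \<omega>) (\<phi> (snd p))) ({0..} \<times> {1..}) \<rightarrow>\<^sub>M L2_borel \<mu>"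
  proof (rule measurable_L2_borelI)
    fix k :: nat assume "1 \<le> k"
    then show "(\<lambda>\<omega>. l2_inner \<mu> (X t \<omega>) (\<phi> k))
        \<in> borel_measurable (process_sigma P borel (\<lambda>p \<omega>. l2_inner \<mu> (X (fst p) \<omega>) (\<phi> (snd p))) ({0..} \<times> {1..}))"
      using measurable_process_sigma[of "(t, k)" "{0..} \<times> {1..}" P
          "\<lambda>p \<omega>. l2_inner \<mu> (X (fst p) \<omega>) (\<phi> (snd p))" borel] t by simp
  qed (use X_L2[OF t] in auto)
qed simp

lemma indep_B_X:
  "indep_set (sets (process_sigma P borel B {0..})) (sets (process_sigma P (L2_borel \<mu>) X {0..}))"
proof -
  have "indep_set (sets (process_sigma P borel B {0..}))
    (sets (process_sigma P borel (\<lambda>p \<omega>. l2_inner \<mu> (X (fst p) \<omega>) (\<phi> (snd p))) ({0..} \<times> {1..})))"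
  proof (rule indep_set_process_sigma_if_char)
    fix J L and a :: "real \<Rightarrow> real" and b :: "real \<times> nat \<Rightarrow> real"
    assume J: "finite J" "J \<subseteq> {0::real..}" and L: "finite L" "L \<subseteq> {0::real..} \<times> {1::nat..}"
    show "(CLINT \<omega>|P. iexp ((\<Sum>s\<in>J. a s * B s \<omega>) + (\<Sum>p\<in>L. b p * l2_inner \<mu> (X (fst p) \<omega>) (\<phi> (snd p)))))
      = (CLINT \<omega>|P. iexp (\<Sum>s\<in>J. a s * B s \<omega>)) *
        (CLINT \<omega>|P. iexp (\<Sum>p\<in>L. b p * l2_inner \<mu> (X (fst p) \<omega>) (\<phi> (snd p))))"
      unfolding char_B_X[OF J L] char_B[OF J] char_X[OF L] ..
  qed (auto intro: B_meas X_inner_meas prob_space_axioms)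
  then show ?thesis
    unfolding indep_sets2_eq using process_sigma_X_subset by blast
qed

text \<open>As \<open>\<phi> 1\<close> is a unit vector, \<open>B\<close> is a Wiener process for
  \<open>Fil\<close>; independence of the increments persists for the smaller filtration generated
  by \<open>B\<close>.\<close>

lemma B_wiener_process: "wiener_process P (\<lambda>t. process_sigma P borel B {0..t}) B"
proof -
  have W1: "wiener_process P Fil B"
    unfolding B_def by (rule W_unit) (auto simp: norm_phi)
  have sub: "sets (process_sigma P borel B {0..s}) \<subseteq> sets (Fil s)" for s
  proof (rule sets_process_sigma_subset)
    fix i assume "i \<in> {0..s}"
    then show "B i \<in> borel_measurable (Fil s)"
      unfolding B_def by (intro Fil_measurable_mono[of i s] W_Fil) auto
  qed simp
  show ?thesis
    unfolding wiener_process_def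
  proof (intro conjI allI impI)
    fix t :: real assume "0 \<le> t"
    then show "B t \<in> borel_measurable (process_sigma P borel B {0..t})"
      by (intro measurable_process_sigma) auto
  next
    show "AE \<omega> in P. B 0 \<omega> = 0" "AE \<omega> in P. continuous_on {0..} (\<lambda>t. B t \<omega>)"
      using W1 by (simp_all add: wiener_process_def)
  next
    fix s t :: real assume st: "0 \<le> s" "s < t"
    show "distributed P lborel (\<lambda>\<omega>. B t \<omega> - B s \<omega>) (normal_density 0 (sqrt (t - s)))"
      using W1 st by (simp add: wiener_process_def)
    have "indep_set (sets (Fil s)) (sets (vimage_algebra (space P) (\<lambda>\<omega>. B t \<omega> - B s \<omega>) borel))"
      using W1 st by (simp add: wiener_process_def)
    then show "indep_set (sets (process_sigma P borel B {0..s}))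
        (sets (vimage_algebra (space P) (\<lambda>\<omega>. B t \<omega> - B s \<omega>) borel))"
      unfolding indep_sets2_eq using sub by blast
  qed
qed

lemma B_adapted: "0 \<le> t \<Longrightarrow> B t \<in> borel_measurable (W_sigma P \<mu> W {0..t})"
  unfolding B_def W_sigma_def
  using measurable_process_sigma[of "(t, \<phi> 1)" "{0..t} \<times> L2 \<mu>" P "\<lambda>(s, h). W s h" borel] by auto

lemma summable_stationary_sd: "summable (\<lambda>k. (stationary_sd (Suc k))\<^sup>2)"
proof -
  obtain I where "has_stochastic_integral P W \<mu> \<phi> (\<lambda>s. Phi 1 s) 1 I"
    by (rule stochastic_convolution_exists[of 1]) auto
  then show ?thesis by (rule summable_stationary_sd_if_integral)
qed

end

section \<open>Stationarity and convergence\<close>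

locale heat_coupling = mild_heat \<mu> \<phi> lam \<alpha> P Fil W u0 u + gaussian_family \<mu> \<phi> lam \<alpha> Q Z
  for \<mu> :: "'a measure" and \<phi> lam \<alpha> and P :: "'w measure" and Fil W u0 u
    and Q :: "'z measure" and Z
begin

sublocale PQ: pair_prob_space P Q ..

text \<open>With \<open>\<rho> k = exp (- t * lam k)\<close> this has the law of \<open>X t\<close>; letting \<open>\<rho>\<close> tend to the
  indicator of \<open>1\<close> turns weak convergence into pointwise convergence.\<close>

definition coupling_coef :: "(nat \<Rightarrow> real) \<Rightarrow> 'w \<times> 'z \<Rightarrow> nat \<Rightarrow> real" where
  "coupling_coef \<rho> z k = \<rho> k * l2_inner \<mu> (u0 (fst z)) (\<phi> k) + sqrt (1 - (\<rho> k)\<^sup>2) * zeta (snd z) k"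

definition coupling :: "(nat \<Rightarrow> real) \<Rightarrow> 'w \<times> 'z \<Rightarrow> 'a \<Rightarrow> real" where
  "coupling \<rho> z = synth (coupling_coef \<rho> z)"

lemma coupling_meas: "coupling \<rho> \<in> P \<Otimes>\<^sub>M Q \<rightarrow>\<^sub>M L2_borel \<mu>"
  unfolding coupling_def[abs_def]
proof (rule measurable_synth)
  fix k :: nat assume "1 \<le> k"
  then have [measurable]: "(\<lambda>\<omega>. l2_inner \<mu> (u0 \<omega>) (\<phi> k)) \<in> borel_measurable P" "(\<lambda>\<omega>. zeta \<omega> k) \<in> borel_measurable Q"
    by (rule u0_inner_meas, rule zeta_meas)
  show "(\<lambda>z. coupling_coef \<rho> z k) \<in> borel_measurable (P \<Otimes>\<^sub>M Q)"
    unfolding coupling_coef_def by measurable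
qed

lemma AE_pair_zeta_summable: "AE z in P \<Otimes>\<^sub>M Q. summable (\<lambda>k. (zeta (snd z) (Suc k))\<^sup>2)"
proof -
  have eq: "distr (P \<Otimes>\<^sub>M Q) Q snd = Q"
  proof (rule measure_eqI)
    fix A assume "A \<in> sets (distr (P \<Otimes>\<^sub>M Q) Q snd)"
    then have A: "A \<in> sets Q" by simp
    have "snd -` A \<inter> space (P \<Otimes>\<^sub>M Q) = space P \<times> A"
      using sets.sets_into_space[OF A] by (auto simp: space_pair_measure)
    then show "emeasure (distr (P \<Otimes>\<^sub>M Q) Q snd) A = emeasure Q A"
      using A by (simp add: emeasure_distr Q.emeasure_pair_measure_Times emeasure_space_1)
  qed simp
  have "AE \<omega> in distr (P \<Otimes>\<^sub>M Q) Q snd. summable (\<lambda>k. (zeta \<omega> (Suc k))\<^sup>2)"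
    unfolding eq by (rule zeta_summable)
  then show ?thesis
    by (rule AE_distrD[rotated]) measurable
qed

lemma coupling_coef_square_le:
  assumes "\<bar>\<rho> k\<bar> \<le> 1"
  shows "(coupling_coef \<rho> z k)\<^sup>2 \<le> 2 * (l2_inner \<mu> (u0 (fst z)) (\<phi> k))\<^sup>2 + 2 * (zeta (snd z) k)\<^sup>2"
proof -
  let ?a = "\<rho> k * l2_inner \<mu> (u0 (fst z)) (\<phi> k)" and ?b = "sqrt (1 - (\<rho> k)\<^sup>2) * zeta (snd z) k"
  have r: "(\<rho> k)\<^sup>2 \<le> 1"
    using assms by (simp add: abs_square_le_1)
  have "(?a + ?b)\<^sup>2 \<le> 2 * ?a\<^sup>2 + 2 * ?b\<^sup>2"
    using zero_le_power2[of "?a - ?b"] by (simp only: power2_sum power2_diff)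
  also have "?a\<^sup>2 \<le> 1 * (l2_inner \<mu> (u0 (fst z)) (\<phi> k))\<^sup>2"
    unfolding power_mult_distrib using r by (intro mult_right_mono) auto
  also have "?b\<^sup>2 = (1 - (\<rho> k)\<^sup>2) * (zeta (snd z) k)\<^sup>2"
    using r by (simp add: power_mult_distrib)
  also have "\<dots> \<le> 1 * (zeta (snd z) k)\<^sup>2"
    by (intro mult_right_mono) auto
  finally show ?thesis
    by (simp add: coupling_coef_def)
qed

lemma coupling_coef_summable:
  assumes z: "z \<in> space (P \<Otimes>\<^sub>M Q)" "summable (\<lambda>k. (zeta (snd z) (Suc k))\<^sup>2)"
    and \<rho>: "\<And>k. 1 \<le> k \<Longrightarrow> \<bar>\<rho> k\<bar> \<le> 1"
  shows "summable (\<lambda>k. (coupling_coef \<rho> z (Suc k))\<^sup>2)"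
proof (rule summable_comparison_test'[where N = 0])
  have "u0 (fst z) \<in> L2 \<mu>"
    using z(1) by (auto simp: space_pair_measure intro: u0_L2)
  then show "summable (\<lambda>k. 2 * (l2_inner \<mu> (u0 (fst z)) (\<phi> (Suc k)))\<^sup>2 + 2 * (zeta (snd z) (Suc k))\<^sup>2)"
    by (intro summable_add summable_mult summable_coords z(2))
  show "norm ((coupling_coef \<rho> z (Suc n))\<^sup>2)
      \<le> 2 * (l2_inner \<mu> (u0 (fst z)) (\<phi> (Suc n)))\<^sup>2 + 2 * (zeta (snd z) (Suc n))\<^sup>2" for n
    using coupling_coef_square_le[of \<rho> "Suc n" z] \<rho>[of "Suc n"] by simp
qed

text \<open>On the product space the initial value and the equilibrium variables are independent, so
  the characteristic function factorises. The weight sqrt(1 - \<rho>^2) reproduces the variance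
  found in \<open>char_X_time\<close>.\<close>

lemma char_coupling:
  assumes H: "finite H" "H \<subseteq> {1..}" and \<rho>: "\<And>k. 1 \<le> k \<Longrightarrow> \<bar>\<rho> k\<bar> \<le> 1"
  shows "(CLINT f|distr (P \<Otimes>\<^sub>M Q) (L2_borel \<mu>) (coupling \<rho>). iexp (lin H b f))
    = complex_of_real (exp (- (\<Sum>k\<in>H. (b k)\<^sup>2 * (1 - (\<rho> k)\<^sup>2) * (stationary_sd k)\<^sup>2) / 2)) *
        (CLINT \<omega>|P. iexp (\<Sum>k\<in>H. b k * \<rho> k * l2_inner \<mu> (u0 \<omega>) (\<phi> k)))"
proof -
  let ?U = "\<lambda>\<omega>. \<Sum>k\<in>H. b k * \<rho> k * l2_inner \<mu> (u0 \<omega>) (\<phi> k)"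
  let ?V = "\<lambda>\<omega>. \<Sum>k\<in>H. (b k * sqrt (1 - (\<rho> k)\<^sup>2)) * zeta \<omega> k"
  have Hk: "1 \<le> k" if "k \<in> H" for k using H that by auto
  have U [measurable]: "?U \<in> borel_measurable P"
    using Hk by (intro borel_measurable_sum borel_measurable_times u0_inner_meas) auto
  have V [measurable]: "?V \<in> borel_measurable Q"
    using Hk by (intro borel_measurable_sum borel_measurable_times zeta_meas) auto
  have "(CLINT f|distr (P \<Otimes>\<^sub>M Q) (L2_borel \<mu>) (coupling \<rho>). iexp (lin H b f))
      = (CLINT z|P \<Otimes>\<^sub>M Q. iexp (lin H b (coupling \<rho> z)))"
    by (rule char_L2_distr[OF coupling_meas H(2)])
  also have "\<dots> = (CLINT z|P \<Otimes>\<^sub>M Q. iexp (?U (fst z)) * iexp (?V (snd z)))"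
  proof (rule integral_cong_AE)
    show "(\<lambda>z. iexp (lin H b (coupling \<rho> z))) \<in> borel_measurable (P \<Otimes>\<^sub>M Q)"
      by (rule iexp_measurable[OF measurable_compose[OF coupling_meas lin_measurable[OF H(2)]]])
    show "(\<lambda>z. iexp (?U (fst z)) * iexp (?V (snd z))) \<in> borel_measurable (P \<Otimes>\<^sub>M Q)"
      by (intro borel_measurable_times iexp_measurable measurable_compose[OF measurable_fst U]
          measurable_compose[OF measurable_snd V])
    show "AE z in P \<Otimes>\<^sub>M Q. iexp (lin H b (coupling \<rho> z)) = iexp (?U (fst z)) * iexp (?V (snd z))"
      using AE_pair_zeta_summable AE_space
    proof eventually_elim
      case (elim z)
      have "lin H b (coupling \<rho> z) = (\<Sum>k\<in>H. b k * coupling_coef \<rho> z k)"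
        unfolding coupling_def using Hk coupling_coef_summable[OF elim(2,1) \<rho>]
        by (intro sum.cong) (auto simp: inner_synth)
      also have "\<dots> = ?U (fst z) + ?V (snd z)"
        unfolding sum.distrib[symmetric] by (intro sum.cong) (auto simp: coupling_coef_def algebra_simps)
      finally show ?case
        by (simp only: of_real_add distrib_left exp_add)
    qed
  qed
  also have "\<dots> = (CLINT \<omega>|P. iexp (?U \<omega>)) * (CLINT \<omega>|Q. iexp (?V \<omega>))"
    by (rule integral_pair_mult[OF prob_space_axioms Q.prob_space_axioms])
      (auto simp del: of_real_sum of_real_mult)
  also have "(CLINT \<omega>|Q. iexp (?V \<omega>))
      = complex_of_real (exp (- (\<Sum>k\<in>H. (b k * sqrt (1 - (\<rho> k)\<^sup>2))\<^sup>2 * (stationary_sd k)\<^sup>2) / 2))"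
    by (rule char_zeta[OF H])
  also have "(\<Sum>k\<in>H. (b k * sqrt (1 - (\<rho> k)\<^sup>2))\<^sup>2 * (stationary_sd k)\<^sup>2) = (\<Sum>k\<in>H. (b k)\<^sup>2 * (1 - (\<rho> k)\<^sup>2) * (stationary_sd k)\<^sup>2)"
    using \<rho>[OF Hk] by (intro sum.cong) (auto simp: power_mult_distrib abs_square_le_1)
  finally show ?thesis by (simp only: mult.commute)
qed

lemma distr_X_eq_coupling:
  assumes t: "0 \<le> t"
  shows "distr P (L2_borel \<mu>) (X t) = distr (P \<Otimes>\<^sub>M Q) (L2_borel \<mu>) (coupling (\<lambda>k. exp (- t * lam k)))"
proof (rule L2_borel_measure_eqI)
  show "prob_space (distr P (L2_borel \<mu>) (X t))"
    by (rule prob_space_distr[OF X_meas[OF t]])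
  show "prob_space (distr (P \<Otimes>\<^sub>M Q) (L2_borel \<mu>) (coupling (\<lambda>k. exp (- t * lam k))))"
    by (rule PQ.prob_space_distr[OF coupling_meas])
  fix H :: "nat set" and b :: "nat \<Rightarrow> real"
  assume H: "finite H" "H \<subseteq> {1..}"
  have "\<bar>exp (- t * lam k)\<bar> \<le> 1" if "1 \<le> k" for k
    using exp_lam_le_1[OF t that] by simp
  then show "(CLINT f|distr P (L2_borel \<mu>) (X t). iexp (lin H b f))
      = (CLINT f|distr (P \<Otimes>\<^sub>M Q) (L2_borel \<mu>) (coupling (\<lambda>k. exp (- t * lam k))). iexp (lin H b f))"
    unfolding char_L2_distr[OF X_meas[OF t] H(2)] char_X_time[OF t H] by (subst char_coupling[OF H]) auto
qed auto

text \<open>In mode \<open>k\<close> the contracted equilibrium variance and the injected one add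
  up: \<rho>^2 + (1 - \<rho>^2) = 1. The factor \<nu> lives on the constants, which are not
  contracted at all.\<close>

lemma distr_X_stationary:
  assumes t: "0 \<le> t" and \<nu>: "l2_prob \<mu> \<nu>" "AE f in \<nu>. f \<in> H1 \<mu> \<phi>"
    and init: "distr P (L2_borel \<mu>) u0 = l2_convolution \<mu> \<nu> (nu_infinity \<mu> \<phi> lam \<alpha> Q Z)"
  shows "distr P (L2_borel \<mu>) (X t) = l2_convolution \<mu> \<nu> (nu_infinity \<mu> \<phi> lam \<alpha> Q Z)"
proof (rule L2_borel_measure_eqI)
  note conv = prob_l2_convolution[OF \<nu>(1) nu_infinity_prob]
  show "prob_space (distr P (L2_borel \<mu>) (X t))"
    by (rule prob_space_distr[OF X_meas[OF t]])
  show "prob_space (l2_convolution \<mu> \<nu> (nu_infinity \<mu> \<phi> lam \<alpha> Q Z))"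
    "sets (l2_convolution \<mu> \<nu> (nu_infinity \<mu> \<phi> lam \<alpha> Q Z)) = sets (L2_borel \<mu>)"
    using conv by (simp_all add: l2_prob_def)
  fix H :: "nat set" and b :: "nat \<Rightarrow> real"
  assume H: "finite H" "H \<subseteq> {1..}"
  have Hk: "1 \<le> k" if "k \<in> H" for k using H that by auto
  let ?\<rho> = "\<lambda>k. exp (- t * lam k)"
  have \<nu>_meas: "lin H c \<in> borel_measurable \<nu>" for c
    using lin_measurable[OF H(2), of c] \<nu>(1) by (simp add: l2_prob_def cong: measurable_cong_sets)
  \<comment> \<open>On \<open>H1\<close> only the first coordinate can be nonzero, and there \<rho>
    = 1 because lam 1 = 0.\<close>
  have \<nu>_char: "(CLINT f|\<nu>. iexp (lin H (\<lambda>k. b k * ?\<rho> k) f)) = (CLINT f|\<nu>. iexp (lin H b f))"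
  proof (rule integral_cong_AE)
    show "AE f in \<nu>. iexp (lin H (\<lambda>k. b k * ?\<rho> k) f) = iexp (lin H b f)"
      using \<nu>(2)
    proof eventually_elim
      case (elim f)
      have "b k * ?\<rho> k * l2_inner \<mu> f (\<phi> k) = b k * l2_inner \<mu> f (\<phi> k)" if "k \<in> H" for k
        using Hk[OF that] H1_inner[OF elim, of k] by (cases "k = 1") auto
      then show ?case by (simp only: cong: sum.cong)
    qed
  qed (rule iexp_measurable[OF \<nu>_meas])+
  have "(CLINT f|distr P (L2_borel \<mu>) (X t). iexp (lin H b f))
      = complex_of_real (exp (- (\<Sum>k\<in>H. (b k)\<^sup>2 * (1 - (?\<rho> k)\<^sup>2) * (stationary_sd k)\<^sup>2) / 2)) *
        (CLINT \<omega>|P. iexp (lin H (\<lambda>k. b k * ?\<rho> k) (u0 \<omega>)))"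
    unfolding char_L2_distr[OF X_meas[OF t] H(2)] by (rule char_X_time[OF t H])
  also have "(CLINT \<omega>|P. iexp (lin H (\<lambda>k. b k * ?\<rho> k) (u0 \<omega>)))
      = (CLINT f|l2_convolution \<mu> \<nu> (nu_infinity \<mu> \<phi> lam \<alpha> Q Z). iexp (lin H (\<lambda>k. b k * ?\<rho> k) f))"
    unfolding init[symmetric] by (rule char_L2_distr[OF u0 H(2), symmetric])
  also have "\<dots> = (CLINT f|\<nu>. iexp (lin H b f)) *
      complex_of_real (exp (- (\<Sum>k\<in>H. (b k * ?\<rho> k)\<^sup>2 * (stationary_sd k)\<^sup>2) / 2))"
    unfolding char_l2_convolution[OF \<nu>(1) nu_infinity_prob H] \<nu>_char char_nu_infinity[OF H] ..
  also have "complex_of_real (exp (- (\<Sum>k\<in>H. (b k)\<^sup>2 * (1 - (?\<rho> k)\<^sup>2) * (stationary_sd k)\<^sup>2) / 2)) *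
      ((CLINT f|\<nu>. iexp (lin H b f)) * complex_of_real (exp (- (\<Sum>k\<in>H. (b k * ?\<rho> k)\<^sup>2 * (stationary_sd k)\<^sup>2) / 2)))
      = (CLINT f|\<nu>. iexp (lin H b f)) * complex_of_real (exp (- (\<Sum>k\<in>H. (b k)\<^sup>2 * (stationary_sd k)\<^sup>2) / 2))"
  proof -
    have "(\<Sum>k\<in>H. (b k)\<^sup>2 * (1 - (?\<rho> k)\<^sup>2) * (stationary_sd k)\<^sup>2) + (\<Sum>k\<in>H. (b k * ?\<rho> k)\<^sup>2 * (stationary_sd k)\<^sup>2)
        = (\<Sum>k\<in>H. (b k)\<^sup>2 * (stationary_sd k)\<^sup>2)"
      unfolding sum.distrib[symmetric] by (intro sum.cong) (auto simp: power_mult_distrib algebra_simps)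
    then have "exp (- (\<Sum>k\<in>H. (b k)\<^sup>2 * (1 - (?\<rho> k)\<^sup>2) * (stationary_sd k)\<^sup>2) / 2) *
        exp (- (\<Sum>k\<in>H. (b k * ?\<rho> k)\<^sup>2 * (stationary_sd k)\<^sup>2) / 2) = exp (- (\<Sum>k\<in>H. (b k)\<^sup>2 * (stationary_sd k)\<^sup>2) / 2)"
      unfolding exp_add[symmetric] by (intro arg_cong[of _ _ exp]) (simp only: field_simps, simp)
    then show ?thesis
      by (metis (no_types) mult.left_commute of_real_mult)
  qed
  also have "\<dots> = (CLINT f|l2_convolution \<mu> \<nu> (nu_infinity \<mu> \<phi> lam \<alpha> Q Z). iexp (lin H b f))"
    unfolding char_l2_convolution[OF \<nu>(1) nu_infinity_prob H] char_nu_infinity[OF H] ..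
  finally show "(CLINT f|distr P (L2_borel \<mu>) (X t). iexp (lin H b f))
      = (CLINT f|l2_convolution \<mu> \<nu> (nu_infinity \<mu> \<phi> lam \<alpha> Q Z). iexp (lin H b f))" .
qed simp

text \<open>The pointwise limit of exp(-t lam k) as t tends to infinity.\<close>

abbreviation limit_coef :: "nat \<Rightarrow> real" where "limit_coef k \<equiv> (if k = 1 then 1 else 0)"

text \<open>With these weights the coupling keeps the first coordinate of \<open>u0\<close>, which
  is its projection, and replaces all others by equilibrium ones.\<close>

lemma limit_law_eq_coupling:
  "l2_convolution \<mu> (distr (distr P (L2_borel \<mu>) u0) (L2_borel \<mu>) (l2_proj \<mu> (H1 \<mu> \<phi>)))
      (nu_infinity \<mu> \<phi> lam \<alpha> Q Z)
    = distr (P \<Otimes>\<^sub>M Q) (L2_borel \<mu>) (coupling limit_coef)"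
    (is "l2_convolution \<mu> ?\<nu> _ = _")
proof (rule L2_borel_measure_eqI)
  have pu: "(\<lambda>\<omega>. l2_proj \<mu> (H1 \<mu> \<phi>) (u0 \<omega>)) \<in> P \<rightarrow>\<^sub>M L2_borel \<mu>"
    by (rule measurable_compose[OF u0 l2_proj_H1_measurable])
  have \<nu>_eq: "?\<nu> = distr P (L2_borel \<mu>) (\<lambda>\<omega>. l2_proj \<mu> (H1 \<mu> \<phi>) (u0 \<omega>))"
    by (subst distr_distr[OF l2_proj_H1_measurable u0]) (simp add: o_def)
  have \<nu>: "l2_prob \<mu> ?\<nu>"
    unfolding \<nu>_eq l2_prob_def using prob_space_distr[OF pu] by simp
  note conv = prob_l2_convolution[OF \<nu> nu_infinity_prob]
  show "prob_space (l2_convolution \<mu> ?\<nu> (nu_infinity \<mu> \<phi> lam \<alpha> Q Z))"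
    "sets (l2_convolution \<mu> ?\<nu> (nu_infinity \<mu> \<phi> lam \<alpha> Q Z)) = sets (L2_borel \<mu>)"
    using conv by (simp_all add: l2_prob_def)
  show "prob_space (distr (P \<Otimes>\<^sub>M Q) (L2_borel \<mu>) (coupling limit_coef))"
    by (rule PQ.prob_space_distr[OF coupling_meas])
  fix H :: "nat set" and b :: "nat \<Rightarrow> real"
  assume H: "finite H" "H \<subseteq> {1..}"
  have Hk: "1 \<le> k" if "k \<in> H" for k using H that by auto
  have "(CLINT f|?\<nu>. iexp (lin H b f)) = (CLINT \<omega>|P. iexp (lin H b (l2_proj \<mu> (H1 \<mu> \<phi>) (u0 \<omega>))))"
    unfolding \<nu>_eq by (rule char_L2_distr[OF pu H(2)])
  also have "\<dots> = (CLINT \<omega>|P. iexp (\<Sum>k\<in>H. b k * limit_coef k * l2_inner \<mu> (u0 \<omega>) (\<phi> k)))"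
  proof (rule Bochner_Integration.integral_cong[OF refl])
    fix \<omega> assume "\<omega> \<in> space P"
    note p = l2_proj_H1[OF u0_L2[OF this]]
    have "b k * l2_inner \<mu> (l2_proj \<mu> (H1 \<mu> \<phi>) (u0 \<omega>)) (\<phi> k) = b k * limit_coef k * l2_inner \<mu> (u0 \<omega>) (\<phi> k)"
      if "k \<in> H" for k
      using Hk[OF that] p H1_inner[OF p(1), of k] by (cases "k = 1") auto
    then show "iexp (lin H b (l2_proj \<mu> (H1 \<mu> \<phi>) (u0 \<omega>)))
        = iexp (\<Sum>k\<in>H. b k * limit_coef k * l2_inner \<mu> (u0 \<omega>) (\<phi> k))"
      by (simp only: cong: sum.cong)
  qed
  finally have 1: "(CLINT f|?\<nu>. iexp (lin H b f))
      = (CLINT \<omega>|P. iexp (\<Sum>k\<in>H. b k * limit_coef k * l2_inner \<mu> (u0 \<omega>) (\<phi> k)))" .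
  \<comment> \<open>The additional factor is 1 except at k = 1, where \<open>stationary_sd\<close>
    vanishes.\<close>
  have "(\<Sum>k\<in>H. (b k)\<^sup>2 * (stationary_sd k)\<^sup>2) = (\<Sum>k\<in>H. (b k)\<^sup>2 * (1 - (limit_coef k)\<^sup>2) * (stationary_sd k)\<^sup>2)"
    by (intro sum.cong) (auto simp: stationary_sd_def)
  then show "(CLINT f|l2_convolution \<mu> ?\<nu> (nu_infinity \<mu> \<phi> lam \<alpha> Q Z). iexp (lin H b f))
      = (CLINT f|distr (P \<Otimes>\<^sub>M Q) (L2_borel \<mu>) (coupling limit_coef). iexp (lin H b f))"
    unfolding char_l2_convolution[OF \<nu> nu_infinity_prob H] char_nu_infinity[OF H] 1
    by (subst char_coupling[OF H]) (simp_all only: mult.commute, simp)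
qed simp

text \<open>For k \<ge> 2 the weight of the initial coordinate is off by r = exp(-t lam k), and that
  of the equilibrium coordinate by 1 - sqrt(1 - r^2) \<le> r^2 \<le> r. The spectral gap bounds r by
  exp(-t lam 2) for all k at once, so the estimate can be summed. For k = 1 the two sets of weights
  agree.\<close>

lemma coupling_coef_diff:
  assumes t: "0 \<le> t" and k: "1 \<le> k"
  shows "(coupling_coef (\<lambda>k. exp (- t * lam k)) z k - coupling_coef limit_coef z k)\<^sup>2
    \<le> (exp (- t * lam 2))\<^sup>2 * (2 * (l2_inner \<mu> (u0 (fst z)) (\<phi> k))\<^sup>2 + 2 * (zeta (snd z) k)\<^sup>2)"
proof (cases "k = 1")
  case True
  then show ?thesis by (simp add: coupling_coef_def)
next
  case False
  then have k2: "2 \<le> k" using k by simp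
  let ?r = "exp (- t * lam k)" and ?a = "l2_inner \<mu> (u0 (fst z)) (\<phi> k)" and ?b = "zeta (snd z) k"
  have r: "0 \<le> ?r" "?r \<le> 1" using exp_lam_le_1[OF t k] by auto
  have r2: "?r \<le> exp (- t * lam 2)"
    using lam_ge[OF k2] t by (simp add: mult_left_mono)
  have sq: "?r\<^sup>2 \<le> 1" "?r\<^sup>2 \<le> ?r"
    using r by (auto simp: power2_eq_square mult_le_one mult_left_le)
  have s: "\<bar>sqrt (1 - ?r\<^sup>2) - 1\<bar> \<le> ?r"
  proof -
    \<comment> \<open>A number in [0, 1] is at most its square root.\<close>
    have "1 - ?r\<^sup>2 \<le> sqrt (1 - ?r\<^sup>2)"
      using sq by (intro real_le_rsqrt) (simp add: power2_eq_square mult_left_le)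
    moreover have "sqrt (1 - ?r\<^sup>2) \<le> 1" by simp
    ultimately show ?thesis using sq by (simp add: abs_le_iff)
  qed
  let ?c = "(sqrt (1 - ?r\<^sup>2) - 1) * ?b"
  have "coupling_coef (\<lambda>k. exp (- t * lam k)) z k - coupling_coef limit_coef z k = ?r * ?a + ?c"
    using False by (simp add: coupling_coef_def algebra_simps)
  also have "(?r * ?a + ?c)\<^sup>2 \<le> 2 * (?r * ?a)\<^sup>2 + 2 * ?c\<^sup>2"
    using zero_le_power2[of "?r * ?a - ?c"] by (simp only: power2_sum power2_diff)
  also have "?c\<^sup>2 \<le> ?r\<^sup>2 * ?b\<^sup>2"
    unfolding power_mult_distrib using s r by (intro mult_right_mono abs_le_square_iff[THEN iffD1]) auto
  also have "2 * (?r * ?a)\<^sup>2 + 2 * (?r\<^sup>2 * ?b\<^sup>2) = ?r\<^sup>2 * (2 * ?a\<^sup>2 + 2 * ?b\<^sup>2)"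
    by (simp only: power_mult_distrib distrib_left mult_ac)
  also have "\<dots> \<le> (exp (- t * lam 2))\<^sup>2 * (2 * ?a\<^sup>2 + 2 * ?b\<^sup>2)"
    using r r2 by (intro mult_right_mono power_mono) auto
  finally show ?thesis by simp
qed

text \<open>Summing the coordinate estimates by Parseval gives exponential decay at rate
  \<open>lam 2\<close>, with a constant \<open>S\<close> that depends on the sample point
  \<open>z\<close> but not on \<open>t\<close>.\<close>

lemma coupling_tendsto:
  assumes z: "z \<in> space (P \<Otimes>\<^sub>M Q)" "summable (\<lambda>k. (zeta (snd z) (Suc k))\<^sup>2)"
  shows "((\<lambda>t. l2_norm \<mu> (\<lambda>x. coupling (\<lambda>k. exp (- t * lam k)) z x - coupling limit_coef z x)) \<longlongrightarrow> 0) at_top"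
proof -
  let ?g = "\<lambda>k. 2 * (l2_inner \<mu> (u0 (fst z)) (\<phi> (Suc k)))\<^sup>2 + 2 * (zeta (snd z) (Suc k))\<^sup>2"
  have "u0 (fst z) \<in> L2 \<mu>"
    using z(1) by (auto simp: space_pair_measure intro: u0_L2)
  then have g: "summable ?g"
    by (intro summable_add summable_mult summable_coords z(2))
  define S where "S = sqrt (suminf ?g)"
  have le: "l2_norm \<mu> (\<lambda>x. coupling (\<lambda>k. exp (- t * lam k)) z x - coupling limit_coef z x) \<le> exp (- t * lam 2) * S"
    if t: "0 \<le> t" for t
  proof -
    have \<rho>: "\<bar>exp (- t * lam k)\<bar> \<le> 1" "\<bar>limit_coef k\<bar> \<le> 1" if "1 \<le> k" for k
      using exp_lam_le_1[OF t that] by auto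
    let ?d = "\<lambda>k. (coupling_coef (\<lambda>k. exp (- t * lam k)) z (Suc k) - coupling_coef limit_coef z (Suc k))\<^sup>2"
    have sums: "?d sums (l2_norm \<mu> (\<lambda>x. coupling (\<lambda>k. exp (- t * lam k)) z x - coupling limit_coef z x))\<^sup>2"
      unfolding coupling_def by (intro norm_synth_diff coupling_coef_summable z \<rho>)
    have "suminf ?d \<le> (\<Sum>k. (exp (- t * lam 2))\<^sup>2 * ?g k)"
      using sums_summable[OF sums] g coupling_coef_diff[OF t] by (intro suminf_le summable_mult) auto
    also have "\<dots> = (exp (- t * lam 2))\<^sup>2 * suminf ?g"
      by (rule suminf_mult[OF g])
    also have "\<dots> = (exp (- t * lam 2) * S)\<^sup>2"
      using suminf_nonneg[OF g] by (simp add: S_def power_mult_distrib)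
    finally have "(l2_norm \<mu> (\<lambda>x. coupling (\<lambda>k. exp (- t * lam k)) z x - coupling limit_coef z x))\<^sup>2
        \<le> (exp (- t * lam 2) * S)\<^sup>2"
      using sums_unique[OF sums] by simp
    then show ?thesis
      by (rule power2_le_imp_le) (simp add: S_def suminf_nonneg[OF g])
  qed
  have "LIM t at_top. lam 2 * t :> at_top"
    by (rule filterlim_tendsto_pos_mult_at_top[OF tendsto_const lam_2 filterlim_ident])
  then have "LIM t at_top. t * lam 2 :> at_top"
    by (simp only: mult.commute)
  then have "LIM t at_top. - (t * lam 2) :> at_bot"
    by (simp add: filterlim_uminus_at_bot)
  then have "((\<lambda>t. exp (- (t * lam 2))) \<longlongrightarrow> 0) at_top"
    by (rule filterlim_compose[OF exp_at_bot])
  then have "((\<lambda>t. exp (- t * lam 2) * S) \<longlongrightarrow> 0) at_top"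
    by (intro tendsto_mult_left_zero) simp
  then show ?thesis
    by (rule Lim_null_comparison[rotated])
      (use le in \<open>auto intro!: eventually_at_top_linorderI[of 0]\<close>)
qed

text \<open>Only laws matter, so \<open>X t\<close> may be replaced by the coupling, which converges
  in norm at almost every sample point. Continuity of \<Phi> carries this to \<Phi>, and its
  boundedness permits dominated convergence.\<close>

lemma weak_convergence:
  "l2_weak_conv \<mu> (\<lambda>t. distr P (L2_borel \<mu>) (X t))
    (l2_convolution \<mu> (distr (distr P (L2_borel \<mu>) u0) (L2_borel \<mu>) (l2_proj \<mu> (H1 \<mu> \<phi>)))
      (nu_infinity \<mu> \<phi> lam \<alpha> Q Z)) at_top"
  unfolding l2_weak_conv_def limit_law_eq_coupling
proof (intro allI impI)
  fix \<Phi> assume "continuous_map (l2_topology \<mu>) euclideanreal \<Phi> \<and> bounded (\<Phi> ` L2 \<mu>)"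
  then have cont: "continuous_map (l2_topology \<mu>) euclideanreal \<Phi>" and bdd: "bounded (\<Phi> ` L2 \<mu>)" by auto
  obtain C where C: "\<And>f. f \<in> L2 \<mu> \<Longrightarrow> norm (\<Phi> f) \<le> C"
    using bdd by (auto simp: bounded_iff)
  have \<Phi>: "\<Phi> \<in> borel_measurable (L2_borel \<mu>)"
    by (rule borel_measurable_continuous_map_l2[OF cont])
  have meas: "(\<lambda>z. \<Phi> (coupling \<rho> z)) \<in> borel_measurable (P \<Otimes>\<^sub>M Q)" for \<rho>
    by (rule measurable_compose[OF coupling_meas \<Phi>])
  have L2: "coupling \<rho> z \<in> L2 \<mu>" for \<rho> z
    unfolding coupling_def by (rule synth_L2)
  let ?Y = "\<lambda>t. coupling (\<lambda>k. exp (- t * lam k))"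
  have conv: "((\<lambda>t. \<integral>z. \<Phi> (?Y t z) \<partial>(P \<Otimes>\<^sub>M Q)) \<longlongrightarrow> (\<integral>z. \<Phi> (coupling limit_coef z) \<partial>(P \<Otimes>\<^sub>M Q))) at_top"
  proof (rule integral_dominated_convergence_at_top[where w = "\<lambda>_. C"])
    show "AE z in P \<Otimes>\<^sub>M Q. ((\<lambda>t. \<Phi> (?Y t z)) \<longlongrightarrow> \<Phi> (coupling limit_coef z)) at_top"
      using AE_pair_zeta_summable AE_space
    proof eventually_elim
      case (elim z)
      show ?case
      proof (rule tendstoI)
        fix e :: real assume "0 < e"
        then obtain d where d: "0 < d" "\<And>g. g \<in> L2 \<mu> \<Longrightarrow> l2_norm \<mu> (\<lambda>x. g x - coupling limit_coef z x) < d \<Longrightarrow>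
            \<bar>\<Phi> g - \<Phi> (coupling limit_coef z)\<bar> < e"
          using continuous_map_l2_topologyD[OF cont L2] by blast
        have "\<forall>\<^sub>F t in at_top. l2_norm \<mu> (\<lambda>x. ?Y t z x - coupling limit_coef z x) < d"
          by (rule order_tendstoD(2)[OF coupling_tendsto[OF elim(2,1)] d(1)])
        then show "\<forall>\<^sub>F t in at_top. dist (\<Phi> (?Y t z)) (\<Phi> (coupling limit_coef z)) < e"
          by eventually_elim (use d(2) L2 in \<open>auto simp: dist_real_def\<close>)
      qed
    qed
    show "\<forall>\<^sub>F t in at_top. AE z in P \<Otimes>\<^sub>M Q. norm (\<Phi> (?Y t z)) \<le> C"
      by (intro always_eventually allI AE_I2 C L2)
  qed (simp_all add: meas)
  have law: "(\<integral>f. \<Phi> f \<partial>distr P (L2_borel \<mu>) (X t)) = (\<integral>z. \<Phi> (?Y t z) \<partial>(P \<Otimes>\<^sub>M Q))" if "0 \<le> t" for t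
    unfolding distr_X_eq_coupling[OF that] by (rule integral_distr[OF coupling_meas \<Phi>])
  \<comment> \<open>The law of the coupling is identified for t \<ge> 0 only, which is enough at
    infinity.\<close>
  have "\<forall>\<^sub>F t in at_top. (\<integral>f. \<Phi> f \<partial>distr P (L2_borel \<mu>) (X t)) = (\<integral>z. \<Phi> (?Y t z) \<partial>(P \<Otimes>\<^sub>M Q))"
    by (rule eventually_at_top_linorderI[of 0]) (rule law)
  from iffD2[OF tendsto_cong[OF this] conv]
  have "((\<lambda>t. \<integral>f. \<Phi> f \<partial>distr P (L2_borel \<mu>) (X t)) \<longlongrightarrow> (\<integral>z. \<Phi> (coupling limit_coef z) \<partial>(P \<Otimes>\<^sub>M Q))) at_top"
    .
  then show "((\<lambda>t. \<integral>f. \<Phi> f \<partial>distr P (L2_borel \<mu>) (X t))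
      \<longlongrightarrow> (\<integral>f. \<Phi> f \<partial>distr (P \<Otimes>\<^sub>M Q) (L2_borel \<mu>) (coupling limit_coef))) at_top"
    by (simp add: integral_distr[OF coupling_meas \<Phi>])
qed

end

theorem theorem6p4:
  fixes M :: nat and \<psi> :: "nat \<Rightarrow> 'a::metric_space \<Rightarrow> 'a"
    and r :: "nat \<Rightarrow> real" and A0 :: "'a \<Rightarrow> 'a \<Rightarrow> real" and dH :: real and \<mu> :: "'a measure"
    and \<phi> :: "nat \<Rightarrow> 'a \<Rightarrow> real" and lam :: "nat \<Rightarrow> real" and \<alpha> :: real
    and Q :: "'z measure" and Z :: "nat \<Rightarrow> 'z \<Rightarrow> real"
    and P :: "'w measure" and Fil :: "real \<Rightarrow> 'w measure"
    and W :: "real \<Rightarrow> ('a \<Rightarrow> real) \<Rightarrow> 'w \<Rightarrow> real"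
    and u0 :: "'w \<Rightarrow> 'a \<Rightarrow> real" and u :: "real \<Rightarrow> 'w \<Rightarrow> 'a \<Rightarrow> real"
  assumes setting: "neumann_eigenbasis M \<psi> r A0 dH \<mu> \<phi> lam"
    and alpha: "0 \<le> \<alpha>"
    and Q: "prob_space Q"
    and Z_indep: "prob_space.indep_vars Q (\<lambda>_. borel) Z {1..}"
    and Z_normal: "\<And>k. 1 \<le> k \<Longrightarrow> distributed Q lborel (Z k) std_normal_density"
    and P: "prob_space P"
    and Fil: "filtration (space P) Fil" "\<And>t. subalgebra P (Fil t)"
    and W: "cylindrical_wiener_process P Fil \<mu> W"
    and u0: "u0 \<in> P \<rightarrow>\<^sub>M L2_borel \<mu>"
    and u0_indep: "prob_space.indep_set P
      (sets (vimage_algebra (space P) u0 (L2_borel \<mu>))) (sets (W_sigma P \<mu> W {0..}))"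
    and u: "neumann_mild_solution P Fil W \<mu> \<phi> lam \<alpha> u0 u"
  shows "\<exists>B :: real \<Rightarrow> 'w \<Rightarrow> real.
    wiener_process P (\<lambda>t. process_sigma P borel B {0..t}) B \<and>
    (\<forall>t\<ge>0. B t \<in> borel_measurable (W_sigma P \<mu> W {0..t})) \<and>
    prob_space.indep_set P
      (sets (process_sigma P borel B {0..}))
      (sets (process_sigma P (L2_borel \<mu>) (\<lambda>t \<omega> x. u t \<omega> x - B t \<omega> * \<phi> 1 x) {0..})) \<and>
    (\<forall>\<nu>. l2_prob \<mu> \<nu> \<and> (AE f in \<nu>. f \<in> H1 \<mu> \<phi>) \<and>
        distr P (L2_borel \<mu>) u0 = l2_convolution \<mu> \<nu> (nu_infinity \<mu> \<phi> lam \<alpha> Q Z) \<longrightarrow>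
        (\<forall>t>0. distr P (L2_borel \<mu>) (\<lambda>\<omega> x. u t \<omega> x - B t \<omega> * \<phi> 1 x)
             = l2_convolution \<mu> \<nu> (nu_infinity \<mu> \<phi> lam \<alpha> Q Z))) \<and>
    (\<forall>\<nu>0. l2_prob \<mu> \<nu>0 \<and> distr P (L2_borel \<mu>) u0 = \<nu>0 \<longrightarrow>
        l2_weak_conv \<mu> (\<lambda>t. distr P (L2_borel \<mu>) (\<lambda>\<omega> x. u t \<omega> x - B t \<omega> * \<phi> 1 x))
          (l2_convolution \<mu> (distr \<nu>0 (L2_borel \<mu>) (l2_proj \<mu> (H1 \<mu> \<phi>)))
             (nu_infinity \<mu> \<phi> lam \<alpha> Q Z)) at_top)"
proof -
  interpret E: neumann_eigenbasis M \<psi> r A0 dH \<mu> \<phi> lam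
    by (rule setting)
  interpret mu: prob_space \<mu>
    by (rule E.prob_mu)
  interpret P: prob_space P
    by (rule P)
  interpret Q: prob_space Q
    by (rule Q)
  have lam_ge: "lam 2 \<le> lam k" if "2 \<le> k" for k
    using that by (induction k rule: dec_induct) (auto intro: order_trans E.lam_mono)
  interpret mild_heat \<mu> \<phi> lam \<alpha> P Fil W u0 u
    by unfold_locales (rule E.basis E.lam_1 E.lam_2 lam_ge alpha filtration.space_F[OF Fil(1)]
        filtration.sets_F_mono[OF Fil(1)] Fil(2) W u0 u0_indep u | assumption)+
  \<comment> \<open>The summability demanded of the equilibrium law is supplied by the preceding
    interpretation: it follows from the existence of the stochastic convolution at time 1.\<close>
  interpret heat_coupling \<mu> \<phi> lam \<alpha> P Fil W u0 u Q Z
    by unfold_locales (rule Z_indep Z_normal summable_stationary_sd | assumption)+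
  note X = X_def[abs_def, symmetric]
  show ?thesis
  proof (intro exI[of _ B] conjI allI impI)
    show "wiener_process P (\<lambda>t. process_sigma P borel B {0..t}) B"
      by (rule B_wiener_process)
    show "B t \<in> borel_measurable (W_sigma P \<mu> W {0..t})" if "0 \<le> t" for t
      using that by (rule B_adapted)
    show "P.indep_set (sets (process_sigma P borel B {0..}))
      (sets (process_sigma P (L2_borel \<mu>) (\<lambda>t \<omega> x. u t \<omega> x - B t \<omega> * \<phi> 1 x) {0..}))"
      unfolding X by (rule indep_B_X)
  next
    fix \<nu> and t :: real
    assume "l2_prob \<mu> \<nu> \<and> (AE f in \<nu>. f \<in> H1 \<mu> \<phi>) \<and>
        distr P (L2_borel \<mu>) u0 = l2_convolution \<mu> \<nu> (nu_infinity \<mu> \<phi> lam \<alpha> Q Z)" and "0 < t"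
    then show "distr P (L2_borel \<mu>) (\<lambda>\<omega> x. u t \<omega> x - B t \<omega> * \<phi> 1 x)
        = l2_convolution \<mu> \<nu> (nu_infinity \<mu> \<phi> lam \<alpha> Q Z)"
      using distr_X_stationary[of t \<nu>] by (simp add: X_def[abs_def])
  next
    fix \<nu>0 assume "l2_prob \<mu> \<nu>0 \<and> distr P (L2_borel \<mu>) u0 = \<nu>0"
    then show "l2_weak_conv \<mu> (\<lambda>t. distr P (L2_borel \<mu>) (\<lambda>\<omega> x. u t \<omega> x - B t \<omega> * \<phi> 1 x))
          (l2_convolution \<mu> (distr \<nu>0 (L2_borel \<mu>) (l2_proj \<mu> (H1 \<mu> \<phi>)))
             (nu_infinity \<mu> \<phi> lam \<alpha> Q Z)) at_top"
      using weak_convergence by (auto simp: X_def[abs_def])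
  qed
qed

end
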